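(* Let $$W=\bigvee_{r=0}^\infty\bigvee_{{\bf j}\in A_r}S_{\bf j}$$ be the endogenous solution, defined in the context, to the high-order Lindley equation $W\stackrel{\mathcal D}{=}\max\{0,\max_{1\le i\le N}(\chi_i-\tau_i+W_i)\}$, with $N$ distributed according to $f$, $\{\chi,\chi_i\}$ i.i.d. with common distribution $B$, and $\{\tau_i\}$ i.i.d. exponentially distributed with rate $\lambda^*$, all random variables independent of each other. Suppose that for some $\theta>0$, $$E[N]\,E\left[e^{\theta\chi}\right]\frac{\lambda^*}{\lambda^*+\theta}=1\qquad\text{and}\qquad 0<E\left[e^{\theta\chi}\chi\right]-\frac{E\left[e^{\theta\chi}\right]}{\lambda^*+\theta}<\infty.$$ In addition, assume that for some $\epsilon>0$, $E\left[N^{\theta\vee(1+\epsilon)}\right]<\infty$. Then $$P(W>x)\sim He^{-\theta x},\qquad x\to\infty,$$ where $0<H<\infty$ is given by $$H=\frac{(\lambda^*+\theta)^2}{\theta\lambda^*E[N]}\cdot\frac{E\left[1\vee\bigvee_{i=1}^Ne^{\theta(\chi_i-\tau_i+W_i)}-\sum_{i=1}^Ne^{\theta(\chi_i-\tau_i+W_i)}\right]}{(\lambda^*+\theta)E\left[e^{\theta\chi}\chi\right]-E\left[e^{\theta\chi}\right]},$$ with the $\{W_i\}$ i.i.d. copies of $W$, independent of $(N,\chi_1,\tau_1,\dots,\chi_N,\tau_N)$.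
   Context: Here $f$ is a distribution on $\mathbb{N}_+=\{1,2,3,\dots\}$ with finite mean, $B$ is a distribution on $\mathbb{R}_+$, $\lambda>0$, and $\lambda^*=\lambda E[N]$. $x\vee y$ is the maximum of $x$ and $y$, and $g(x)\sim h(x)$ means $g(x)/h(x)\to1$ as $x\to\infty$. Let $U=\bigcup_{r\ge0}(\mathbb{N}_+)^r$ with $(\mathbb{N}_+)^0=\{\emptyset\}$; for ${\bf i}=(i_1,\dots,i_k)$ write ${\bf i}|t=(i_1,\dots,i_t)$ and $({\bf i},j)=(i_1,\dots,i_k,j)$. Let $\{N_{\bf i}\}_{{\bf i}\in U}$ be i.i.d. with distribution $f$, $\{\chi_{\bf i}\}_{{\bf i}\in U}$ i.i.d. with distribution $B$, $\{\tau_{\bf i}\}_{{\bf i}\in U}$ i.i.d. exponential with rate $\lambda^*$, all independent of each other. Set $A_0=\{\emptyset\}$, $A_r=\{({\bf i},i_r):{\bf i}\in A_{r-1},\,1\le i_r\le N_{\bf i}\}$ for $r\ge1$, $X_{\bf i}=\chi_{\bf i}-\tau_{\bf i}$, $S_\emptyset=0$ and $S_{\bf j}=X_{{\bf j}|1}+X_{{\bf j}|2}+\dots+X_{\bf j}$ for ${\bf j}\neq\emptyset$. The endogenous solution is $W=\bigvee_{r=0}^\infty\bigvee_{{\bf j}\in A_r}S_{\bf j}$ (a supremum). *)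

theory Defs
  imports "HOL-Probability.Probability" "HOL-Library.Landau_Symbols"
begin

text \<open>The node \<open>(i\<^sub>1, \<dots>, i\<^sub>k)\<close> of the tree is the list \<open>[i\<^sub>1, \<dots>, i\<^sub>k]\<close>, so that
  \<open>take t j\<close> is its ancestor of generation \<open>t\<close>.\<close>

definition nodes :: "nat list set" where
  "nodes = lists {1..}"

fun generation :: "(nat list \<Rightarrow> nat) \<Rightarrow> nat \<Rightarrow> nat list set" where
  "generation n 0 = {[]}"
| "generation n (Suc r) = {i @ [k] | i k. i \<in> generation n r \<and> 1 \<le> k \<and> k \<le> n i}"

definition walk :: "(nat list \<Rightarrow> real) \<Rightarrow> nat list \<Rightarrow> real" where
  "walk x j = (\<Sum>t = 1..length j. x (take t j))"

definition endogenous ::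
  "(nat list \<Rightarrow> 'a \<Rightarrow> nat) \<Rightarrow> (nat list \<Rightarrow> 'a \<Rightarrow> real) \<Rightarrow> (nat list \<Rightarrow> 'a \<Rightarrow> real) \<Rightarrow> 'a \<Rightarrow> ereal" where
  "endogenous N chi tau \<omega> =
     (SUP r. SUP j \<in> generation (\<lambda>i. N i \<omega>) r. ereal (walk (\<lambda>i. chi i \<omega> - tau i \<omega>) j))"

text \<open>The joint law of \<open>(N, (\<chi>\<^sub>i, \<tau>\<^sub>i, W\<^sub>i)\<^sub>i\<^sub>\<ge>\<^sub>1)\<close>, all independent, where \<open>L\<close> is the law of the
  \<open>W\<^sub>i\<close> and \<open>l\<close> the rate of the \<open>\<tau>\<^sub>i\<close>.\<close>

definition copies ::
  "nat pmf \<Rightarrow> real measure \<Rightarrow> real \<Rightarrow> ereal measure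
    \<Rightarrow> (nat \<times> (nat \<Rightarrow> real \<times> real \<times> ereal)) measure" where
  "copies f B l L =
     measure_pmf f \<Otimes>\<^sub>M
     PiM {1..} (\<lambda>_. B \<Otimes>\<^sub>M (density lborel (exponential_density l) \<Otimes>\<^sub>M L))"

text \<open>\<open>real_of_ereal\<close> sends \<open>\<infinity>\<close> to \<open>0\<close>; this is harmless, since it is used only for
  \<open>W\<^sub>i\<close> whose law has tail \<open>P(W > x) \<longlongrightarrow> 0\<close>, hence with \<open>W\<^sub>i < \<infinity>\<close> almost surely.\<close>

definition branch_weight :: "real \<Rightarrow> real \<times> real \<times> ereal \<Rightarrow> real" where
  "branch_weight \<theta> = (\<lambda>(c, t, w). exp (\<theta> * (c - t + real_of_ereal w)))"

definition max_minus_sum :: "real \<Rightarrow> nat \<times> (nat \<Rightarrow> real \<times> real \<times> ereal) \<Rightarrow> real" where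
  "max_minus_sum \<theta> = (\<lambda>(n, z).
     Max (insert 1 ((\<lambda>i. branch_weight \<theta> (z i)) ` {1..n})) - (\<Sum>i = 1..n. branch_weight \<theta> (z i)))"

end

theory Submission
  imports Defs "HOL-Real_Asymp.Real_Asymp"
begin

text \<open>Write \<open>G x = P(W > x)\<close>. Cutting the tree below the root gives, for \<open>x \<ge> 0\<close>,
  \<open>G x = E[1 - (1 - V x)^N]\<close> with \<open>V x = E[G(x - \<chi> + \<tau>)]\<close>, and induction on the depth of the tree
  gives \<open>G x \<le> exp(-\<theta> x)\<close>. Let \<open>\<eta>\<close> be the law with density \<open>E[N] exp(\<theta> u)\<close> with respect to the
  law of \<open>\<chi> - \<tau>\<close>; by the root condition it is a probability law, with positive mean \<open>\<mu>\<close>. The function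
  \<open>a x = exp(\<theta> x) G x\<close> then solves the two-sided renewal equation \<open>a = a * \<eta> + b\<close>, where
  \<open>b x = exp(\<theta> x) (G x - E[N] V x)\<close> decays exponentially at \<open>\<plusminus>\<infinity>\<close> because \<open>N\<close> has a moment of
  order \<open>1 + \<epsilon>\<close>.

  Since \<open>\<eta>\<close> charges every interval of the negative half line, a bounded Lipschitz function that is
  asymptotically \<open>\<eta>\<close>-harmonic is asymptotically invariant under translations (a Choquet--Deny
  argument); integrating the renewal equation over \<open>(-\<infinity>, x]\<close> then identifies the limit of \<open>a\<close>
  as \<open>(\<integral> b) / \<mu>\<close>. It is positive because \<open>a\<close> is superharmonic for the walk killed at an
  exponentially small rate, which reaches a bounded set with a probability bounded away from \<open>0\<close>.
  Finally \<open>\<theta> \<integral> b\<close> is the expectation in the constant \<open>H\<close>, by Fubini and the layer cake formula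
  \<open>exp(\<theta> y) = \<integral> \<theta> exp(\<theta> x) 1(x < y) dx\<close>.\<close>

section \<open>Renewal theory for a random walk with positive drift\<close>

text \<open>Three obstacles shape the argument. First, \<open>a\<close> is not known to be
  continuous, so the Choquet--Deny step is applied to \<open>a * \<eta>\<close>: the exponential
  part of the step makes this convolution Lipschitz, and \<open>a\<close> inherits the invariance
  because \<open>b\<close> tends to 0. Negative values z of the step carry \<open>x - z\<close> to
  the right, so near-maxima propagate into the region where harmonicity only gets more accurate;
  this is why \<eta> has to charge the negative half line, which \<chi> \<ge> 0 and the unbounded
  \<tau> ensure. Second, \<open>b\<close> is nonpositive on the positive half line, so the sign of
  its integral cannot be read off, and positivity of the limit needs a separate lower bound on
  \<open>a\<close>. Third, the maximum and the sum in the numerator of \<open>H\<close> both have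
  infinite expectation, since \<open>E[exp(\<theta> W)]\<close> is infinite once the limit is
  positive; only their difference is integrable, and Fubini is applied to it as a whole.\<close>

lemma filterlim_at_top_add_const: "filterlim (\<lambda>x::real. x + c) at_top at_top"
  using filterlim_tendsto_add_at_top[OF tendsto_const[of c] filterlim_ident] by (simp add: add.commute) 

locale drift_step = prob_space \<eta> for \<eta> :: "real measure" +
  assumes sets_step [measurable_cong, simp]: "sets \<eta> = sets borel"
    and step_integrable: "integrable \<eta> (\<lambda>z. z)"
    and drift_pos: "0 < expectation (\<lambda>z. z)"
begin

lemma space_step [simp]: "space \<eta> = UNIV"
  using sets_eq_imp_space_eq[OF sets_step] by simp

lemma integrable_shift_bounded:
  fixes h :: "real \<Rightarrow> real"
  assumes [measurable]: "h \<in> borel_measurable borel" and "\<And>x. \<bar>h x\<bar> \<le> C"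
  shows "integrable \<eta> (\<lambda>z. h (x - z))"
  by (rule integrable_const_bound[where B = C]) (use assms in auto)

section \<open>Asymptotically harmonic functions are asymptotically translation invariant\<close>

lemma tail_prob_small:
  assumes "0 < e"
  shows "\<exists>R\<ge>0. prob {R<..} \<le> e"
proof -
  have "((\<lambda>n. prob {real n<..}) \<longlonglongrightarrow> prob (\<Inter>n. {real n<..}))"
    by (rule finite_Lim_measure_decseq) (auto simp: decseq_def)
  moreover have "x \<notin> (\<Inter>n. {real n<..})" for x
    using reals_Archimedean2[of x] by (auto simp: not_less intro: less_imp_le)
  then have "(\<Inter>n. {real n<..}) = {}" by blast
  ultimately have "(\<lambda>n. prob {real n<..}) \<longlonglongrightarrow> 0" by simp
  then have "eventually (\<lambda>n. prob {real n<..} < e) sequentially"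
    using assms by (rule order_tendstoD)
  then obtain n where "prob {real n<..} < e" by (auto simp: eventually_sequentially)
  then show ?thesis by (intro exI[of _ "real n"]) auto
qed

text \<open>An approximate maximum principle. Where \<open>d\<close> is almost \<delta>, the average
  of \<open>d (x - z)\<close> is almost \<delta> while hardly any term exceeds \<delta>, so no set
  of z of fixed probability can lower it noticeably. By the Lipschitz bound a defect
  \<open>e\<close> at \<open>x + s\<close> would persist, halved, for all z in
  \<open>{-t..-s}\<close>, a set of positive probability.\<close>

lemma near_maximum_propagates:
  fixes d :: "real \<Rightarrow> real"
  assumes [measurable]: "d \<in> borel_measurable borel" and bound: "\<And>x. \<bar>d x\<bar> \<le> C"
    and lip: "\<And>x y. \<bar>d x - d y\<bar> \<le> K * \<bar>x - y\<bar>"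
    and harm: "((\<lambda>x. d x - expectation (\<lambda>z. d (x - z))) \<longlongrightarrow> 0) at_top"
    and supp: "\<And>s t. 0 < s \<Longrightarrow> s < t \<Longrightarrow> 0 < prob {-t..-s}"
    and \<delta>: "0 \<le> \<delta>" "\<And>e. 0 < e \<Longrightarrow> eventually (\<lambda>x. d x \<le> \<delta> + e) at_top"
    and s: "0 < s" and e: "0 < e"
  shows "\<exists>e'>0. \<exists>T. \<forall>x\<ge>T. d x \<ge> \<delta> - e' \<longrightarrow> d (x + s) \<ge> \<delta> - e"
proof -
  have C: "0 \<le> C" using bound[of 0] by simp
  have K: "0 \<le> K" using lip[of 0 1] by simp
  \<comment> \<open>Chosen so that the Lipschitz bound loses at most \<open>e / 2\<close> on
    \<open>[x + s, x + t]\<close>; the summand 2 keeps the denominator positive when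
    \<open>K = 0\<close>.\<close>
  define t where "t = s + e / (2 * K + 2)"
  have t: "s < t" "K * (t - s) \<le> e / 2"
    using e K by (auto simp: t_def field_simps)
  define p where "p = prob {-t..-s}"
  have p: "0 < p" using supp[OF s t(1)] by (simp add: p_def)
  \<comment> \<open>The errors are one \<open>e'\<close> each for harmonicity, for the excess over
    \<delta> and for \<open>d x \<ge> \<delta> - e'\<close>, and \<open>C * e'\<close> for far
    jumps: together \<open>(3 + C) * e'\<close>, less than the loss \<open>e / 2 * p\<close> on the
    window.\<close>
  define e' where "e' = e * p / (2 * (4 + C))"
  have e': "0 < e'" using e p C by (simp add: e'_def)
  have e'2: "(4 + C) * e' = e / 2 * p" using C by (simp add: e'_def field_simps)
  obtain R where R: "0 \<le> R" "prob {R<..} \<le> e'" using tail_prob_small[OF e'] by auto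
  obtain T1 where T1: "\<And>x. T1 \<le> x \<Longrightarrow> d x \<le> \<delta> + e'"
    using \<delta>(2)[OF e'] by (auto simp: eventually_at_top_linorder)
  obtain T2 where T2: "\<And>x. T2 \<le> x \<Longrightarrow> d x - expectation (\<lambda>z. d (x - z)) < e'"
    using order_tendstoD(2)[OF harm e'] by (auto simp: eventually_at_top_linorder)
  show ?thesis
  proof (intro exI conjI allI impI)
    show "0 < e'" by fact
    fix x assume x: "max T2 (T1 + R) \<le> x" "d x \<ge> \<delta> - e'"
    show "d (x + s) \<ge> \<delta> - e"
    proof (rule ccontr)
      assume neg: "\<not> d (x + s) \<ge> \<delta> - e"
      \<comment> \<open>Jumps beyond \<open>R\<close> may land left of \<open>T1\<close>, where only
        the crude bound \<open>C\<close> is known; it lies below \<open>\<delta> + e' + C\<close>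
        because \<delta> \<ge> 0.\<close>
      have pt: "d (x - z) \<le> \<delta> + e' + C * indicator {R<..} z - e / 2 * indicator {-t..-s} z" for z
      proof (cases "z \<in> {-t..-s}")
        case True
        have "d (x - z) - d (x + s) \<le> K * \<bar>- z - s\<bar>" using lip[of "x - z" "x + s"] by (simp add: abs_le_iff[of "d (x - z) - d (x + s)"])
        also have "\<dots> \<le> K * (t - s)" using True K by (intro mult_left_mono) auto
        finally show ?thesis using True neg t s R e' by (auto simp: indicator_def)
      next
        case False
        show ?thesis
        proof (cases "R < z")
          case True
          then show ?thesis using False bound[of "x - z"] \<delta>(1) e' by auto
        next
          case nR: False
          then have "d (x - z) \<le> \<delta> + e'" using x by (intro T1) auto
          then show ?thesis using False nR by auto
        qed
      qed
      have int: "integrable \<eta> (indicator A :: real \<Rightarrow> real)" if "A \<in> sets borel" for A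
        using that by (intro integrable_real_indicator) (auto simp: emeasure_eq_measure)
      have "expectation (\<lambda>z. d (x - z))
          \<le> expectation (\<lambda>z. \<delta> + e' + C * indicator {R<..} z - e / 2 * indicator {-t..-s} z)"
        by (intro integral_mono pt integrable_shift_bounded[OF _ bound] Bochner_Integration.integrable_add
            Bochner_Integration.integrable_diff integrable_mult_right int) auto
      also have "\<dots> = \<delta> + e' + C * prob {R<..} - e / 2 * p"
        unfolding p_def by (simp add: int prob_space[unfolded space_step])
      also have "\<dots> \<le> \<delta> + e' + C * e' - e / 2 * p"
        using R(2) C by (simp add: mult_left_mono)
      finally have "d x < \<delta> + e' + e' + C * e' - e / 2 * p" using T2[of x] x by simp
      then show False using x(2) e'2 e' by (simp add: algebra_simps)
    qed
  qed
qed

text \<open>The difference \<open>d x = h x - h (x + s)\<close> is again asymptotically harmonic.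
  Were its limsup \<delta> positive, a near-maximum of \<open>d\<close> would propagate along x, x +
  s, x + 2 s, ..., and a telescoping sum of k values, each at least \<delta> / 2, would exceed the
  oscillation \<open>2 * C\<close> of \<open>h\<close>.\<close>

lemma asymptotically_nonincreasing:
  fixes h :: "real \<Rightarrow> real"
  assumes [measurable]: "h \<in> borel_measurable borel" and bound: "\<And>x. \<bar>h x\<bar> \<le> C"
    and lip: "\<And>x y. \<bar>h x - h y\<bar> \<le> K * \<bar>x - y\<bar>"
    and harm: "((\<lambda>x. h x - expectation (\<lambda>z. h (x - z))) \<longlongrightarrow> 0) at_top"
    and supp: "\<And>s t. 0 < s \<Longrightarrow> s < t \<Longrightarrow> 0 < prob {-t..-s}"
    and s: "0 < s" and c: "0 < c"
  shows "eventually (\<lambda>x. h x - h (x + s) \<le> c) at_top"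
proof (rule ccontr)
  assume neg: "\<not> ?thesis"
  define d where "d x = h x - h (x + s)" for x
  have d_meas [measurable]: "d \<in> borel_measurable borel" unfolding d_def by measurable
  have d_bound: "\<bar>d x\<bar> \<le> 2 * C" for x using bound[of x] bound[of "x + s"] by (auto simp: d_def)
  have d_lip: "\<bar>d x - d y\<bar> \<le> (2 * K) * \<bar>x - y\<bar>" for x y
    using lip[of x y] lip[of "x + s" "y + s"] by (auto simp: d_def)
  have "((\<lambda>x. h (x + s) - expectation (\<lambda>z. h (x + s - z))) \<longlongrightarrow> 0) at_top"
    by (rule filterlim_compose[OF harm filterlim_at_top_add_const[of s]])
  note h_harm = tendsto_diff[OF harm this]
  have "d x - expectation (\<lambda>z. d (x - z))
      = h x - expectation (\<lambda>z. h (x - z)) - (h (x + s) - expectation (\<lambda>z. h (x + s - z)))" for x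
  proof -
    have "expectation (\<lambda>z. d (x - z)) = expectation (\<lambda>z. h (x - z)) - expectation (\<lambda>z. h (x + s - z))"
      unfolding d_def using integrable_shift_bounded[where h = h and x = x, OF _ bound] integrable_shift_bounded[where h = h and x = "x + s", OF _ bound]
      by (subst Bochner_Integration.integral_diff[symmetric]) (auto simp: algebra_simps)
    then show ?thesis by (simp add: d_def)
  qed
  with h_harm have d_harm: "((\<lambda>x. d x - expectation (\<lambda>z. d (x - z))) \<longlongrightarrow> 0) at_top"
    by simp
  \<comment> \<open>\<delta> is the limsup of \<open>d\<close> at infinity, written as the infimum
    of its eventual upper bounds.\<close>
  define S where "S = {c. eventually (\<lambda>x. d x \<le> c) at_top}"
  define \<delta> where "\<delta> = Inf S"
  have lower: "c \<le> c'" if "c' \<in> S" for c'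
  proof (rule ccontr)
    assume "\<not> c \<le> c'"
    with that have "eventually (\<lambda>x. d x \<le> c) at_top"
      by (auto simp: S_def elim!: eventually_mono)
    with neg show False by (simp add: d_def)
  qed
  have "2 * C \<in> S" using d_bound by (auto simp: S_def abs_le_iff)
  then have S: "S \<noteq> {}" "bdd_below S" using bdd_belowI[of S c] lower by auto
  have \<delta>: "c \<le> \<delta>" unfolding \<delta>_def using S lower by (intro cInf_greatest) auto
  have up: "eventually (\<lambda>x. d x \<le> \<delta> + e) at_top" if "0 < e" for e
  proof -
    from that obtain c' where "c' \<in> S" "c' < \<delta> + e"
      using cInf_less_iff[OF S, of "\<delta> + e"] by (auto simp: \<delta>_def)
    then show ?thesis by (auto simp: S_def elim!: eventually_mono)
  qed
  have freq: "\<exists>x\<ge>T. d x \<ge> \<delta> - e" if "0 < e" for e T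
  proof (rule ccontr)
    assume "\<not> ?thesis"
    then have "d x \<le> \<delta> - e" if "T \<le> x" for x using that not_le_imp_less less_imp_le by metis
    then have "\<delta> - e \<in> S" unfolding S_def eventually_at_top_linorder by blast
    then have "\<delta> \<le> \<delta> - e" unfolding \<delta>_def by (intro cInf_lower S)
    with that show False by simp
  qed
  \<comment> \<open>Tolerances are chosen backwards: the goal of the last step fixes
    \<open>e1\<close>, and the induction hypothesis is used with \<open>min e e1\<close>, so that
    the value at \<open>x + real k * s\<close> is good enough to start that last step.\<close>
  have iter: "\<exists>e'>0. \<exists>T. \<forall>x\<ge>T. d x \<ge> \<delta> - e' \<longrightarrow> (\<forall>j\<le>k. d (x + real j * s) \<ge> \<delta> - e)" if "0 < e" for k e
    using that
  proof (induction k arbitrary: e)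
    case 0
    then show ?case by (intro exI[of _ e] conjI exI[of _ 0] allI impI) simp_all
  next
    case (Suc k)
    obtain e1 T1 where e1: "0 < e1" "\<And>x. T1 \<le> x \<Longrightarrow> d x \<ge> \<delta> - e1 \<Longrightarrow> d (x + s) \<ge> \<delta> - e"
      using near_maximum_propagates[OF d_meas d_bound d_lip d_harm supp less_imp_le[OF less_le_trans[OF c \<delta>]] up s Suc.prems]
      by blast
    obtain e2 T2 where e2: "0 < e2" "\<And>x j. T2 \<le> x \<Longrightarrow> d x \<ge> \<delta> - e2 \<Longrightarrow> j \<le> k \<Longrightarrow> d (x + real j * s) \<ge> \<delta> - min e e1"
      using Suc.IH[of "min e e1"] Suc.prems e1(1) unfolding min_less_iff_conj by blast
    show ?case
    proof (rule exI[of _ e2], rule conjI, fact e2(1), rule exI[of _ "max T1 T2"], intro allI impI)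
      fix x j assume x: "max T1 T2 \<le> x" "\<delta> - e2 \<le> d x" "j \<le> Suc k"
      show "\<delta> - e \<le> d (x + real j * s)"
      proof (cases "j \<le> k")
        case True then show ?thesis using e2(2)[of x j] x by auto
      next
        case False
        then have j: "j = Suc k" using x by auto
        have "T1 \<le> x + real k * s" using x s by (simp add: add_increasing2)
        then have "\<delta> - e \<le> d (x + real k * s + s)" using e2(2)[of x k] x by (intro e1(2)) auto
        then show ?thesis by (simp add: j algebra_simps)
      qed
    qed
  qed
  obtain k :: nat where k: "4 * C < real k * \<delta>"
    using reals_Archimedean3[of \<delta>] \<delta> c by auto
  obtain e' T where "0 < e'" and T: "\<And>x j. T \<le> x \<Longrightarrow> d x \<ge> \<delta> - e' \<Longrightarrow> j \<le> k \<Longrightarrow> d (x + real j * s) \<ge> \<delta> - \<delta> / 2"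
    using iter[of "\<delta> / 2" k] \<delta> c by auto
  obtain x where x: "T \<le> x" "d x \<ge> \<delta> - e'" using freq[OF \<open>0 < e'\<close>] by blast
  have "real k * (\<delta> / 2) = (\<Sum>j<k. \<delta> / 2)" by simp
  also have "\<dots> \<le> (\<Sum>j<k. d (x + real j * s))" using T[OF x] by (intro sum_mono) auto
  also have "\<dots> = (\<Sum>j<k. h (x + real j * s) - h (x + real (Suc j) * s))"
    by (intro sum.cong) (auto simp: d_def algebra_simps)
  also have "\<dots> = h x - h (x + real k * s)" by (subst sum_lessThan_telescope') simp
  also have "\<dots> \<le> 2 * C" using bound[of x] bound[of "x + real k * s"] by auto
  finally show False using k by simp
qed

text \<open>The one-sided bound applies to \<open>h\<close> and to \<open>- h\<close>; a negative
  shift reduces to a positive one by moving the base point.\<close>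

lemma asymptotically_invariant:
  fixes h :: "real \<Rightarrow> real"
  assumes [measurable]: "h \<in> borel_measurable borel" and bound: "\<And>x. \<bar>h x\<bar> \<le> C"
    and lip: "\<And>x y. \<bar>h x - h y\<bar> \<le> K * \<bar>x - y\<bar>"
    and harm: "((\<lambda>x. h x - expectation (\<lambda>z. h (x - z))) \<longlongrightarrow> 0) at_top"
    and supp: "\<And>s t. 0 < s \<Longrightarrow> s < t \<Longrightarrow> 0 < prob {-t..-s}"
  shows "((\<lambda>x. h (x + s) - h x) \<longlongrightarrow> 0) at_top"
proof -
  have pos: "((\<lambda>x. h (x + s) - h x) \<longlongrightarrow> 0) at_top" if s: "0 < s" for s
  proof (rule tendstoI)
    fix e :: real assume e: "0 < e"
    have 1: "eventually (\<lambda>x. h x - h (x + s) \<le> e / 2) at_top"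
      by (rule asymptotically_nonincreasing[OF _ bound lip harm supp s]) (use e in auto)
    have "((\<lambda>x. - h x - expectation (\<lambda>z. - h (x - z))) \<longlongrightarrow> 0) at_top"
      using tendsto_minus[OF harm] by simp
    moreover have "\<bar>- h x - - h y\<bar> \<le> K * \<bar>x - y\<bar>" for x y
      using lip[of y x] by (simp add: abs_minus_commute)
    ultimately have "eventually (\<lambda>x. - h x - - h (x + s) \<le> e / 2) at_top"
      by (intro asymptotically_nonincreasing[where h = "\<lambda>x. - h x" and C = C, OF _ _ _ _ supp s])
        (use e bound in auto)
    with 1 show "eventually (\<lambda>x. dist (h (x + s) - h x) 0 < e) at_top"
      by eventually_elim (use e in \<open>auto simp: dist_real_def\<close>)
  qed
  consider "s = 0" | "0 < s" | "0 < - s" by linarith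
  then show ?thesis
  proof cases
    case 1 then show ?thesis by simp
  next
    case 2 then show ?thesis by (rule pos)
  next
    case 3
    have "filterlim (\<lambda>x::real. x + s) at_top at_top"
      by (rule filterlim_at_top_add_const)
    from tendsto_minus[OF filterlim_compose[OF pos[OF 3] this]] show ?thesis by simp
  qed
qed

end

text \<open>The oriented indicator of the interval between 0 and z: integrating against it gives the
  oriented integral from 0 to z, for either sign of z.\<close>

definition ramp_kernel :: "real \<Rightarrow> real \<Rightarrow> real" where
  "ramp_kernel z t = indicator {0..<z} t - indicator {z..<0} t"

lemma ramp_kernel_measurable [measurable]: "ramp_kernel z \<in> borel_measurable borel"
  unfolding ramp_kernel_def by measurable

lemma ramp_kernel_cases:
  "0 \<le> z \<Longrightarrow> ramp_kernel z = indicator {0..<z}"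
  "z \<le> 0 \<Longrightarrow> ramp_kernel z = (\<lambda>t. - indicator {z..<0} t)"
  by (auto simp: ramp_kernel_def fun_eq_iff)

lemma ramp_kernel_integrable: "integrable lborel (ramp_kernel z)"
  by (cases "0 \<le> z") (auto simp: ramp_kernel_cases integrable_indicator_iff)

lemma ramp_kernel_integral: "(\<integral>t. ramp_kernel z t \<partial>lborel) = z"
  by (cases "0 \<le> z") (auto simp: ramp_kernel_cases)

lemma ramp_kernel_abs: "\<bar>ramp_kernel z t\<bar> = (if 0 \<le> z then ramp_kernel z t else - ramp_kernel z t)"
  by (auto simp: ramp_kernel_def indicator_def)

lemma ramp_kernel_abs_integral: "(\<integral>t. \<bar>ramp_kernel z t\<bar> \<partial>lborel) = \<bar>z\<bar>"
  unfolding ramp_kernel_abs using ramp_kernel_integral by (cases "0 \<le> z") (auto simp: ramp_kernel_integral)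

section \<open>The renewal theorem on the whole line\<close>

context drift_step
begin

lemma expectation_shift_bounded:
  fixes h :: "real \<Rightarrow> real"
  assumes [measurable]: "h \<in> borel_measurable borel" and b: "\<And>x. \<bar>h x\<bar> \<le> C"
  shows "\<bar>expectation (\<lambda>z. h (x - z))\<bar> \<le> C"
proof -
  have i: "integrable \<eta> (\<lambda>z. h (x - z))" by (rule integrable_shift_bounded[OF _ b]) simp
  have "expectation (\<lambda>z. h (x - z)) \<le> C"
    by (rule integral_le_const[OF i]) (use b abs_le_D1 in blast)
  moreover have "- C \<le> expectation (\<lambda>z. h (x - z))"
    by (rule integral_ge_const[OF i]) (use b in \<open>auto simp: abs_le_iff minus_le_iff\<close>)
  ultimately show ?thesis by linarith
qed

lemma expectation_shift_tendsto:
  fixes h :: "real \<Rightarrow> real"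
  assumes [measurable]: "h \<in> borel_measurable borel" and b: "\<And>x. \<bar>h x\<bar> \<le> C"
    and lim: "(h \<longlongrightarrow> 0) at_top"
  shows "((\<lambda>x. expectation (\<lambda>z. h (x - z))) \<longlongrightarrow> 0) at_top"
proof -
  have "((\<lambda>x. expectation (\<lambda>z. h (x - z))) \<longlongrightarrow> expectation (\<lambda>z. 0)) at_top"
  proof (rule integral_dominated_convergence_at_top[where w = "\<lambda>_. C"])
    show "AE z in \<eta>. ((\<lambda>x. h (x - z)) \<longlongrightarrow> 0) at_top"
      using filterlim_compose[OF lim filterlim_at_top_add_const] by (auto intro!: AE_I2 simp: diff_conv_add_uminus simp del: add_uminus_conv_diff)
  qed (use b in auto)
  then show ?thesis by simp
qed

text \<open>Integrating \<open>b\<close> over the half line up to x turns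
  \<open>a - a * \<eta>\<close> into the \<eta>-mean of the oriented integrals of \<open>a\<close>
  from \<open>x - z\<close> to \<open>x\<close>. As \<open>a\<close> is asymptotically translation
  invariant, these are close to \<open>a x * z\<close>, so \<open>a x * \<mu>\<close> tends to the
  total integral of \<open>b\<close>. The Lipschitz hypothesis concerns \<open>a * \<eta>\<close>;
  \<open>a\<close> itself may have jumps.\<close>

theorem renewal_limit:
  fixes a b :: "real \<Rightarrow> real"
  assumes meas [measurable]: "a \<in> borel_measurable borel"
    and nonneg: "\<And>x. 0 \<le> a x" and bound: "\<And>x. a x \<le> C"
    and left: "\<And>x. integrable lborel (\<lambda>y. indicator {..x} y * a y)"
    and lip: "\<And>x y. \<bar>expectation (\<lambda>z. a (x - z)) - expectation (\<lambda>z. a (y - z))\<bar> \<le> K * \<bar>x - y\<bar>"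
    and supp: "\<And>s t. 0 < s \<Longrightarrow> s < t \<Longrightarrow> 0 < prob {-t..-s}"
    and b: "\<And>x. b x = a x - expectation (\<lambda>z. a (x - z))"
    and b_int: "integrable lborel b" and b_lim: "(b \<longlongrightarrow> 0) at_top"
  shows "(a \<longlongrightarrow> (\<integral>x. b x \<partial>lborel) / expectation (\<lambda>z. z)) at_top"
proof -
  define u where "u x = expectation (\<lambda>z. a (x - z))" for x
  have [measurable]: "u \<in> borel_measurable borel" "b \<in> borel_measurable borel"
    unfolding u_def b by measurable
  have C: "0 \<le> C" using nonneg[of 0] bound[of 0] by simp
  have a_bd: "\<bar>a x\<bar> \<le> C" for x using nonneg bound by simp
  have u_bd: "\<bar>u x\<bar> \<le> C" for x unfolding u_def by (rule expectation_shift_bounded[OF _ a_bd]) simp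
  have bu: "b x = a x - u x" for x by (simp add: b u_def)
  have b_bd: "\<bar>b x\<bar> \<le> 2 * C" for x using a_bd[of x] u_bd[of x] by (auto simp: bu)
  have "u x - expectation (\<lambda>z. u (x - z)) = expectation (\<lambda>z. b (x - z))" for x
    unfolding bu u_def[of x]
    by (rule Bochner_Integration.integral_diff[symmetric])
      (auto intro!: integrable_shift_bounded[OF _ a_bd] integrable_shift_bounded[OF _ u_bd])
  then have u_harm: "((\<lambda>x. u x - expectation (\<lambda>z. u (x - z))) \<longlongrightarrow> 0) at_top"
    using expectation_shift_tendsto[OF _ b_bd b_lim] by simp
  have "((\<lambda>x. u (x + s) - u x) \<longlongrightarrow> 0) at_top" for s
    by (rule asymptotically_invariant[OF _ u_bd _ u_harm supp])
      (use lip in \<open>auto simp: u_def[symmetric]\<close>)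
  \<comment> \<open>Invariance passes from \<open>u\<close> to \<open>a = u + b\<close> since
    \<open>b\<close> vanishes at infinity.\<close>
  then have "((\<lambda>x. u (x + - t) - u x + (b (x + - t) - b x)) \<longlongrightarrow> 0 + (0 - 0)) at_top" for t
    by (intro tendsto_add tendsto_diff b_lim filterlim_compose[OF b_lim filterlim_at_top_add_const[of "- t"]])
  then have a_inv: "((\<lambda>x. a (x - t) - a x) \<longlongrightarrow> 0) at_top" for t
    by (simp add: bu)
  \<comment> \<open>By \<open>D_A\<close> below this is the oriented integral of \<open>a\<close>
    from \<open>x - z\<close> to \<open>x\<close>; the kernel form fixes the integration variable,
    so that dominated convergence applies as x grows.\<close>
  define D where "D z x = (\<integral>t. a (x - t) * ramp_kernel z t \<partial>lborel)" for z x
  have D_int: "integrable lborel (\<lambda>t. a (x - t) * ramp_kernel z t)" for x z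
    by (rule Bochner_Integration.integrable_bound[OF integrable_mult_right[OF ramp_kernel_integrable[of z], of C]])
      (use nonneg bound C in \<open>auto intro!: AE_I2 mult_right_mono simp: abs_mult\<close>)
  have D_lim: "((\<lambda>x. D z x - a x * z) \<longlongrightarrow> 0) at_top" for z
  proof -
    have eq: "D z x - a x * z = (\<integral>t. (a (x - t) - a x) * ramp_kernel z t \<partial>lborel)" for x
    proof -
      have "(\<integral>t. (a (x - t) - a x) * ramp_kernel z t \<partial>lborel)
          = (\<integral>t. a (x - t) * ramp_kernel z t - a x * ramp_kernel z t \<partial>lborel)"
        by (simp add: left_diff_distrib)
      also have "\<dots> = D z x - a x * z"
        unfolding D_def by (subst Bochner_Integration.integral_diff)
          (auto intro!: D_int integrable_mult_right ramp_kernel_integrable simp: ramp_kernel_integral)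
      finally show ?thesis ..
    qed
    have "((\<lambda>x. \<integral>t. (a (x - t) - a x) * ramp_kernel z t \<partial>lborel) \<longlongrightarrow> (\<integral>t. 0 \<partial>(lborel :: real measure))) at_top"
    proof (rule integral_dominated_convergence_at_top[where w = "\<lambda>t. C * \<bar>ramp_kernel z t\<bar>"])
      show "AE t in lborel. ((\<lambda>x. (a (x - t) - a x) * ramp_kernel z t) \<longlongrightarrow> 0) at_top"
        by (intro AE_I2 tendsto_mult_left_zero a_inv)
      have "\<bar>a (x - t) - a x\<bar> \<le> C" for x t
        using nonneg[of "x - t"] bound[of "x - t"] nonneg[of x] bound[of x] by simp
      then show "\<forall>\<^sub>F x in at_top. AE t in lborel. norm ((a (x - t) - a x) * ramp_kernel z t) \<le> C * \<bar>ramp_kernel z t\<bar>"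
        by (intro always_eventually allI AE_I2) (auto simp: abs_mult intro!: mult_right_mono)
    qed (auto intro!: ramp_kernel_integrable)
    then show ?thesis by (simp add: eq)
  qed
  have D_bd: "\<bar>D z x\<bar> \<le> C * \<bar>z\<bar>" for z x
  proof -
    have "\<bar>D z x\<bar> \<le> (\<integral>t. \<bar>a (x - t) * ramp_kernel z t\<bar> \<partial>lborel)"
      unfolding D_def by (rule integral_abs_bound)
    also have "\<dots> \<le> (\<integral>t. C * \<bar>ramp_kernel z t\<bar> \<partial>lborel)"
      by (intro integral_mono integrable_abs D_int integrable_mult_right ramp_kernel_integrable)
        (use nonneg bound in \<open>auto simp: abs_mult intro!: mult_right_mono\<close>)
    also have "\<dots> = C * \<bar>z\<bar>" by (simp add: ramp_kernel_abs_integral)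
    finally show ?thesis .
  qed
  define A where "A x = (\<integral>y. indicator {..x} y * a y \<partial>lborel)" for x
  have D_A: "D z x = A x - A (x - z)" for z x
  proof -
    have "D z x = (\<integral>y. a y * ramp_kernel z (x - y) \<partial>lborel)"
      unfolding D_def by (subst lborel_integral_real_affine[where c = "-1" and t = x]) auto
    also have "\<dots> = (\<integral>y. indicator {..x} y * a y - indicator {..x - z} y * a y \<partial>lborel)"
      by (intro Bochner_Integration.integral_cong) (auto simp: ramp_kernel_def indicator_def)
    also have "\<dots> = A x - A (x - z)"
      unfolding A_def by (rule Bochner_Integration.integral_diff[OF left left])
    finally show ?thesis .
  qed
  have "mono A"
    unfolding A_def by (intro monoI integral_mono left) (auto simp: indicator_def nonneg)
  then have [measurable]: "A \<in> borel_measurable borel" by (rule borel_measurable_mono)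
  have [measurable]: "(\<lambda>z. D z x) \<in> borel_measurable borel" for x
    unfolding D_A by measurable
  have D_eint: "integrable \<eta> (\<lambda>z. D z x)" for x
    by (rule Bochner_Integration.integrable_bound[OF integrable_mult_right[OF integrable_abs[OF step_integrable], of C]])
      (use D_bd C in auto)
  define \<mu> where "\<mu> = expectation (\<lambda>z. z)"
  have "((\<lambda>x. expectation (\<lambda>z. D z x - a x * z)) \<longlongrightarrow> expectation (\<lambda>z. 0)) at_top"
  proof (rule integral_dominated_convergence_at_top[where w = "\<lambda>z. 2 * C * \<bar>z\<bar>"])
    have "\<bar>D z x - a x * z\<bar> \<le> 2 * C * \<bar>z\<bar>" for x z
    proof -
      have "\<bar>a x * z\<bar> \<le> C * \<bar>z\<bar>" using a_bd[of x] by (simp add: abs_mult mult_right_mono del: abs_of_nonneg)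
      then show ?thesis using D_bd[of z x] by linarith
    qed
    then show "\<forall>\<^sub>F x in at_top. AE z in \<eta>. norm (D z x - a x * z) \<le> 2 * C * \<bar>z\<bar>" by simp
    show "AE z in \<eta>. ((\<lambda>x. D z x - a x * z) \<longlongrightarrow> 0) at_top" using D_lim by (intro AE_I2)
    show "integrable \<eta> (\<lambda>z. 2 * C * \<bar>z\<bar>)" by (intro integrable_mult_right integrable_abs step_integrable)
  qed measurable
  then have lim1: "((\<lambda>x. expectation (\<lambda>z. D z x) - a x * \<mu>) \<longlongrightarrow> 0) at_top"
    by (simp add: D_eint step_integrable \<mu>_def)
  \<comment> \<open>A mass balance: the net flow across \<open>x\<close> in one step equals the mass
    that \<open>b\<close> creates to the left of \<open>x\<close>. Fubini is used on the half line,
    where \<open>a\<close> and hence \<open>u = a - b\<close> are integrable; on the whole line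
    \<open>a\<close> need not be.\<close>
  have flux: "expectation (\<lambda>z. D z x) = (\<integral>y. indicator {..x} y * b y \<partial>lborel)" for x
  proof -
    interpret P: pair_sigma_finite lborel \<eta> ..
    define F where "F y z = indicator {..x} y * a (y - z)" for y z
    have [measurable]: "case_prod F \<in> borel_measurable (lborel \<Otimes>\<^sub>M \<eta>)"
      unfolding F_def by measurable
    have Fy: "(\<integral>z. F y z \<partial>\<eta>) = indicator {..x} y * u y" for y
      by (simp add: F_def u_def)
    have u_int: "integrable lborel (\<lambda>y. indicator {..x} y * u y)"
      using Bochner_Integration.integrable_diff[OF left[of x] integrable_mult_indicator[OF _ b_int, of "{..x}"]]
      by (simp add: bu algebra_simps)
    have F_int: "integrable (lborel \<Otimes>\<^sub>M \<eta>) (case_prod F)"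
    proof (rule P.Fubini_integrable)
      show "integrable lborel (\<lambda>y. \<integral>z. norm (case_prod F (y, z)) \<partial>\<eta>)"
        using u_int nonneg by (simp add: F_def abs_mult u_def)
      show "AE y in lborel. integrable \<eta> (\<lambda>z. case_prod F (y, z))"
        by (auto simp: F_def intro!: integrable_shift_bounded[OF _ a_bd])
    qed simp
    have "(\<integral>y. indicator {..x} y * u y \<partial>lborel) = (\<integral>z. (\<integral>y. F y z \<partial>lborel) \<partial>\<eta>)"
      unfolding Fy[symmetric] by (rule P.Fubini_integral[symmetric, OF F_int])
    also have "\<dots> = (\<integral>z. A (x - z) \<partial>\<eta>)"
    proof (rule Bochner_Integration.integral_cong[OF refl])
      fix z
      show "(\<integral>y. F y z \<partial>lborel) = A (x - z)"
        unfolding A_def F_def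
        by (subst (2) lborel_integral_real_affine[where c = 1 and t = "- z"])
          (auto simp: indicator_def intro!: Bochner_Integration.integral_cong)
    qed
    finally have "A x - (\<integral>y. indicator {..x} y * u y \<partial>lborel) = expectation (\<lambda>z. A x) - expectation (\<lambda>z. A (x - z))"
      using prob_space by simp
    also have "\<dots> = expectation (\<lambda>z. D z x)"
    proof -
      have "integrable \<eta> (\<lambda>z. A (x - z))"
        using Bochner_Integration.integrable_diff[OF integrable_const D_eint, of "A x" x] by (simp add: D_A)
      then show ?thesis unfolding D_A by (subst Bochner_Integration.integral_diff) auto
    qed
    finally show ?thesis
      unfolding A_def bu right_diff_distrib by (simp add: left u_int)
  qed
  have "((\<lambda>x. \<integral>y. indicator {..x} y *\<^sub>R b y \<partial>lborel) \<longlongrightarrow> (\<integral>y. b y \<partial>lborel)) at_top"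
    by (rule tendsto_integral_at_top[OF _ b_int]) simp
  from tendsto_diff[OF this lim1] have "((\<lambda>x. a x * \<mu>) \<longlongrightarrow> (\<integral>y. b y \<partial>lborel)) at_top"
    by (simp add: flux)
  from tendsto_divide[OF this tendsto_const[of \<mu>]] drift_pos show ?thesis
    by (simp add: \<mu>_def)
qed

section \<open>Lower bounds for functions superharmonic up to exponentially small killing\<close>

lemma truncated_mean_large:
  assumes "c < expectation (\<lambda>z. z)"
  shows "\<exists>L\<ge>0. \<forall>y\<ge>L. c \<le> expectation (\<lambda>z. indicator {..y} z * z)"
proof -
  have "((\<lambda>y. expectation (\<lambda>z. indicator {..y} z *\<^sub>R z)) \<longlongrightarrow> expectation (\<lambda>z. z)) at_top"
    by (rule tendsto_integral_at_top[OF _ step_integrable]) simp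
  from order_tendstoD(1)[OF this assms] obtain L where
    "\<And>y. L \<le> y \<Longrightarrow> c < expectation (\<lambda>z. indicator {..y} z * z)"
    by (auto simp: eventually_at_top_linorder)
  then show ?thesis by (intro exI[of _ "max 0 L"]) (auto intro: less_imp_le)
qed

lemma integrable_truncated: "integrable \<eta> (\<lambda>z. indicator {..y} z * z)"
  using integrable_mult_indicator[OF _ step_integrable, of "{..y}"] by simp

lemma integrable_indicator_borel: "A \<in> sets borel \<Longrightarrow> integrable \<eta> (indicator A :: real \<Rightarrow> real)"
  by (intro integrable_real_indicator) (auto simp: emeasure_eq_measure)

text \<open>The complement of \<open>\<psi>\<close> on the positive half line is, up to a factor, the sum of the concave
  function \<open>E[min z y; z > L]\<close>, whose decrease along the walk pays for the jumps below \<open>0\<close> from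
  above \<open>L\<close>, and of a term that pays for the killing at rate \<open>k exp (- \<kappa> y)\<close>.\<close>

lemma subharmonic_barrier:
  assumes \<kappa>: "0 < \<kappa>" and k: "0 \<le> k" "k \<le> \<kappa> * expectation (\<lambda>z. z) / 8"
    and L: "0 \<le> L" "\<And>y. L \<le> y \<Longrightarrow> 7 / 8 * expectation (\<lambda>z. z) \<le> expectation (\<lambda>z. indicator {..y} z * z)"
  shows "\<exists>\<psi> \<in> borel_measurable borel. (\<forall>y<0. \<psi> y = 0) \<and> (\<forall>y\<ge>0. 1 / 2 \<le> \<psi> y) \<and> (\<forall>y. 0 \<le> \<psi> y \<and> \<psi> y \<le> 1)
    \<and> (\<forall>y\<ge>L. \<psi> y + k * exp (- \<kappa> * y) \<le> expectation (\<lambda>z. \<psi> (y - z)))"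
proof -
  define \<mu> where "\<mu> = expectation (\<lambda>z. z)"
  have \<mu>: "0 < \<mu>" using drift_pos by (simp add: \<mu>_def)
  define m where "m y = expectation (\<lambda>z. min z y * indicator {L<..} z)" for y
  \<comment> \<open>As \<open>m y \<le> \<mu> / 8\<close> for y \<ge> 0 and
    \<open>k / \<kappa> \<le> \<mu> / 8\<close>, the factor \<open>2 / \<mu>\<close> keeps
    \<open>g\<close> at most 1/2 there. It also gives the slope \<open>s\<close> below the property
    \<open>s * (\<mu> / 2) = p + k * exp (- \<kappa> * x)\<close>, exactly the loss to be
    paid.\<close>
  define g where "g y = 2 / \<mu> * (m y + k / \<kappa> * (1 - exp (- \<kappa> * y)))" for y
  define \<psi> where "\<psi> y = (if y < 0 then 0 else 1 - g y)" for y
  have m_meas [measurable]: "m \<in> borel_measurable borel" unfolding m_def by measurable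
  have [measurable]: "g \<in> borel_measurable borel" unfolding g_def by measurable
  have \<psi>_meas [measurable]: "\<psi> \<in> borel_measurable borel" unfolding \<psi>_def by measurable
  have tail_int: "integrable \<eta> (\<lambda>z. z * indicator {L<..} z)"
    using integrable_mult_indicator[OF _ step_integrable, of "{L<..}"] by (simp add: mult.commute)
  have m_int: "integrable \<eta> (\<lambda>z. min z y * indicator {L<..} z)" for y
    by (rule Bochner_Integration.integrable_bound[OF Bochner_Integration.integrable_add[OF integrable_abs[OF step_integrable] integrable_const[of "\<bar>y\<bar>"]]])
      (auto simp: indicator_def)
  have tail: "expectation (\<lambda>z. z * indicator {L<..} z) \<le> \<mu> / 8"
  proof -
    have "expectation (\<lambda>z. z * indicator {L<..} z) = expectation (\<lambda>z. z - indicator {..L} z * z)"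
      by (intro Bochner_Integration.integral_cong) (auto simp: indicator_def)
    also have "\<dots> = \<mu> - expectation (\<lambda>z. indicator {..L} z * z)"
      unfolding \<mu>_def by (rule Bochner_Integration.integral_diff[OF step_integrable integrable_truncated])
    finally show ?thesis using L(2)[of L] by (simp add: \<mu>_def)
  qed
  have m_bd: "0 \<le> m y" "m y \<le> \<mu> / 8" if "0 \<le> y" for y
  proof -
    show "0 \<le> m y" unfolding m_def using that L(1)
      by (intro Bochner_Integration.integral_nonneg) (auto simp: indicator_def)
    have "m y \<le> expectation (\<lambda>z. z * indicator {L<..} z)"
      unfolding m_def by (rule integral_mono[OF m_int tail_int]) (auto simp: indicator_def)
    with tail show "m y \<le> \<mu> / 8" by linarith
  qed
  have g_bd: "0 \<le> g y" "g y \<le> 1 / 2" if y: "0 \<le> y" for y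
  proof -
    have e: "0 \<le> 1 - exp (- \<kappa> * y)" "1 - exp (- \<kappa> * y) \<le> 1" using y \<kappa> by auto
    have e2: "0 \<le> k / \<kappa> * (1 - exp (- \<kappa> * y))" "k / \<kappa> * (1 - exp (- \<kappa> * y)) \<le> k / \<kappa>"
      using mult_left_mono[OF e(1), of "k / \<kappa>"] mult_left_mono[OF e(2), of "k / \<kappa>"] k(1) \<kappa> by simp_all
    show "0 \<le> g y" unfolding g_def using \<mu> m_bd(1)[OF y] e2(1) by auto
    have "k / \<kappa> \<le> \<mu> / 8" using k(2) \<kappa> by (simp add: \<mu>_def field_simps)
    then have "m y + k / \<kappa> * (1 - exp (- \<kappa> * y)) \<le> \<mu> / 8 + \<mu> / 8"
      using m_bd(2)[OF y] e2(2) by linarith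
    then have "g y \<le> 2 / \<mu> * (\<mu> / 8 + \<mu> / 8)"
      unfolding g_def using \<mu> by (intro mult_left_mono) auto
    also have "\<dots> = 1 / 2" using \<mu> by simp
    finally show "g y \<le> 1 / 2" .
  qed
  have \<psi>_bd: "0 \<le> \<psi> y \<and> \<psi> y \<le> 1" for y using g_bd[of y] by (auto simp: \<psi>_def)
  have drift: "\<psi> x + k * exp (- \<kappa> * x) \<le> expectation (\<lambda>z. \<psi> (x - z))" if x: "L \<le> x" for x
  proof -
    have x0: "0 \<le> x" using x L(1) by simp
    define p where "p = prob {x<..}"
    define s where "s = 2 / \<mu> * (p + k * exp (- \<kappa> * x))"
    have s: "0 \<le> s" using \<mu> k(1) by (simp add: s_def p_def)
    have split: "c * (u + v * t) = c * u + c * v * t" for c u v t :: real by (simp add: algebra_simps)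
    \<comment> \<open>\<open>s\<close> is a supergradient of the concave \<open>g\<close> at
      \<open>x\<close>. Up to the factor \<open>2 / \<mu>\<close>, the part \<open>m\<close>
      contributes \<open>p\<close>, because \<open>min z y\<close> has slope 1 at \<open>x\<close>
      exactly when z > x, and the other summand has derivative
      \<open>k * exp (- \<kappa> * x)\<close>.\<close>
    have conc: "g y \<le> g x + s * (y - x)" for y
    proof -
      have "m y \<le> expectation (\<lambda>z. min z x * indicator {L<..} z + indicator {x<..} z * (y - x))"
        unfolding m_def
        by (intro integral_mono m_int Bochner_Integration.integrable_add integrable_mult_left integrable_indicator_borel)
          (use x in \<open>auto simp: indicator_def min_def\<close>)
      also have "\<dots> = m x + p * (y - x)"
        unfolding m_def p_def
        by (subst Bochner_Integration.integral_add)
          (auto intro!: m_int integrable_mult_left integrable_indicator_borel)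
      finally have 1: "m y \<le> m x + p * (y - x)" .
      have "exp (- \<kappa> * x) * (1 + (- \<kappa> * (y - x))) \<le> exp (- \<kappa> * x) * exp (- \<kappa> * (y - x))"
        by (intro mult_left_mono exp_ge_add_one_self) auto
      also have "\<dots> = exp (- \<kappa> * y)" by (simp add: exp_add[symmetric] algebra_simps)
      finally have 2: "1 - exp (- \<kappa> * y) \<le> 1 - exp (- \<kappa> * x) + \<kappa> * exp (- \<kappa> * x) * (y - x)"
        by (simp add: algebra_simps)
      have "k / \<kappa> * (1 - exp (- \<kappa> * y)) \<le> k / \<kappa> * (1 - exp (- \<kappa> * x) + \<kappa> * exp (- \<kappa> * x) * (y - x))"
        using 2 k \<kappa> by (intro mult_left_mono) auto
      also have "\<dots> = k / \<kappa> * (1 - exp (- \<kappa> * x)) + k * exp (- \<kappa> * x) * (y - x)"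
        using \<kappa> by (simp add: field_simps)
      finally have "m y + k / \<kappa> * (1 - exp (- \<kappa> * y))
          \<le> m x + k / \<kappa> * (1 - exp (- \<kappa> * x)) + (p + k * exp (- \<kappa> * x)) * (y - x)"
        using 1 by (simp add: algebra_simps)
      then have "g y \<le> 2 / \<mu> * (m x + k / \<kappa> * (1 - exp (- \<kappa> * x)) + (p + k * exp (- \<kappa> * x)) * (y - x))"
        unfolding g_def using \<mu> by (intro mult_left_mono) auto
      also have "\<dots> = g x + s * (y - x)" unfolding g_def s_def by (rule split)
      finally show ?thesis .
    qed
    \<comment> \<open>For z > x the walk falls below 0, where \<psi> vanishes; for z \<le> x the
      tangent bound gives \<open>\<psi> (x - z) \<ge> 1 - g x + s * z\<close>.\<close>
    have low: "(1 - g x) * indicator {..x} z + s * (indicator {..x} z * z) \<le> \<psi> (x - z)" for z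
      using conc[of "x - z"] by (auto simp: indicator_def \<psi>_def)
    have p1: "prob {..x} = 1 - p"
    proof -
      have "{..x} = space \<eta> - {x<..}" by auto
      then show ?thesis unfolding p_def using prob_compl[of "{x<..}"] by simp
    qed
    have "(1 - g x) * (1 - p) + s * expectation (\<lambda>z. indicator {..x} z * z)
       = expectation (\<lambda>z. (1 - g x) * indicator {..x} z + s * (indicator {..x} z * z))"
      by (subst Bochner_Integration.integral_add)
        (auto intro!: integrable_mult_right integrable_truncated integrable_indicator_borel simp: p1)
    also have "\<dots> \<le> expectation (\<lambda>z. \<psi> (x - z))"
      by (intro integral_mono low integrable_shift_bounded[where C = 1] Bochner_Integration.integrable_add
         integrable_mult_right integrable_truncated integrable_indicator_borel) (use \<psi>_bd in auto)
    finally have 3: "(1 - g x) * (1 - p) + s * expectation (\<lambda>z. indicator {..x} z * z) \<le> expectation (\<lambda>z. \<psi> (x - z))" .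
    have "s * (\<mu> / 2) \<le> s * expectation (\<lambda>z. indicator {..x} z * z)"
      using L(2)[OF x] \<mu> s by (intro mult_left_mono) (auto simp: \<mu>_def)
    moreover have "s * (\<mu> / 2) = p + k * exp (- \<kappa> * x)" using \<mu> by (simp add: s_def)
    moreover have "0 \<le> g x * p" using g_bd(1)[OF x0] by (simp add: p_def)
    moreover have "\<psi> x = 1 - g x" using x0 by (simp add: \<psi>_def)
    ultimately show ?thesis using 3 by (simp add: algebra_simps)
  qed
  show ?thesis
    using \<psi>_meas \<psi>_bd drift g_bd by (intro bexI[of _ \<psi>]) (auto simp: \<psi>_def)
qed

text \<open>A minimum principle comparing \<open>a\<close>, seen from \<open>x1\<close>, with
  \<delta> times the barrier \<psi>. The infimum over an unbounded line need not be attained, so a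
  penalty \<open>s * max y 0\<close> is added: the positive drift lowers its mean by at least
  \<open>s * (\<mu> / 2)\<close> in a step from above \<open>L\<close>, which rules out a negative
  infimum. Then \<open>s\<close> tends to 0.\<close>

theorem superharmonic_bounded_below:
  fixes a :: "real \<Rightarrow> real"
  assumes [measurable]: "a \<in> borel_measurable borel"
    and nonneg: "\<And>x. 0 \<le> a x" and bound: "\<And>x. a x \<le> C"
    and \<kappa>: "0 < \<kappa>" and K: "0 \<le> K"
    and super: "\<And>x. x0 \<le> x \<Longrightarrow> (1 - K * exp (- \<kappa> * x)) * expectation (\<lambda>z. a (x - z)) \<le> a x"
    and low: "\<And>s t. \<exists>\<delta>>0. \<forall>x\<in>{s..t}. \<delta> \<le> a x"
  shows "\<exists>\<delta>>0. eventually (\<lambda>x. \<delta> \<le> a x) at_top"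
proof -
  define \<mu> where "\<mu> = expectation (\<lambda>z. z)"
  have \<mu>: "0 < \<mu>" using drift_pos by (simp add: \<mu>_def)
  obtain L where L: "0 \<le> L" "\<And>y. L \<le> y \<Longrightarrow> 7 / 8 * \<mu> \<le> expectation (\<lambda>z. indicator {..y} z * z)"
    using truncated_mean_large[of "7 / 8 * \<mu>"] \<mu> unfolding \<mu>_def by auto
  have "((\<lambda>x. K * exp (- \<kappa> * x)) \<longlongrightarrow> 0) at_top"
    using \<kappa> by real_asymp
  from order_tendstoD(2)[OF this, of "min 1 (\<kappa> * \<mu> / 8)"] \<mu> \<kappa>
  have "eventually (\<lambda>x. K * exp (- \<kappa> * x) < min 1 (\<kappa> * \<mu> / 8)) at_top" by simp
  then obtain x1 where x1: "x0 \<le> x1" "K * exp (- \<kappa> * x1) < min 1 (\<kappa> * \<mu> / 8)"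
    by (auto simp: eventually_at_top_linorder) (meson max.cobounded1 max.cobounded2)
  \<comment> \<open>Moving the origin to \<open>x1\<close> turns the killing rate into
    \<open>k * exp (- \<kappa> * y)\<close>. The point \<open>x1\<close> is so large that
    \<open>k \<le> 1\<close>, which keeps \<open>q\<close> below nonnegative, and
    \<open>k \<le> \<kappa> * \<mu> / 8\<close>, as the barrier requires.\<close>
  define k where "k = K * exp (- \<kappa> * x1)"
  have k: "0 \<le> k" "k \<le> 1" "k \<le> \<kappa> * \<mu> / 8" using K x1(2) by (auto simp: k_def)
  obtain \<psi> where [measurable]: "\<psi> \<in> borel_measurable borel"
    and \<psi>: "\<And>y. y < 0 \<Longrightarrow> \<psi> y = 0" "\<And>y. 0 \<le> y \<Longrightarrow> 1 / 2 \<le> \<psi> y" "\<And>y. 0 \<le> \<psi> y" "\<And>y. \<psi> y \<le> 1"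
      "\<And>y. L \<le> y \<Longrightarrow> \<psi> y + k * exp (- \<kappa> * y) \<le> expectation (\<lambda>z. \<psi> (y - z))"
    using subharmonic_barrier[OF \<kappa> k(1) _ L(1)] k(3) L(2) unfolding \<mu>_def by blast
  obtain \<delta> where \<delta>: "0 < \<delta>" "\<And>x. x \<in> {x1..x1 + L} \<Longrightarrow> \<delta> \<le> a x" using low[of x1 "x1 + L"] by auto
  define aa where "aa y = a (x1 + y)" for y
  have [measurable]: "aa \<in> borel_measurable borel" unfolding aa_def by measurable
  have nn: "0 \<le> \<Delta>" if s: "0 < s" and \<Delta>: "\<Delta> = aa y - \<delta> * \<psi> y + s * max y 0" for s y \<Delta>
  proof -
    define d where "d y = aa y - \<delta> * \<psi> y + s * max y 0" for y
    have [measurable]: "d \<in> borel_measurable borel" unfolding d_def by measurable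
    have d_low: "- \<delta> \<le> d y" for y
    proof -
      have "\<delta> * \<psi> y \<le> \<delta>" using mult_left_mono[OF \<psi>(4)[of y], of \<delta>] \<delta>(1) by simp
      moreover have "0 \<le> s * max y 0" using s by simp
      ultimately show ?thesis using nonneg[of "x1 + y"] unfolding d_def aa_def by linarith
    qed
    have d_left: "0 \<le> d y" if "y < L" for y
    proof (cases "y < 0")
      case True then show ?thesis using nonneg[of "x1 + y"] s by (simp add: d_def aa_def \<psi>(1))
    next
      case False
      then have "\<delta> \<le> aa y" using that unfolding aa_def by (intro \<delta>(2)) auto
      moreover have "\<delta> * \<psi> y \<le> \<delta>" using mult_left_mono[OF \<psi>(4)[of y], of \<delta>] \<delta>(1) by simp
      moreover have "0 \<le> s * max y 0" using s by simp
      ultimately show ?thesis unfolding d_def by linarith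
    qed
    have a_int: "integrable \<eta> (\<lambda>z. aa (y - z))" for y
      by (rule integrable_shift_bounded[where C = C]) (use nonneg bound in \<open>auto simp: aa_def\<close>)
    have \<psi>_int: "integrable \<eta> (\<lambda>z. \<psi> (y - z))" for y
      by (rule integrable_shift_bounded[where C = 1]) (use \<psi> in auto)
    have max_int: "integrable \<eta> (\<lambda>z. max (y - z) 0)" for y
      by (intro integrable_max Bochner_Integration.integrable_diff step_integrable) auto
    have d_int: "integrable \<eta> (\<lambda>z. d (y - z))" for y
      unfolding d_def by (intro Bochner_Integration.integrable_add Bochner_Integration.integrable_diff
        integrable_mult_right a_int \<psi>_int max_int)
    have d_exp: "expectation (\<lambda>z. d (y - z))
        = expectation (\<lambda>z. aa (y - z)) - \<delta> * expectation (\<lambda>z. \<psi> (y - z)) + s * expectation (\<lambda>z. max (y - z) 0)" for y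
      unfolding d_def by (simp add: a_int \<psi>_int max_int)
    have d_super: "\<exists>q. 0 \<le> q \<and> q \<le> 1 \<and> q * expectation (\<lambda>z. d (y - z)) + s * (\<mu> / 2) \<le> d y" if y: "L \<le> y" for y
    proof (intro exI conjI)
      define q where "q = 1 - k * exp (- \<kappa> * y)"
      have y0: "0 \<le> y" using y L(1) by simp
      have "k * exp (- \<kappa> * y) \<le> 1 * 1" using y0 \<kappa> k by (intro mult_mono) auto
      then show q: "0 \<le> q" "q \<le> 1" using k by (auto simp: q_def)
      have "q * expectation (\<lambda>z. aa (y - z)) \<le> aa y"
        using super[of "x1 + y"] y0 x1(1)
        by (simp add: aa_def q_def k_def algebra_simps exp_add[symmetric] diff_add_eq)
      moreover have "\<psi> y \<le> q * expectation (\<lambda>z. \<psi> (y - z))"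
      proof -
        have "expectation (\<lambda>z. \<psi> (y - z)) \<le> 1"
          by (rule integral_le_const[OF \<psi>_int]) (simp add: \<psi>)
        then have "k * exp (- \<kappa> * y) * expectation (\<lambda>z. \<psi> (y - z)) \<le> k * exp (- \<kappa> * y)"
          using k(1) by (intro mult_left_le) auto
        then show ?thesis using \<psi>(5)[OF y] by (simp add: q_def algebra_simps)
      qed
      then have "\<delta> * \<psi> y \<le> \<delta> * (q * expectation (\<lambda>z. \<psi> (y - z)))" using \<delta>(1) by (intro mult_left_mono) auto
      moreover have "q * expectation (\<lambda>z. max (y - z) 0) + \<mu> / 2 \<le> max y 0"
      proof -
        have "expectation (\<lambda>z. max (y - z) 0) = expectation (\<lambda>z. y * indicator {..y} z - indicator {..y} z * z)"
          by (intro Bochner_Integration.integral_cong) (auto simp: indicator_def)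
        also have "\<dots> = y * prob {..y} - expectation (\<lambda>z. indicator {..y} z * z)"
          by (simp add: integrable_truncated integrable_indicator_borel)
        also have "\<dots> \<le> y - \<mu> / 2"
          using L(2)[OF y] \<mu> mult_left_le[OF prob_le_1 y0, of "{..y}"] by linarith
        finally have "expectation (\<lambda>z. max (y - z) 0) \<le> y - \<mu> / 2" .
        moreover have "0 \<le> expectation (\<lambda>z. max (y - z) 0)" by simp
        then have "q * expectation (\<lambda>z. max (y - z) 0) \<le> expectation (\<lambda>z. max (y - z) 0)"
          using q by (intro mult_left_le_one_le)
        ultimately show ?thesis using y0 by simp
      qed
      then have "s * (q * expectation (\<lambda>z. max (y - z) 0) + \<mu> / 2) \<le> s * max y 0"
        using s by (intro mult_left_mono) auto
      ultimately show "q * expectation (\<lambda>z. d (y - z)) + s * (\<mu> / 2) \<le> d y"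
        unfolding d_exp by (simp add: d_def[of y] algebra_simps)
    qed
    define m where "m = Inf (range d)"
    have bdd: "bdd_below (range d)" using d_low by (intro bdd_belowI[of _ "- \<delta>"]) auto
    have m_le: "m \<le> d y" for y unfolding m_def by (rule cInf_lower[OF _ bdd]) auto
    \<comment> \<open>A point with \<open>d y\<close> negative and within
      \<open>s * (\<mu> / 2)\<close> of a negative infimum is at least \<open>L\<close> by
      \<open>d_left\<close>. There \<open>m \<le> q * m\<close>, because m < 0 and q \<le> 1, and
      the gain of \<open>d_super\<close> contradicts the choice of the point.\<close>
    have "0 \<le> m"
    proof (rule ccontr)
      assume neg: "\<not> 0 \<le> m"
      then have "Inf (range d) < min 0 (m + s * (\<mu> / 2))" using s \<mu> by (auto simp: m_def)
      then obtain y where y: "d y < min 0 (m + s * (\<mu> / 2))"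
        by (subst (asm) cInf_less_iff[OF _ bdd]) auto
      then have "L \<le> y" using d_left[of y] by force
      then obtain q where q: "0 \<le> q" "q \<le> 1" "q * expectation (\<lambda>z. d (y - z)) + s * (\<mu> / 2) \<le> d y"
        using d_super by blast
      have "m \<le> q * m" using q(1,2) neg by (simp add: mult_le_cancel_right1)
      also have "\<dots> \<le> q * expectation (\<lambda>z. d (y - z))"
        by (intro mult_left_mono q(1) integral_ge_const[OF d_int]) (simp add: m_le)
      finally show False using q(3) y by simp
    qed
    then show ?thesis using m_le[of y] by (simp add: d_def \<Delta>)
  qed
  have "\<delta> / 2 \<le> aa y" if y: "0 \<le> y" for y
  proof -
    have "\<delta> * \<psi> y \<le> aa y + e" if e: "0 < e" for e
    proof -
      \<comment> \<open>The slope of the penalty is chosen after \<open>y\<close>, so that it costs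
        at most \<open>e\<close> at this point.\<close>
      have "0 \<le> aa y - \<delta> * \<psi> y + e / (y + 1) * max y 0" by (rule nn[OF _ refl]) (use e y in auto)
      moreover have "e / (y + 1) * max y 0 \<le> e" using e y by (simp add: field_simps)
      ultimately show ?thesis by linarith
    qed
    then have "\<delta> * \<psi> y \<le> aa y" by (rule field_le_epsilon)
    moreover have "\<delta> * (1 / 2) \<le> \<delta> * \<psi> y" using \<psi>(2)[OF y] \<delta>(1) by (intro mult_left_mono) auto
    ultimately show ?thesis by simp
  qed
  then have "\<delta> / 2 \<le> a x" if "x1 \<le> x" for x
    using that by (force simp: aa_def dest: spec[of _ "x - x1"])
  then show ?thesis using \<delta>(1)
    by (intro exI[of _ "\<delta> / 2"]) (auto simp: eventually_at_top_linorder)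
qed

end

section \<open>The weighted tree\<close>

text \<open>One index type for all variables: \<open>Inl\<close> for N, then \<chi>, then \<tau>.
  Independence of parts of the tree becomes independence of restrictions of one family to disjoint
  index sets.\<close>

type_synonym tree_index = "nat list + nat list + nat list"

text \<open>The supremum over the first r generations below node i, as a function of a configuration
  \<open>y\<close>, so that measurability and independence can be studied on product spaces. Index 0
  stands for the node itself, with walk 0, and keeps the set under \<open>Max\<close> nonempty.
  Offspring counts are stored as reals, whence the floor.\<close>

fun depth_max :: "nat \<Rightarrow> nat list \<Rightarrow> (tree_index \<Rightarrow> real) \<Rightarrow> real" where
  "depth_max 0 i y = 0"
| "depth_max (Suc r) i y = Max ((\<lambda>k. if k = 0 then 0
      else y (Inr (Inl (i @ [k]))) - y (Inr (Inr (i @ [k]))) + depth_max r (i @ [k]) y) ` {0..nat \<lfloor>y (Inl i)\<rfloor>})"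

text \<open>The coordinates on which \<open>depth_max r i\<close> depends. The variables \<chi> and
  \<tau> at i itself are left out: they form the step into i, which has to be independent of
  everything below.\<close>

definition subtree :: "nat list \<Rightarrow> tree_index set" where
  "subtree i = Inl ` {i @ w | w. w \<in> nodes}
     \<union> Inr ` Inl ` {i @ w | w. w \<in> nodes \<and> w \<noteq> []} \<union> Inr ` Inr ` {i @ w | w. w \<in> nodes \<and> w \<noteq> []}"

lemma nodes_simps [simp]: "[] \<in> nodes" "k # w \<in> nodes \<longleftrightarrow> 1 \<le> k \<and> w \<in> nodes"
  "i @ w \<in> nodes \<longleftrightarrow> i \<in> nodes \<and> w \<in> nodes"
  by (auto simp: nodes_def)

lemma subtree_simps:
  "Inl j \<in> subtree i \<longleftrightarrow> (\<exists>w\<in>nodes. j = i @ w)"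
  "Inr (Inl j) \<in> subtree i \<longleftrightarrow> (\<exists>w\<in>nodes. w \<noteq> [] \<and> j = i @ w)"
  "Inr (Inr j) \<in> subtree i \<longleftrightarrow> (\<exists>w\<in>nodes. w \<noteq> [] \<and> j = i @ w)"
  by (auto simp: subtree_def)

lemma subtree_child: "1 \<le> k \<Longrightarrow> subtree (i @ [k]) \<subseteq> subtree i"
proof
  fix x assume "1 \<le> k" "x \<in> subtree (i @ [k])"
  then show "x \<in> subtree i"
    by (cases x rule: sum.exhaust[case_names 1 2]; (cases "projr x")?) (force simp: subtree_simps)+
qed

lemma depth_max_cong:
  "(\<And>x. x \<in> subtree i \<Longrightarrow> y x = y' x) \<Longrightarrow> depth_max r i y = depth_max r i y'"
proof (induction r arbitrary: i)
  case (Suc r)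
  have "Inl i \<in> subtree i" by (auto simp: subtree_simps intro!: bexI[of _ "[]"])
  moreover have "Inr (Inl (i @ [k])) \<in> subtree i" "Inr (Inr (i @ [k])) \<in> subtree i" if "k \<noteq> 0" for k
    using that by (auto simp: subtree_simps)
  moreover have "depth_max r (i @ [k]) y = depth_max r (i @ [k]) y'" if "k \<noteq> 0" for k
    using Suc.prems subtree_child[of k i] that by (intro Suc.IH) auto
  ultimately show ?case using Suc.prems
    by (auto intro!: arg_cong[where f = Max] image_cong)
qed simp

lemma depth_max_measurable:
  "subtree i \<subseteq> A \<Longrightarrow> depth_max r i \<in> borel_measurable (PiM A (\<lambda>_. borel))"
proof (induction r arbitrary: i)
  case (Suc r)
  have mem: "Inl i \<in> A" "\<And>k. k \<noteq> 0 \<Longrightarrow> Inr (Inl (i @ [k])) \<in> A" "\<And>k. k \<noteq> 0 \<Longrightarrow> Inr (Inr (i @ [k])) \<in> A"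
    using Suc.prems by (auto simp: subset_iff subtree_simps intro!: bexI[of _ "[]"])
  have comp [measurable]: "(\<lambda>y. y x) \<in> borel_measurable (PiM A (\<lambda>_. borel))" if "x \<in> A" for x
    using that by (rule measurable_component_singleton)
  have IH: "depth_max r (i @ [k]) \<in> borel_measurable (PiM A (\<lambda>_. borel))" if "k \<noteq> 0" for k
    using Suc.prems subtree_child[of k i] that by (intro Suc.IH) auto
  have "(\<lambda>y. (\<lambda>n y. Max ((\<lambda>k. if k = 0 then 0
      else y (Inr (Inl (i @ [k]))) - y (Inr (Inr (i @ [k]))) + depth_max r (i @ [k]) y) ` {0..n}))
      (nat \<lfloor>y (Inl i)\<rfloor>) y) \<in> borel_measurable (PiM A (\<lambda>_. borel))"
  proof (rule measurable_compose_countable)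
    show "(\<lambda>y::tree_index \<Rightarrow> real. nat \<lfloor>y (Inl i)\<rfloor>) \<in> measurable (PiM A (\<lambda>_. borel)) (count_space UNIV)"
      by (rule measurable_compose[OF measurable_compose[OF comp[OF mem(1)] measurable_real_floor]]) simp
    fix n :: nat
    show "(\<lambda>y. Max ((\<lambda>k. if k = 0 then 0
      else y (Inr (Inl (i @ [k]))) - y (Inr (Inr (i @ [k]))) + depth_max r (i @ [k]) y) ` {0..n}))
      \<in> borel_measurable (PiM A (\<lambda>_. borel))"
    proof (rule borel_measurable_Max)
      fix k
      show "(\<lambda>y. if k = 0 then 0
        else y (Inr (Inl (i @ [k]))) - y (Inr (Inr (i @ [k]))) + depth_max r (i @ [k]) y)
        \<in> borel_measurable (PiM A (\<lambda>_. borel))"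
        using comp[OF mem(2)[of k]] comp[OF mem(3)[of k]] IH[of k]
        by (cases "k = 0") (auto intro!: borel_measurable_add borel_measurable_diff)
    qed simp
  qed
  then show ?case by simp
next
  case 0
  have "depth_max 0 i = (\<lambda>_. 0)" for i by (simp add: fun_eq_iff)
  then show ?case by simp
qed

text \<open>\<open>generation\<close> extends paths at the leaf, whereas the recursion for W cuts
  the tree at the root; this describes the same set from the root.\<close>

lemma generation_Suc_Cons:
  "generation n (Suc r) = {k # w | k w. 1 \<le> k \<and> k \<le> n [] \<and> w \<in> generation (\<lambda>v. n (k # v)) r}"
proof (induction r)
  case 0 show ?case by auto
next
  case (Suc r)
  have "generation n (Suc (Suc r)) = {i @ [k] | i k. i \<in> generation n (Suc r) \<and> 1 \<le> k \<and> k \<le> n i}"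
    by (simp only: generation.simps(2)[of n "Suc r"])
  also have "\<dots> = {k # w | k w. 1 \<le> k \<and> k \<le> n [] \<and> w \<in> generation (\<lambda>v. n (k # v)) (Suc r)}"
    unfolding Suc.IH by (force simp: generation.simps(2) intro: exI[of _ "_ # _"])
  finally show ?case .
qed

lemma walk_Nil [simp]: "walk x [] = 0"
  by (simp add: walk_def)

lemma walk_Cons: "walk x (k # w) = x [k] + walk (\<lambda>v. x (k # v)) w"
  unfolding walk_def
  by (simp add: sum.atLeast_Suc_atMost sum.shift_bounds_cl_Suc_ivl del: sum.cl_ivl_Suc)

text \<open>Links the recursion at the root with the generationwise supremum that defines W. Strict
  upper level sets are compared because they turn both \<open>Max\<close> and \<open>SUP\<close>
  into existential statements and avoid arithmetic on extended reals.\<close>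

lemma less_depth_max_iff:
  "z < depth_max r i y \<longleftrightarrow> (\<exists>s\<le>r. \<exists>w \<in> generation (\<lambda>v. nat \<lfloor>y (Inl (i @ v))\<rfloor>) s.
     z < walk (\<lambda>v. y (Inr (Inl (i @ v))) - y (Inr (Inr (i @ v)))) w)"
proof (induction r arbitrary: i z)
  case (Suc r)
  let ?n = "\<lambda>i v. nat \<lfloor>y (Inl (i @ v))\<rfloor>" and ?x = "\<lambda>i v. y (Inr (Inl (i @ v))) - y (Inr (Inr (i @ v)))"
  have set_Cons: "(\<exists>w\<in>{k # w | k w. 1 \<le> k \<and> k \<le> m \<and> w \<in> R k}. S w) \<longleftrightarrow> (\<exists>k. 1 \<le> k \<and> k \<le> m \<and> (\<exists>w\<in>R k. S (k # w)))"
    for m :: nat and R and S :: "nat list \<Rightarrow> bool" by blast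
  have gen: "(\<exists>w\<in>generation (?n i) (Suc s). z < walk (?x i) w) \<longleftrightarrow>
      (\<exists>k. 1 \<le> k \<and> k \<le> ?n i [] \<and> (\<exists>w\<in>generation (?n (i @ [k])) s. z < ?x i [k] + walk (?x (i @ [k])) w))" for s
    unfolding generation_Suc_Cons set_Cons by (simp add: walk_Cons)
  have "z < depth_max (Suc r) i y \<longleftrightarrow> z < 0 \<or> (\<exists>k. 1 \<le> k \<and> k \<le> ?n i [] \<and> z - ?x i [k] < depth_max r (i @ [k]) y)"
    by (subst depth_max.simps, subst Max_gr_iff) (force simp: algebra_simps Suc_le_eq)+
  also have "\<dots> \<longleftrightarrow> z < 0 \<or> (\<exists>k. 1 \<le> k \<and> k \<le> ?n i [] \<and> (\<exists>s\<le>r. \<exists>w\<in>generation (?n (i @ [k])) s. z < ?x i [k] + walk (?x (i @ [k])) w))"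
    unfolding Suc.IH by (simp add: less_diff_eq diff_less_eq add.commute)
  also have "\<dots> \<longleftrightarrow> z < 0 \<or> (\<exists>s\<le>r. \<exists>w\<in>generation (?n i) (Suc s). z < walk (?x i) w)"
    unfolding gen by blast
  also have "\<dots> \<longleftrightarrow> (\<exists>s\<le>Suc r. \<exists>w\<in>generation (?n i) s. z < walk (?x i) w)"
  proof -
    have "(\<exists>s\<le>Suc r. P s) \<longleftrightarrow> P 0 \<or> (\<exists>s\<le>r. P (Suc s))" for P :: "nat \<Rightarrow> bool"
      by (metis Suc_le_mono le0 not0_implies_Suc)
    then show ?thesis by simp
  qed
  finally show ?case .
qed simp

lemma less_endogenous_iff:
  assumes "\<And>i. y (Inl i) = real (N i \<omega>)" "\<And>i. y (Inr (Inl i)) = chi i \<omega>" "\<And>i. y (Inr (Inr i)) = tau i \<omega>"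
  shows "ereal z < endogenous N chi tau \<omega> \<longleftrightarrow> (\<exists>r. z < depth_max r [] y)"
  by (auto simp: endogenous_def less_SUP_iff less_depth_max_iff assms)

text \<open>The probability that at least one of N independent children succeeds, each with
  probability v: one minus the generating function of \<open>f\<close> at
  \<open>1 - v\<close>.\<close>

definition some_child :: "nat pmf \<Rightarrow> real \<Rightarrow> real" where
  "some_child f v = measure_pmf.expectation f (\<lambda>n. 1 - (1 - v) ^ n)"

definition jump_law :: "real measure \<Rightarrow> real \<Rightarrow> real measure" where
  "jump_law B l = distr (B \<Otimes>\<^sub>M density lborel (exponential_density l)) borel (\<lambda>(c, t). c - t)"

definition jump_tail :: "real measure \<Rightarrow> real \<Rightarrow> (real \<Rightarrow> real) \<Rightarrow> real \<Rightarrow> real" where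
  "jump_tail B l G x = (\<integral>u. G (x - u) \<partial>jump_law B l)"

fun depth_tail :: "nat pmf \<Rightarrow> real measure \<Rightarrow> real \<Rightarrow> nat \<Rightarrow> real \<Rightarrow> real" where
  "depth_tail f B l 0 x = (if x < 0 then 1 else 0)"
| "depth_tail f B l (Suc r) x = (if x < 0 then 1 else some_child f (jump_tail B l (depth_tail f B l r) x))"

lemma sets_jump_law [simp, measurable_cong]: "sets (jump_law B l) = sets borel"
  and space_jump_law [simp]: "space (jump_law B l) = UNIV"
  by (simp_all add: jump_law_def)

lemma measure_pair_measure_slices:
  assumes "finite_measure M2" and X: "X \<in> sets (M1 \<Otimes>\<^sub>M M2)"
  shows "measure (M1 \<Otimes>\<^sub>M M2) X = (\<integral>x. measure M2 (Pair x -` X) \<partial>M1)"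
proof -
  interpret M2: finite_measure M2 by fact
  have [measurable]: "(\<lambda>x. measure M2 (Pair x -` X)) \<in> borel_measurable M1"
    unfolding measure_def using M2.measurable_emeasure_Pair[OF X] by measurable
  have "measure (M1 \<Otimes>\<^sub>M M2) X = enn2real (\<integral>\<^sup>+x. ennreal (measure M2 (Pair x -` X)) \<partial>M1)"
    using X by (simp add: measure_def[of "M1 \<Otimes>\<^sub>M M2"] M2.emeasure_pair_measure_alt M2.emeasure_eq_measure)
  also have "\<dots> = (\<integral>x. measure M2 (Pair x -` X) \<partial>M1)"
    by (rule integral_eq_nn_integral[symmetric]) auto
  finally show ?thesis .
qed

section \<open>The law of the supremum truncated at depth r\<close>

locale lindley_tree = prob_space M
  for M :: "'a measure" and f :: "nat pmf" and B :: "real measure" and l :: real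
    and N :: "nat list \<Rightarrow> 'a \<Rightarrow> nat" and chi tau :: "nat list \<Rightarrow> 'a \<Rightarrow> real" +
  assumes B_prob: "prob_space B" "sets B = sets borel" and rate: "0 < l"
    and N_law: "\<And>i. i \<in> nodes \<Longrightarrow> distr M (count_space UNIV) (N i) = measure_pmf f"
    and chi_law: "\<And>i. i \<in> nodes \<Longrightarrow> distr M borel (chi i) = B"
    and tau_law: "\<And>i. i \<in> nodes \<Longrightarrow> distributed M lborel (tau i) (exponential_density l)"
    and indep: "indep_vars (\<lambda>_. borel) (case_sum (\<lambda>i \<omega>. real (N i \<omega>)) (case_sum chi tau)) (nodes <+> (nodes <+> nodes))"
begin

definition var :: "tree_index \<Rightarrow> 'a \<Rightarrow> real" where
  "var = case_sum (\<lambda>i \<omega>. real (N i \<omega>)) (case_sum chi tau)"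

definition vars :: "tree_index set" where "vars = nodes <+> (nodes <+> nodes)"

lemma indep_var_vars: "indep_vars (\<lambda>_. borel) var vars"
  using indep by (simp add: var_def vars_def)

lemma var_simps [simp]:
  "var (Inl i) \<omega> = real (N i \<omega>)" "var (Inr (Inl i)) \<omega> = chi i \<omega>" "var (Inr (Inr i)) \<omega> = tau i \<omega>"
  by (simp_all add: var_def)

lemma vars_simps [simp]:
  "Inl i \<in> vars \<longleftrightarrow> i \<in> nodes" "Inr (Inl i) \<in> vars \<longleftrightarrow> i \<in> nodes" "Inr (Inr i) \<in> vars \<longleftrightarrow> i \<in> nodes"
  by (auto simp: vars_def)

lemma var_measurable: "x \<in> vars \<Longrightarrow> var x \<in> borel_measurable M"
  using indep_var_vars unfolding indep_vars_def by blast

lemma subtree_vars: "i \<in> nodes \<Longrightarrow> subtree i \<subseteq> vars"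
  by (auto simp: subtree_def)

definition depth_sup :: "nat \<Rightarrow> nat list \<Rightarrow> 'a \<Rightarrow> real" where
  "depth_sup r i \<omega> = depth_max r i (\<lambda>x. var x \<omega>)"

lemma depth_sup_restrict: "depth_sup r i \<omega> = depth_max r i (restrict (\<lambda>x. var x \<omega>) (subtree i))"
  unfolding depth_sup_def by (rule depth_max_cong) simp

lemma depth_sup_measurable [measurable]: "i \<in> nodes \<Longrightarrow> depth_sup r i \<in> borel_measurable M"
  unfolding depth_sup_restrict[abs_def]
  by (intro measurable_compose[OF measurable_restrict depth_max_measurable[OF order_refl]] var_measurable)
    (use subtree_vars in auto)

lemma chi_measurable [measurable]: "i \<in> nodes \<Longrightarrow> chi i \<in> borel_measurable M"
  using var_measurable[of "Inr (Inl i)"] by (simp add: var_def)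

lemma tau_measurable [measurable]: "i \<in> nodes \<Longrightarrow> tau i \<in> borel_measurable M"
  using var_measurable[of "Inr (Inr i)"] by (simp add: var_def)

lemma N_measurable: "i \<in> nodes \<Longrightarrow> (\<lambda>\<omega>. real (N i \<omega>)) \<in> borel_measurable M"
  using var_measurable[of "Inl i"] by (simp add: var_def)

lemma endogenous_greater: "{\<omega>\<in>space M. ereal x < endogenous N chi tau \<omega>} = (\<Union>r. {\<omega>\<in>space M. x < depth_sup r [] \<omega>})"
  by (auto simp: less_endogenous_iff[where y = "\<lambda>x. var x _"] depth_sup_def)

lemma endogenous_measurable [measurable]: "endogenous N chi tau \<in> borel_measurable M"
proof (rule borel_measurableI_greater)
  fix z :: ereal
  have *: "{\<omega>\<in>space M. ereal x < endogenous N chi tau \<omega>} \<in> sets M" for x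
    unfolding endogenous_greater by measurable
  show "{\<omega>\<in>space M. z < endogenous N chi tau \<omega>} \<in> sets M"
  proof (cases z)
    case PInf then show ?thesis by simp
  next
    case MInf
    have "- \<infinity> < endogenous N chi tau \<omega>" for \<omega>
    proof -
      have "ereal (- 1) < endogenous N chi tau \<omega>"
        using less_endogenous_iff[of "\<lambda>x. var x \<omega>" N \<omega> chi tau "- 1"] by (auto intro!: exI[of _ 0])
      then show ?thesis using less_trans[of "- \<infinity>" "ereal (- 1)"] by simp
    qed
    then have "{\<omega>\<in>space M. z < endogenous N chi tau \<omega>} = space M" using MInf by simp
    then show ?thesis by simp
  qed (use * in simp)
qed

lemma edge_law: "i \<in> nodes \<Longrightarrow> distr M borel (\<lambda>\<omega>. chi i \<omega> - tau i \<omega>) = jump_law B l"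
proof -
  assume i: "i \<in> nodes"
  have "indep_var (PiM {Inr (Inl i)} (\<lambda>_. borel)) (\<lambda>\<omega>. restrict (\<lambda>x. var x \<omega>) {Inr (Inl i)})
      (PiM {Inr (Inr i)} (\<lambda>_. borel)) (\<lambda>\<omega>. restrict (\<lambda>x. var x \<omega>) {Inr (Inr i)})"
    by (rule indep_var_restrict[OF indep_var_vars]) (use i in auto)
  then have "indep_var borel ((\<lambda>y. y (Inr (Inl i))) \<circ> (\<lambda>\<omega>. restrict (\<lambda>x. var x \<omega>) {Inr (Inl i)}))
      borel ((\<lambda>y. y (Inr (Inr i))) \<circ> (\<lambda>\<omega>. restrict (\<lambda>x. var x \<omega>) {Inr (Inr i)}))"
    by (rule indep_var_compose) auto
  then have "indep_var borel (chi i) borel (tau i)" by (simp add: comp_def)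
  then have "distr M borel (chi i) \<Otimes>\<^sub>M distr M borel (tau i) = distr M (borel \<Otimes>\<^sub>M borel) (\<lambda>\<omega>. (chi i \<omega>, tau i \<omega>))"
    by (simp add: indep_var_distribution_eq)
  moreover have "distr M borel (tau i) = density lborel (exponential_density l)"
    using tau_law[OF i] by (simp add: distributed_def cong: distr_cong)
  ultimately have "jump_law B l = distr (distr M (borel \<Otimes>\<^sub>M borel) (\<lambda>\<omega>. (chi i \<omega>, tau i \<omega>))) borel (\<lambda>(c, t). c - t)"
    unfolding jump_law_def using chi_law[OF i] by simp
  also have "\<dots> = distr M borel (\<lambda>\<omega>. chi i \<omega> - tau i \<omega>)"
    using i by (subst distr_distr) (auto simp: comp_def)
  finally show ?thesis ..
qed

sublocale J: prob_space "jump_law B l"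
  using edge_law[of "[]"] prob_space_distr[of "\<lambda>\<omega>. chi [] \<omega> - tau [] \<omega>" borel] by simp

text \<open>The variables of the edge into a child and those of its subtree occupy disjoint index
  sets, so step and supremum are independent and the tail of their sum is a convolution.\<close>

lemma child_tail:
  assumes i: "i \<in> nodes" and k: "1 \<le> k"
    and G: "\<And>x. prob {\<omega>\<in>space M. x < depth_sup r (i @ [k]) \<omega>} = G x"
  shows "prob {\<omega>\<in>space M. x < chi (i @ [k]) \<omega> - tau (i @ [k]) \<omega> + depth_sup r (i @ [k]) \<omega>} = jump_tail B l G x"
proof -
  let ?j = "i @ [k]"
  have j: "?j \<in> nodes" using i k by simp
  let ?X = "\<lambda>\<omega>. chi ?j \<omega> - tau ?j \<omega>" and ?W = "depth_sup r ?j"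
  have [measurable]: "?X \<in> borel_measurable M" "?W \<in> borel_measurable M" using j by measurable
  let ?E = "{Inr (Inl ?j), Inr (Inr ?j)} :: tree_index set"
  have "indep_var (PiM ?E (\<lambda>_. borel)) (\<lambda>\<omega>. restrict (\<lambda>x. var x \<omega>) ?E)
      (PiM (subtree ?j) (\<lambda>_. borel)) (\<lambda>\<omega>. restrict (\<lambda>x. var x \<omega>) (subtree ?j))"
    by (rule indep_var_restrict[OF indep_var_vars]) (use j subtree_vars[OF j] in \<open>auto simp: subtree_simps\<close>)
  then have "indep_var borel ((\<lambda>y. y (Inr (Inl ?j)) - y (Inr (Inr ?j))) \<circ> (\<lambda>\<omega>. restrict (\<lambda>x. var x \<omega>) ?E))
      borel (depth_max r ?j \<circ> (\<lambda>\<omega>. restrict (\<lambda>x. var x \<omega>) (subtree ?j)))"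
    by (rule indep_var_compose) (auto intro!: borel_measurable_diff depth_max_measurable)
  then have ind: "indep_var borel ?X borel ?W"
    by (simp add: comp_def depth_sup_restrict[symmetric])
  interpret W: prob_space "distr M borel ?W" by (rule prob_space_distr) simp
  interpret P: pair_prob_space "jump_law B l" "distr M borel ?W" ..
  have joint: "distr M (borel \<Otimes>\<^sub>M borel) (\<lambda>\<omega>. (?X \<omega>, ?W \<omega>)) = jump_law B l \<Otimes>\<^sub>M distr M borel ?W"
    using ind edge_law[OF j] by (simp add: indep_var_distribution_eq)
  let ?A = "{p :: real \<times> real. x < fst p + snd p}"
  have "{p \<in> space (borel \<Otimes>\<^sub>M borel). x < fst p + snd p} \<in> sets (borel \<Otimes>\<^sub>M (borel :: real measure))"
    by measurable
  then have A [measurable]: "?A \<in> sets (borel \<Otimes>\<^sub>M borel)" by (simp add: space_pair_measure)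
  have "prob {\<omega>\<in>space M. x < ?X \<omega> + ?W \<omega>} = measure (distr M (borel \<Otimes>\<^sub>M borel) (\<lambda>\<omega>. (?X \<omega>, ?W \<omega>))) ?A"
    by (subst measure_distr) (auto intro!: arg_cong[where f = prob])
  also have "\<dots> = (\<integral>u. measure (distr M borel ?W) (Pair u -` ?A) \<partial>jump_law B l)"
    unfolding joint by (rule measure_pair_measure_slices) (use A in \<open>auto intro!: W.finite_measure_axioms cong: measurable_cong_sets\<close>)
  also have "\<dots> = jump_tail B l G x"
    unfolding jump_tail_def
  proof (rule Bochner_Integration.integral_cong[OF refl])
    fix u
    have "measure (distr M borel ?W) (Pair u -` {p. x < fst p + snd p}) = prob {\<omega>\<in>space M. x - u < ?W \<omega>}"
      by (subst measure_distr) (auto intro!: arg_cong[where f = prob])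
    then show "measure (distr M borel ?W) (Pair u -` {p. x < fst p + snd p}) = G (x - u)" by (simp add: G)
  qed
  finally show ?thesis .
qed

lemma N_count_measurable: "i \<in> nodes \<Longrightarrow> N i \<in> measurable M (count_space UNIV)"
proof -
  assume "i \<in> nodes"
  from measurable_compose[OF measurable_compose[OF N_measurable[OF this] measurable_real_floor], of nat]
  show ?thesis by simp
qed

lemma N_prob: "i \<in> nodes \<Longrightarrow> prob {\<omega>\<in>space M. N i \<omega> = n} = pmf f n"
proof -
  assume i: "i \<in> nodes"
  have "pmf f n = measure (distr M (count_space UNIV) (N i)) {n}" by (simp add: N_law[OF i] pmf.rep_eq)
  also have "\<dots> = prob {\<omega>\<in>space M. N i \<omega> = n}"
    using N_count_measurable[OF i] by (subst measure_distr) (auto intro!: arg_cong[where f = prob])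
  finally show ?thesis ..
qed

definition child_val :: "nat \<Rightarrow> nat list \<Rightarrow> nat \<Rightarrow> 'a \<Rightarrow> real" where
  "child_val r i k \<omega> = chi (i @ [k]) \<omega> - tau (i @ [k]) \<omega> + depth_sup r (i @ [k]) \<omega>"

lemma child_val_measurable [measurable]: "i \<in> nodes \<Longrightarrow> 1 \<le> k \<Longrightarrow> child_val r i k \<in> borel_measurable M"
  unfolding child_val_def[abs_def] by measurable

lemma depth_sup_Suc_le_iff:
  "0 \<le> x \<Longrightarrow> depth_sup (Suc r) i \<omega> \<le> x \<longleftrightarrow> (\<forall>k\<in>{1..N i \<omega>}. child_val r i k \<omega> \<le> x)"
  by (auto simp: depth_sup_def child_val_def)

lemma depth_sup_nonneg: "0 \<le> depth_sup r i \<omega>"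
  by (cases r) (auto simp: depth_sup_def intro!: Max_ge)

text \<open>The index blocks \<open>K k\<close> are disjoint: the count at the node for k = 0, and
  the k-th edge with its subtree otherwise. Values are attached to all potential children, so that
  the random number of actual ones can be fixed afterwards.\<close>

lemma indep_children:
  assumes i: "i \<in> nodes"
  shows "indep_vars (\<lambda>_. borel) (\<lambda>k \<omega>. if k = 0 then real (N i \<omega>) else child_val r i k \<omega>) UNIV"
proof -
  define K where "K k = (if k = 0 then {Inl i} else
     {Inr (Inl (i @ [k])), Inr (Inr (i @ [k]))} \<union> subtree (i @ [k]))" for k :: nat
  define g where "g k y = (if k = 0 then y (Inl i) else
     y (Inr (Inl (i @ [k]))) - y (Inr (Inr (i @ [k]))) + depth_max r (i @ [k]) y)" for k y
  have "indep_vars (\<lambda>k. PiM (K k) (\<lambda>_. borel)) (\<lambda>k \<omega>. restrict (\<lambda>x. var x \<omega>) (K k)) UNIV"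
  proof (rule indep_vars_restrict[OF indep_var_vars])
    show "K k \<subseteq> vars" for k
      using i subtree_vars[of "i @ [k]"] by (auto simp: K_def)
    show "disjoint_family_on K UNIV"
      by (auto simp: disjoint_family_on_def K_def subtree_def)
  qed
  then have "indep_vars (\<lambda>_. borel) (\<lambda>k \<omega>. g k (restrict (\<lambda>x. var x \<omega>) (K k))) UNIV"
  proof (rule indep_vars_compose2)
    fix k
    show "g k \<in> borel_measurable (PiM (K k) (\<lambda>_. borel))"
      unfolding g_def[abs_def]
      by (cases "k = 0") (auto simp: K_def intro!: borel_measurable_add borel_measurable_diff depth_max_measurable)
  qed
  moreover have "g k (restrict (\<lambda>x. var x \<omega>) (K k)) = (if k = 0 then real (N i \<omega>) else child_val r i k \<omega>)" for k \<omega>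
  proof (cases "k = 0")
    case True then show ?thesis by (simp add: g_def K_def)
  next
    case False
    have "depth_max r (i @ [k]) (restrict (\<lambda>x. var x \<omega>) (K k)) = depth_max r (i @ [k]) (\<lambda>x. var x \<omega>)"
      by (rule depth_max_cong) (use False in \<open>simp add: K_def\<close>)
    then show ?thesis using False by (simp add: g_def K_def child_val_def depth_sup_def)
  qed
  ultimately show ?thesis by simp
qed

end

lemma sums_pmf_nat:
  fixes g :: "nat \<Rightarrow> real"
  assumes "integrable (measure_pmf f) g"
  shows "(\<lambda>n. pmf f n * g n) sums measure_pmf.expectation f g"
proof -
  have "integrable (count_space UNIV) (\<lambda>n. pmf f n * g n)"
    using assms unfolding measure_pmf_eq_density by (subst (asm) integrable_density) auto
  from sums_integral_count_space_nat[OF this] show ?thesis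
    unfolding measure_pmf_eq_density by (subst integral_density) auto
qed

lemma integrable_pmf_power:
  fixes v :: real
  assumes "0 \<le> v" "v \<le> 1"
  shows "integrable (measure_pmf f) (\<lambda>n. (1 - v) ^ n)"
  by (rule measure_pmf.integrable_const_bound[where B = 1]) (use assms in \<open>auto simp: power_le_one\<close>)

context lindley_tree
begin

text \<open>Splitting over the value n of \<open>N i\<close>: on that event the supremum is at most
  x \<ge> 0 iff the first n child values are, which independently of the count has probability
  \<open>(1 - v) ^ n\<close>. All nodes are treated at once since the induction passes to the
  children.\<close>

lemma depth_law:
  "i \<in> nodes \<Longrightarrow> prob {\<omega>\<in>space M. x < depth_sup r i \<omega>} = depth_tail f B l r x"
proof (induction r arbitrary: i x)
  case 0
  show ?case by (auto simp: depth_sup_def prob_space)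
next
  case (Suc r)
  show ?case
  proof (cases "x < 0")
    case True
    then have "{\<omega>\<in>space M. x < depth_sup (Suc r) i \<omega>} = space M"
      using depth_sup_nonneg[of "Suc r" i] by (auto intro: less_le_trans)
    then show ?thesis using True by (simp add: prob_space)
  next
    case False
    define v where "v = jump_tail B l (depth_tail f B l r) x"
    have v: "prob {\<omega>\<in>space M. x < child_val r i k \<omega>} = v" if "1 \<le> k" for k
      unfolding child_val_def v_def using Suc.IH Suc.prems that by (intro child_tail) auto
    have v01: "0 \<le> v" "v \<le> 1" using v[of 1] by (auto simp del: v simp: v[of 1, symmetric])
    have v': "prob {\<omega>\<in>space M. child_val r i k \<omega> \<le> x} = 1 - v" if "1 \<le> k" for k
      using prob_neg[of "\<lambda>\<omega>. x < child_val r i k \<omega>"] Suc.prems that by (simp add: v not_less)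
    define E where "E n = {\<omega>\<in>space M. N i \<omega> = n \<and> (\<forall>k\<in>{1..n}. child_val r i k \<omega> \<le> x)}" for n
    have E_eq: "E n = (\<Inter>k\<in>{0..n}. (\<lambda>\<omega>. if k = 0 then real (N i \<omega>) else child_val r i k \<omega>)
        -` (if k = 0 then {real n} else {..x}) \<inter> space M)" for n
    proof -
      have "{0..n} = insert 0 {1..n}" by auto
      then show ?thesis by (auto simp: E_def)
    qed
    have E_prob: "prob (E n) = pmf f n * (1 - v) ^ n" for n
    proof -
      have "prob (E n) = (\<Prod>k\<in>{0..n}. prob ((\<lambda>\<omega>. if k = 0 then real (N i \<omega>) else child_val r i k \<omega>)
        -` (if k = 0 then {real n} else {..x}) \<inter> space M))"
        unfolding E_eq by (rule indep_varsD[OF indep_children[OF Suc.prems]]) auto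
      also have "\<dots> = prob {\<omega>\<in>space M. N i \<omega> = n} * (\<Prod>k\<in>{1..n}. prob {\<omega>\<in>space M. child_val r i k \<omega> \<le> x})"
      proof -
        have "{0..n} = insert 0 {1..n}" by auto
        then show ?thesis by (auto intro!: arg_cong2[where f = "(*)"] prod.cong arg_cong[where f = prob])
      qed
      also have "\<dots> = pmf f n * (1 - v) ^ n" using Suc.prems by (simp add: N_prob v')
      finally show ?thesis .
    qed
    have E_sets: "E n \<in> sets M" for n
    proof -
      have "Measurable.pred M (\<lambda>\<omega>. N i \<omega> = n)" using N_count_measurable[OF Suc.prems] by measurable
      moreover have "Measurable.pred M (\<lambda>\<omega>. child_val r i k \<omega> \<le> x)" if "k \<in> {1..n}" for k
      proof -
        have [measurable]: "child_val r i k \<in> borel_measurable M" using that Suc.prems by auto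
        show ?thesis by measurable
      qed
      ultimately show ?thesis unfolding E_def
        by (intro sets.sets_Collect_conj sets.sets_Collect_finite_All) (auto simp: pred_def)
    qed
    have "(\<lambda>n. prob (E n)) sums prob (\<Union>n. E n)"
      using E_sets by (intro finite_measure_UNION) (auto simp: disjoint_family_on_def E_def)
    moreover have "(\<lambda>n. prob (E n)) sums measure_pmf.expectation f (\<lambda>n. (1 - v) ^ n)"
      unfolding E_prob by (rule sums_pmf_nat[OF integrable_pmf_power[OF v01]])
    ultimately have "prob (\<Union>n. E n) = measure_pmf.expectation f (\<lambda>n. (1 - v) ^ n)"
      by (rule sums_unique2)
    moreover have "(\<Union>n. E n) = {\<omega>\<in>space M. depth_sup (Suc r) i \<omega> \<le> x}"
      using False by (auto simp: E_def depth_sup_Suc_le_iff)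
    moreover have "prob {\<omega>\<in>space M. x < depth_sup (Suc r) i \<omega>} = 1 - prob {\<omega>\<in>space M. depth_sup (Suc r) i \<omega> \<le> x}"
      using prob_neg[of "\<lambda>\<omega>. depth_sup (Suc r) i \<omega> \<le> x"] Suc.prems by (simp add: not_le)
    ultimately show ?thesis
      using False integrable_pmf_power[OF v01, of f] by (simp add: some_child_def v_def)
  qed
qed

end

text \<open>With y = n v, the defect in the second bound is at most y, and by a second-order
  Bernoulli estimate (\<open>quad\<close>) at most the square of y. The former for y \<ge> 1 and the
  latter for y < 1 give y to the power 1 + \<beta>, so that a moment of N of this order suffices
  later.\<close>

lemma one_minus_power_bounds:
  fixes v :: real
  assumes v: "0 \<le> v" "v \<le> 1" and \<beta>: "0 < \<beta>" "\<beta> \<le> 1"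
  shows "1 - (1 - v) ^ n \<le> real n * v"
    and "real n * v - (1 - (1 - v) ^ n) \<le> real n powr (1 + \<beta>) * v powr (1 + \<beta>)"
proof -
  show 1: "1 - (1 - v) ^ n \<le> real n * v"
    using Bernoulli_inequality[of "- v" n] v by simp
  have quad: "(1 - v) ^ n \<le> 1 - real n * v + (real n * v)\<^sup>2"
  proof (induction n)
    case (Suc n)
    have "(1 - v) ^ Suc n \<le> (1 - v) * (1 - real n * v + (real n * v)\<^sup>2)"
      using Suc v by (simp add: mult_left_mono)
    also have "\<dots> = 1 - real (Suc n) * v + ((real n)\<^sup>2 + real n) * v\<^sup>2 - (real n)\<^sup>2 * v ^ 3"
      by (simp add: algebra_simps power2_eq_square power3_eq_cube)
    also have "\<dots> \<le> 1 - real (Suc n) * v + (real (Suc n))\<^sup>2 * v\<^sup>2"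
    proof -
      have "((real n)\<^sup>2 + real n) * v\<^sup>2 \<le> (real (Suc n))\<^sup>2 * v\<^sup>2"
        by (intro mult_right_mono) (auto simp: power2_eq_square algebra_simps)
      moreover have "0 \<le> (real n)\<^sup>2 * v ^ 3" using v by simp
      ultimately show ?thesis by linarith
    qed
    finally show ?case by (simp add: power_mult_distrib)
  qed simp
  show "real n * v - (1 - (1 - v) ^ n) \<le> real n powr (1 + \<beta>) * v powr (1 + \<beta>)"
  proof (cases "n = 0 \<or> v = 0")
    case True then show ?thesis by auto
  next
    case False
    then have pos: "0 < real n * v" using v by simp
    have "real n * v - (1 - (1 - v) ^ n) \<le> (real n * v) powr (1 + \<beta>)"
    proof (cases "1 \<le> real n * v")
      case True
      have "(real n * v) powr 1 \<le> (real n * v) powr (1 + \<beta>)" using True \<beta> by (intro powr_mono) auto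
      moreover have "real n * v - (1 - (1 - v) ^ n) \<le> real n * v" using v by (simp add: power_le_one)
      ultimately show ?thesis using pos by simp
    next
      case False
      have "(real n * v) powr 2 \<le> (real n * v) powr (1 + \<beta>)" using False pos \<beta> by (intro powr_mono') auto
      then show ?thesis using quad pos by simp
    qed
    then show ?thesis using v by (simp add: powr_mult)
  qed
qed

text \<open>The lower bound rests on N \<ge> 1, through \<open>(1 - v) ^ n \<le> 1 - v\<close>; the
  upper one is Bernoulli's inequality and replaces the recursion by its linearisation.\<close>

lemma some_child_bounds:
  assumes f: "set_pmf f \<subseteq> {1..}" "integrable (measure_pmf f) real" and v: "0 \<le> v" "v \<le> 1"
  shows "v \<le> some_child f v"
    and "some_child f v \<le> measure_pmf.expectation f real * v"
proof -
  have i: "integrable (measure_pmf f) (\<lambda>n. 1 - (1 - v) ^ n)"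
    by (intro Bochner_Integration.integrable_diff integrable_pmf_power v) auto
  show "v \<le> some_child f v"
    unfolding some_child_def
  proof (rule measure_pmf.integral_ge_const[OF i])
    show "AE n in measure_pmf f. v \<le> 1 - (1 - v) ^ n"
    proof (rule AE_pmfI)
      fix n assume "n \<in> set_pmf f"
      then have "1 \<le> n" using f(1) by auto
      then have "(1 - v) ^ n \<le> (1 - v) ^ 1" using v by (intro power_decreasing) auto
      then show "v \<le> 1 - (1 - v) ^ n" by simp
    qed
  qed
  have "some_child f v \<le> measure_pmf.expectation f (\<lambda>n. real n * v)"
    unfolding some_child_def
    by (rule integral_mono[OF i]) (use f(2) one_minus_power_bounds(1)[OF v, of 1] in auto)
  then show "some_child f v \<le> measure_pmf.expectation f real * v" by simp
qed

lemma some_child_defect: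
  assumes f: "integrable (measure_pmf f) real" and v: "0 \<le> v" "v \<le> 1" and \<beta>: "0 < \<beta>" "\<beta> \<le> 1"
    and m: "integrable (measure_pmf f) (\<lambda>n. real n powr (1 + \<beta>))"
  shows "measure_pmf.expectation f real * v - some_child f v
    \<le> measure_pmf.expectation f (\<lambda>n. real n powr (1 + \<beta>)) * v powr (1 + \<beta>)"
proof -
  have i: "integrable (measure_pmf f) (\<lambda>n. 1 - (1 - v) ^ n)"
    by (intro Bochner_Integration.integrable_diff integrable_pmf_power v) auto
  have "measure_pmf.expectation f real * v - some_child f v
      = measure_pmf.expectation f (\<lambda>n. real n * v - (1 - (1 - v) ^ n))"
    unfolding some_child_def using f i by (subst Bochner_Integration.integral_diff) auto
  also have "\<dots> \<le> measure_pmf.expectation f (\<lambda>n. real n powr (1 + \<beta>) * v powr (1 + \<beta>))"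
    by (rule integral_mono) (use f i m one_minus_power_bounds(2)[OF v \<beta>] in \<open>auto intro!: Bochner_Integration.integrable_diff\<close>)
  finally show ?thesis by simp
qed

lemma some_child_tendsto:
  assumes v: "\<And>r::nat. 0 \<le> v r \<and> v r \<le> 1" and lim: "v \<longlonglongrightarrow> u"
  shows "(\<lambda>r. some_child f (v r)) \<longlonglongrightarrow> some_child f u"
  unfolding some_child_def
proof (rule integral_dominated_convergence[where w = "\<lambda>_. 1"])
  show "AE n in measure_pmf f. norm (1 - (1 - v r) ^ n) \<le> 1" for r
    using v[of r] by (auto simp: power_le_one)
qed (auto intro!: tendsto_intros lim)

lemma borel_measurable_antimono:
  fixes h :: "real \<Rightarrow> real"
  assumes "antimono h"
  shows "h \<in> borel_measurable borel"
proof -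
  have "mono (\<lambda>x. - h x)" using assms by (auto simp: mono_def antimono_def)
  then have "(\<lambda>x. - (- h x)) \<in> borel_measurable borel"
    by (intro borel_measurable_uminus borel_measurable_mono)
  then show ?thesis by simp
qed

section \<open>The tail of W: fixed point equation and exponential bound\<close>

context lindley_tree
begin

definition tail :: "real \<Rightarrow> real" where
  "tail x = prob {\<omega>\<in>space M. ereal x < endogenous N chi tau \<omega>}"

lemma antimono_tail: "antimono tail"
proof (rule antimonoI)
  fix x y :: real assume "x \<le> y"
  then have "ereal x < e" if "ereal y < e" for e using that by (meson ereal_less_eq(3) le_less_trans)
  then show "tail y \<le> tail x" unfolding tail_def by (intro finite_measure_mono) auto
qed

lemma tail_measurable [measurable]: "tail \<in> borel_measurable borel"
  by (rule borel_measurable_antimono[OF antimono_tail])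

lemma depth_tail_prob: "depth_tail f B l r x = prob {\<omega>\<in>space M. x < depth_sup r [] \<omega>}"
  by (simp add: depth_law)

lemma depth_tail_bounds: "0 \<le> depth_tail f B l r x" "depth_tail f B l r x \<le> 1"
  by (simp_all add: depth_tail_prob)

lemma depth_tail_measurable [measurable]: "depth_tail f B l r \<in> borel_measurable borel"
proof (rule borel_measurable_antimono, rule antimonoI)
  fix x y :: real assume "x \<le> y"
  then show "depth_tail f B l r y \<le> depth_tail f B l r x"
    unfolding depth_tail_prob by (intro finite_measure_mono) auto
qed

lemma tail_bounds: "0 \<le> tail x" "tail x \<le> 1"
  by (simp_all add: tail_def)

lemma depth_tail_tendsto: "(\<lambda>r. depth_tail f B l r x) \<longlonglongrightarrow> tail x"
proof -
  have "incseq (\<lambda>r. {\<omega>\<in>space M. x < depth_sup r [] \<omega>})"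
    by (auto simp: incseq_def depth_sup_def less_depth_max_iff dest: le_trans)
  then show ?thesis
    unfolding depth_tail_prob tail_def endogenous_greater by (intro finite_Lim_measure_incseq) auto
qed

lemma jump_tail_bounds:
  assumes [measurable]: "G \<in> borel_measurable borel" and G: "\<And>x. 0 \<le> G x" "\<And>x. G x \<le> 1"
  shows "integrable (jump_law B l) (\<lambda>u. G (x - u))" "0 \<le> jump_tail B l G x" "jump_tail B l G x \<le> 1"
proof -
  show i: "integrable (jump_law B l) (\<lambda>u. G (x - u))"
    by (rule J.integrable_const_bound[where B = 1]) (use G in auto)
  show "0 \<le> jump_tail B l G x" "jump_tail B l G x \<le> 1"
    unfolding jump_tail_def using J.integral_le_const[OF i, of 1] G by auto
qed

lemma tail_neg: "x < 0 \<Longrightarrow> tail x = 1"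
  by (rule LIMSEQ_unique[OF depth_tail_tendsto[of x]], rule LIMSEQ_offset[where k = 1]) simp

lemma tail_fixed_point: "0 \<le> x \<Longrightarrow> tail x = some_child f (jump_tail B l tail x)"
proof -
  assume x: "0 \<le> x"
  have "(\<lambda>r. jump_tail B l (depth_tail f B l r) x) \<longlonglongrightarrow> jump_tail B l tail x"
    unfolding jump_tail_def
    by (rule integral_dominated_convergence[where w = "\<lambda>_. 1"])
      (auto simp: depth_tail_bounds depth_tail_tendsto)
  then have "(\<lambda>r. some_child f (jump_tail B l (depth_tail f B l r) x)) \<longlonglongrightarrow> some_child f (jump_tail B l tail x)"
    using jump_tail_bounds depth_tail_bounds by (intro some_child_tendsto) auto
  moreover have "(\<lambda>r. depth_tail f B l (r + 1) x) \<longlonglongrightarrow> tail x"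
    by (rule LIMSEQ_ignore_initial_segment[OF depth_tail_tendsto])
  ultimately show ?thesis using x by (intro LIMSEQ_unique[of "\<lambda>r. depth_tail f B l (r + 1) x"]) auto
qed

text \<open>The linearised recursion, which sends G to E[N] V, fixes
  \<open>exp (- \<theta> * x)\<close> by the root equation, and \<open>some_child\<close> stays
  below its linearisation; so the bound survives each generation and the limit.\<close>

lemma tail_le_exp:
  assumes f: "set_pmf f \<subseteq> {1..}" "integrable (measure_pmf f) real"
    and e: "integrable (jump_law B l) (\<lambda>u. exp (\<theta> * u))"
      "measure_pmf.expectation f real * (\<integral>u. exp (\<theta> * u) \<partial>jump_law B l) = 1"
    and \<theta>: "0 < \<theta>"
  shows "tail x \<le> exp (- \<theta> * x)"
proof -
  let ?m = "measure_pmf.expectation f real"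
  have m: "0 \<le> ?m" by simp
  have "depth_tail f B l r x \<le> exp (- \<theta> * x)" for r
  proof (induction r arbitrary: x)
    case 0
    show ?case using \<theta> by (auto simp: mult_nonneg_nonpos)
  next
    case (Suc r)
    show ?case
    proof (cases "x < 0")
      case True then show ?thesis using \<theta> by (simp add: mult_nonneg_nonpos)
    next
      case False
      let ?v = "jump_tail B l (depth_tail f B l r) x"
      have ex: "exp (- \<theta> * (x - u)) = exp (- \<theta> * x) * exp (\<theta> * u)" for u
        by (simp add: exp_add[symmetric] algebra_simps)
      have "?v \<le> (\<integral>u. exp (- \<theta> * (x - u)) \<partial>jump_law B l)"
        unfolding jump_tail_def
      proof (rule integral_mono)
        show "integrable (jump_law B l) (\<lambda>u. exp (- \<theta> * (x - u)))"
          unfolding ex by (intro integrable_mult_right e(1))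
      qed (auto intro!: jump_tail_bounds(1) depth_tail_bounds Suc.IH[simplified])
      also have "\<dots> = exp (- \<theta> * x) * (\<integral>u. exp (\<theta> * u) \<partial>jump_law B l)"
        unfolding ex by simp
      finally have "?m * ?v \<le> ?m * (exp (- \<theta> * x) * (\<integral>u. exp (\<theta> * u) \<partial>jump_law B l))"
        by (intro mult_left_mono m)
      also have "\<dots> = exp (- \<theta> * x)" using e(2) by (simp add: mult.left_commute)
      finally have "?m * ?v \<le> exp (- \<theta> * x)" .
      moreover have "some_child f ?v \<le> ?m * ?v"
        by (rule some_child_bounds(2)[OF f]) (auto intro!: jump_tail_bounds depth_tail_bounds)
      ultimately show ?thesis using False by simp
    qed
  qed
  then show ?thesis by (intro LIMSEQ_le_const2[OF depth_tail_tendsto]) auto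
qed

end

section \<open>Exponential tilting\<close>

text \<open>The Cramer (Esscher) transform of \<open>B\<close>.\<close>

definition tilted :: "real measure \<Rightarrow> real \<Rightarrow> real measure" where
  "tilted B \<theta> = density B (\<lambda>c. ennreal (exp (\<theta> * c) / (\<integral>c. exp (\<theta> * c) \<partial>B)))"

lemma sets_tilted [simp, measurable_cong]: "sets (tilted B \<theta>) = sets B"
  by (simp add: tilted_def)

lemma integral_exp_pos:
  assumes "prob_space B" and int: "integrable B (\<lambda>c. exp (\<theta> * c))"
  shows "0 < (\<integral>c. exp (\<theta> * c :: real) \<partial>B)"
proof -
  interpret prob_space B by fact
  have "(\<integral>c. exp (\<theta> * c) \<partial>B) \<noteq> 0"
    using integral_nonneg_eq_0_iff_AE[OF int] AE_False by auto
  then show ?thesis by (simp add: order_less_le)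
qed

lemma prob_space_tilted:
  assumes "prob_space B" "sets B = sets borel" and int: "integrable B (\<lambda>c. exp (\<theta> * c))"
  shows "prob_space (tilted B \<theta>)"
proof
  let ?m = "\<integral>c. exp (\<theta> * c) \<partial>B"
  have [measurable_cong]: "sets B = sets borel" by fact
  have m: "0 < ?m" by (rule integral_exp_pos[OF assms(1) int])
  have "emeasure (tilted B \<theta>) (space (tilted B \<theta>)) = (\<integral>\<^sup>+c. ennreal (exp (\<theta> * c) / ?m) \<partial>B)"
    unfolding tilted_def by (subst emeasure_density) (auto intro!: nn_integral_cong)
  also have "\<dots> = ennreal (\<integral>c. exp (\<theta> * c) / ?m \<partial>B)"
    using m int by (intro nn_integral_eq_integral) auto
  also have "\<dots> = 1" using m by simp
  finally show "emeasure (tilted B \<theta>) (space (tilted B \<theta>)) = 1" .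
qed

lemma integral_tilted:
  assumes "sets B = sets borel" and "0 < (\<integral>c. exp (\<theta> * c) \<partial>B)" and "integrable B (\<lambda>c. exp (\<theta> * c) * c)"
  shows "integrable (tilted B \<theta>) (\<lambda>c. c)"
    and "(\<integral>c. c \<partial>tilted B \<theta>) = (\<integral>c. exp (\<theta> * c) * c \<partial>B) / (\<integral>c. exp (\<theta> * c) \<partial>B)"
proof -
  have [measurable_cong]: "sets B = sets borel" by fact
  show "integrable (tilted B \<theta>) (\<lambda>c. c)"
    unfolding tilted_def using assms(2,3) by (subst integrable_density) auto
  show "(\<integral>c. c \<partial>tilted B \<theta>) = (\<integral>c. exp (\<theta> * c) * c \<partial>B) / (\<integral>c. exp (\<theta> * c) \<partial>B)"
    unfolding tilted_def using assms(2) by (subst integral_density) auto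
qed

lemma exponential_density_integrable:
  assumes "0 < l"
  shows "integrable lborel (exponential_density l)" "(\<integral>t. exponential_density l t \<partial>lborel) = 1"
proof -
  interpret E: prob_space "density lborel (exponential_density l)" by (rule prob_space_exponential_density[OF assms])
  have "(\<integral>\<^sup>+t. ennreal (exponential_density l t) \<partial>lborel) = ennreal 1"
    using E.emeasure_space_1 by (subst (asm) emeasure_density) auto
  then have "has_bochner_integral lborel (exponential_density l) 1"
    using assms by (intro has_bochner_integral_nn_integral) (auto simp: exponential_density_nonneg)
  then show "integrable lborel (exponential_density l)" "(\<integral>t. exponential_density l t \<partial>lborel) = 1"
    by (auto simp: has_bochner_integral_iff)
qed

lemma exponential_mean:
  assumes "0 < l"
  shows "integrable (density lborel (exponential_density l)) (\<lambda>t. t)"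
    and "(\<integral>t. t \<partial>density lborel (exponential_density l)) = 1 / l"
proof -
  interpret E: prob_space "density lborel (exponential_density l)" by (rule prob_space_exponential_density[OF assms])
  have "distributed (density lborel (exponential_density l)) lborel (\<lambda>t. t) (exponential_density l)"
    unfolding distributed_def by (auto simp: distr_id2)
  from E.exponential_distributed_expectation[OF assms this]
  show *: "(\<integral>t. t \<partial>density lborel (exponential_density l)) = 1 / l" .
  show "integrable (density lborel (exponential_density l)) (\<lambda>t. t)"
    using * assms not_integrable_integral_eq by fastforce
qed

lemma exponential_law_Ioc_pos:
  assumes l: "0 < l" and ab: "0 \<le> a" "a < b"
  shows "0 < measure (density lborel (exponential_density l)) {a<..b}"
proof -
  interpret E: prob_space "density lborel (exponential_density l)" by (rule prob_space_exponential_density[OF l])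
  have cdf: "E.prob {..t} = 1 - exp (- l * t)" if "0 \<le> t" for t
    using emeasure_erlang_density[of l 0 t] that l by (simp add: E.emeasure_eq_measure erlang_CDF_0 mult_nonneg_nonneg)
  have "E.prob {a<..b} = E.prob ({..b} - {..a})" by (intro arg_cong[where f = E.prob]) auto
  also have "\<dots> = exp (- l * a) - exp (- l * b)"
    using ab by (subst E.finite_measure_Diff) (auto simp: cdf)
  finally show ?thesis using l ab by simp
qed

text \<open>By lack of memory, \<open>F x\<close> is the contribution of exponential times below y -
  x plus \<open>q * F y\<close>, where \<open>q = exp (- l * (y - x))\<close> is the probability of
  a longer time. The first part and \<open>1 - q\<close> are both at most
  \<open>l * (y - x)\<close>.\<close>

lemma exponential_smoothing_lipschitz:
  fixes h :: "real \<Rightarrow> real"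
  assumes l: "0 < l" and [measurable]: "h \<in> borel_measurable borel" and h: "\<And>x. 0 \<le> h x" "\<And>x. h x \<le> 1"
  shows "\<bar>(\<integral>t. h (x + t) \<partial>density lborel (exponential_density l)) - (\<integral>t. h (y + t) \<partial>density lborel (exponential_density l))\<bar>
    \<le> 2 * l * \<bar>x - y\<bar>"
proof -
  let ?p = "exponential_density l"
  define F where "F x = (\<integral>t. h (x + t) \<partial>density lborel ?p)" for x
  have p0: "0 \<le> ?p t" for t using l by (simp add: exponential_density_nonneg)
  have F: "F x = (\<integral>s. ?p (s - x) * h s \<partial>lborel)" for x
  proof -
    have "F x = (\<integral>t. ?p t * h (x + t) \<partial>lborel)"
      unfolding F_def using p0 by (subst integral_density) auto
    also have "\<dots> = (\<integral>s. ?p (s - x) * h s \<partial>lborel)"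
      by (subst (2) lborel_integral_real_affine[where c = 1 and t = x]) (auto simp: add.commute)
    finally show ?thesis .
  qed
  have int: "integrable lborel (\<lambda>s. ?p (s - x) * h s)" for x
  proof (rule Bochner_Integration.integrable_bound)
    show "integrable lborel (\<lambda>s. ?p (s - x))"
      using lborel_integrable_real_affine[OF exponential_density_integrable(1)[OF l], of 1 "- x"] by (simp add: add.commute)
    show "AE s in lborel. norm (?p (s - x) * h s) \<le> norm (?p (s - x))"
      using h by (auto simp: abs_mult intro!: mult_left_le)
  qed simp
  have F01: "0 \<le> F x" "F x \<le> 1" for x
  proof -
    interpret E: prob_space "density lborel ?p" by (rule prob_space_exponential_density[OF l])
    have "integrable (density lborel ?p) (\<lambda>t. h (x + t))"
      by (rule E.integrable_const_bound[where B = 1]) (use h in auto)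
    then show "0 \<le> F x" "F x \<le> 1" unfolding F_def using h E.integral_le_const[of _ 1] by auto
  qed
  have main: "\<bar>F x - F y\<bar> \<le> 2 * l * (y - x)" if xy: "x \<le> y" for x y
  proof -
    define q where "q = exp (- l * (y - x))"
    have q: "0 \<le> q" "q \<le> 1" "1 - q \<le> l * (y - x)"
      using l xy exp_ge_add_one_self[of "- l * (y - x)"] by (auto simp: q_def)
    have "F x - q * F y = (\<integral>s. ?p (s - x) * h s - q * (?p (s - y) * h s) \<partial>lborel)"
      unfolding F using int by (subst Bochner_Integration.integral_diff) auto
    also have "\<dots> = (\<integral>s. indicator {x..<y} s * (?p (s - x) * h s) \<partial>lborel)"
    proof (rule Bochner_Integration.integral_cong[OF refl])
      fix s
      have "exp (l * (x - s)) = q * exp (l * (y - s))"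
        unfolding q_def by (simp add: exp_add[symmetric] algebra_simps)
      then show "?p (s - x) * h s - q * (?p (s - y) * h s) = indicator {x..<y} s * (?p (s - x) * h s)"
        using xy by (auto simp: exponential_density_def indicator_def mult.commute)
    qed
    finally have eq: "F x - q * F y = (\<integral>s. indicator {x..<y} s * (?p (s - x) * h s) \<partial>lborel)" .
    have "0 \<le> F x - q * F y"
      unfolding eq using p0 h by (intro Bochner_Integration.integral_nonneg) auto
    moreover have "F x - q * F y \<le> l * (y - x)"
    proof -
      have pl: "?p t \<le> l" for t using l by (auto simp: exponential_density_def mult_le_cancel_left1)
      have "(\<integral>s. indicator {x..<y} s * (?p (s - x) * h s) \<partial>lborel) \<le> (\<integral>s. indicator {x..<y} s * l \<partial>lborel)"
      proof (rule integral_mono)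
        show "integrable lborel (\<lambda>s. indicator {x..<y} s * (?p (s - x) * h s))"
          using integrable_mult_indicator[OF _ int[of x], of "{x..<y}"] by simp
        show "integrable lborel (\<lambda>s. indicator {x..<y} s * l)"
          using xy by (intro integrable_mult_left) (auto intro!: integrable_real_indicator)
        fix s
        have "?p (s - x) * h s \<le> l * 1" using pl p0 h l by (intro mult_mono) auto
        then show "indicator {x..<y} s * (?p (s - x) * h s) \<le> indicator {x..<y} s * l"
          by (auto simp: indicator_def)
      qed
      also have "\<dots> = l * (y - x)" using xy by simp
      finally show ?thesis unfolding eq .
    qed
    moreover have "0 \<le> (1 - q) * F y" "(1 - q) * F y \<le> l * (y - x)"
    proof -
      show "0 \<le> (1 - q) * F y" using q F01 by simp
      have "(1 - q) * F y \<le> (1 - q) * 1" using q F01 by (intro mult_left_mono) auto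
      then show "(1 - q) * F y \<le> l * (y - x)" using q(3) by simp
    qed
    moreover have "F x - F y = (F x - q * F y) - (1 - q) * F y" by (simp add: algebra_simps)
    moreover have "0 \<le> l * (y - x)" using l xy by simp
    ultimately show ?thesis unfolding abs_le_iff by (simp add: mult.assoc)
  qed
  show ?thesis
    using main[of x y] main[of y x] unfolding F_def by (cases "x \<le> y") (auto simp: abs_minus_commute)
qed

lemma integral_exp_abs_bound:
  fixes b :: "real \<Rightarrow> real"
  assumes [measurable]: "b \<in> borel_measurable borel" and \<kappa>: "0 < \<kappa>"
    and b: "\<And>x. \<bar>b x\<bar> \<le> C * exp (- \<kappa> * \<bar>x\<bar>)"
  shows "integrable lborel b"
proof (rule Bochner_Integration.integrable_bound)
  have C: "0 \<le> C" using b[of 0] by simp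
  let ?p = "exponential_density \<kappa>"
  have "integrable lborel (\<lambda>x. ?p (- x))"
    using lborel_integrable_real_affine[OF exponential_density_integrable(1)[OF \<kappa>], of "- 1" 0] by simp
  then show "integrable lborel (\<lambda>x. C / \<kappa> * (?p x + ?p (- x)))"
    using exponential_density_integrable(1)[OF \<kappa>] by auto
  have "C * exp (- \<kappa> * \<bar>x\<bar>) \<le> C / \<kappa> * (?p x + ?p (- x))" for x
    using \<kappa> C by (cases "0 \<le> x") (auto simp: exponential_density_def field_simps)
  then have "\<bar>b x\<bar> \<le> \<bar>C / \<kappa> * (?p x + ?p (- x))\<bar>" for x
    using b[of x] by (meson abs_ge_self order_trans)
  then show "AE x in lborel. norm (b x) \<le> norm (C / \<kappa> * (?p x + ?p (- x)))" by simp
qed simp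

section \<open>The tilted tail and its renewal equation\<close>

locale cramer_lindley = lindley_tree M f B l N chi tau
  for M :: "'a measure" and f B l N chi tau +
  fixes \<theta> \<beta> EN :: real
  defines "EN \<equiv> measure_pmf.expectation f real"
  assumes f_pos: "set_pmf f \<subseteq> {1..}"
    and f_mean: "integrable (measure_pmf f) real"
    and B_nonneg: "AE x in B. 0 \<le> x"
    and theta: "0 < \<theta>"
    and exp_int: "integrable B (\<lambda>x. exp (\<theta> * x))"
    and root: "EN * (\<integral>x. exp (\<theta> * x) \<partial>B) * (l / (l + \<theta>)) = 1"
    and exp_id_int: "integrable B (\<lambda>x. exp (\<theta> * x) * x)"
    and deriv_pos: "0 < (\<integral>x. exp (\<theta> * x) * x \<partial>B) - (\<integral>x. exp (\<theta> * x) \<partial>B) / (l + \<theta>)"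
    and \<beta>: "0 < \<beta>" "\<beta> \<le> 1"
    and N_moment: "integrable (measure_pmf f) (\<lambda>n. real n powr (1 + \<beta>))"
begin

abbreviation "mB \<equiv> \<integral>x. exp (\<theta> * x) \<partial>B"
abbreviation "\<eta> \<equiv> jump_law (tilted B \<theta>) (l + \<theta>)"
abbreviation "expo r \<equiv> density lborel (\<lambda>x. ennreal (exponential_density r x))"

text \<open>In the notation of the overview, \<open>tail\<close> is G, \<open>step_tail\<close> is
  V, \<open>tilted_tail\<close> is a and \<open>forcing\<close> is b.\<close>

definition step_tail :: "real \<Rightarrow> real" where "step_tail = jump_tail B l tail"

text \<open>The mean \<mu> of \<eta>: the mean of the tilted \<chi> minus that of an exponential
  variable of rate \<open>l + \<theta>\<close>.\<close>

definition drift :: real where "drift = (\<integral>x. exp (\<theta> * x) * x \<partial>B) / mB - 1 / (l + \<theta>)"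

lemma B_measurable [measurable_cong]: "sets B = sets borel" by (rule B_prob(2))

lemma mB_pos: "0 < mB"
  by (rule integral_exp_pos[OF B_prob(1) exp_int])

lemma rate': "0 < l + \<theta>" using rate theta by simp

lemma EN_ge_1: "1 \<le> EN"
  unfolding EN_def
  by (rule measure_pmf.integral_ge_const[OF f_mean]) (use f_pos in \<open>auto intro!: AE_pmfI\<close>)

lemma drift_pos': "0 < drift"
proof -
  have "0 < ((\<integral>x. exp (\<theta> * x) * x \<partial>B) - mB / (l + \<theta>)) / mB"
    using deriv_pos mB_pos by simp
  then show ?thesis using mB_pos by (simp add: drift_def diff_divide_distrib)
qed

sublocale T: prob_space "tilted B \<theta>"
  by (rule prob_space_tilted[OF B_prob exp_int])

sublocale X: prob_space "expo (l + \<theta>)"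
  by (rule prob_space_exponential_density[OF rate'])

sublocale TX: pair_prob_space "tilted B \<theta>" "expo (l + \<theta>)" ..

lemma pair_sets [measurable_cong]:
  "sets (tilted B \<theta> \<Otimes>\<^sub>M expo (l + \<theta>)) = sets (borel \<Otimes>\<^sub>M borel)"
  by (intro sets_pair_measure_cong) (auto simp: B_prob)

lemma integral_step:
  fixes h :: "real \<Rightarrow> real"
  assumes [measurable]: "h \<in> borel_measurable borel" and h: "integrable (tilted B \<theta> \<Otimes>\<^sub>M expo (l + \<theta>)) (\<lambda>(c, t). h (c - t))"
  shows "(\<integral>z. h z \<partial>\<eta>) = (\<integral>c. (\<integral>t. h (c - t) \<partial>expo (l + \<theta>)) \<partial>tilted B \<theta>)"
proof -
  have "(\<integral>z. h z \<partial>\<eta>) = (\<integral>p. (\<lambda>(c, t). h (c - t)) p \<partial>(tilted B \<theta> \<Otimes>\<^sub>M expo (l + \<theta>)))"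
    unfolding jump_law_def by (subst integral_distr) (auto simp: case_prod_unfold)
  also have "\<dots> = (\<integral>c. (\<integral>t. h (c - t) \<partial>expo (l + \<theta>)) \<partial>tilted B \<theta>)"
    using TX.integral_fst'[OF h] by simp
  finally show ?thesis .
qed

lemma step_mean: "integrable \<eta> (\<lambda>z. z)" "(\<integral>z. z \<partial>\<eta>) = drift"
proof -
  note m = integral_tilted[OF B_prob(2) mB_pos exp_id_int] exponential_mean[OF rate']
  have fst: "integrable (tilted B \<theta> \<Otimes>\<^sub>M expo (l + \<theta>)) (\<lambda>p. fst p)"
    by (rule TX.Fubini_integrable) (use m in \<open>auto simp: X.prob_space\<close>)
  have snd: "integrable (tilted B \<theta> \<Otimes>\<^sub>M expo (l + \<theta>)) (\<lambda>p. snd p)"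
    by (rule TX.Fubini_integrable) (use m in auto)
  have i: "integrable (tilted B \<theta> \<Otimes>\<^sub>M expo (l + \<theta>)) (\<lambda>(c, t). c - t)"
    using Bochner_Integration.integrable_diff[OF fst snd] by (simp add: case_prod_unfold)
  then show "integrable \<eta> (\<lambda>z. z)"
    unfolding jump_law_def by (subst integrable_distr_eq) (auto simp: case_prod_unfold)
  have "(\<integral>z. z \<partial>\<eta>) = (\<integral>c. (\<integral>t. c - t \<partial>expo (l + \<theta>)) \<partial>tilted B \<theta>)"
    by (rule integral_step[OF _ i]) simp
  also have "\<dots> = (\<integral>c. c - 1 / (l + \<theta>) \<partial>tilted B \<theta>)"
    using m X.prob_space by simp
  also have "\<dots> = drift" using m T.prob_space by (simp add: drift_def)
  finally show "(\<integral>z. z \<partial>\<eta>) = drift" .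
qed

sublocale D: drift_step \<eta>
proof (intro drift_step.intro drift_step_axioms.intro)
  show "prob_space \<eta>"
    unfolding jump_law_def by (rule TX.prob_space_distr) measurable
qed (use step_mean drift_pos' in auto)

text \<open>The weight \<open>exp (\<theta> * (c - t))\<close> factorises. It tilts \<open>B\<close>
  and turns the exponential law of rate \<open>l\<close> into that of rate
  \<open>l + \<theta>\<close>; the normalising constants \<open>1 / mB\<close> and
  \<open>(l + \<theta>) / l\<close> multiply to \<open>EN\<close> by the root equation. Thus \<eta>
  is again the law of a difference of independent variables, the form from which its mean, support
  and smoothing effect are obtained.\<close>

lemma step_density: "\<eta> = density (jump_law B l) (\<lambda>u. ennreal (EN * exp (\<theta> * u)))"
proof -
  interpret E: prob_space "expo l" by (rule prob_space_exponential_density[OF rate])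
  let ?g = "\<lambda>c. ennreal (exp (\<theta> * c) / mB)" and ?h = "\<lambda>t. ennreal ((l + \<theta>) / l * exp (- \<theta> * t))"
  have "expo (l + \<theta>) = density (expo l) ?h"
  proof -
    have "ennreal (exponential_density l t) * ?h t = ennreal (exponential_density (l + \<theta>) t)" for t
    proof -
      have "exponential_density l t * ((l + \<theta>) / l * exp (- \<theta> * t)) = exponential_density (l + \<theta>) t"
      proof (cases "t < 0")
        case False
        have "l * exp (- t * l) * ((l + \<theta>) / l * exp (- \<theta> * t)) = (l + \<theta>) * (exp (- t * l) * exp (- \<theta> * t))"
          using rate by simp
        also have "exp (- t * l) * exp (- \<theta> * t) = exp (- t * (l + \<theta>))"
          by (simp add: exp_add[symmetric] algebra_simps)
        finally show ?thesis using False by (simp add: exponential_density_def)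
      qed (simp add: exponential_density_def)
      then show ?thesis using rate theta by (subst ennreal_mult[symmetric]) (auto simp: exponential_density_nonneg)
    qed
    then show ?thesis by (subst density_density_eq) auto
  qed
  then have "tilted B \<theta> \<Otimes>\<^sub>M expo (l + \<theta>) = density B ?g \<Otimes>\<^sub>M density (expo l) ?h"
    by (simp add: tilted_def)
  also have "\<dots> = density (B \<Otimes>\<^sub>M expo l) (\<lambda>(c, t). ?g c * ?h t)"
  proof (rule pair_measure_density)
    show "sigma_finite_measure (density (expo l) ?h)"
      using X.sigma_finite_measure_axioms \<open>expo (l + \<theta>) = density (expo l) ?h\<close> by simp
    show "sigma_finite_measure (expo l)" by (rule E.sigma_finite_measure_axioms)
  qed measurable
  also have "\<dots> = density (B \<Otimes>\<^sub>M expo l) (\<lambda>p. ennreal (EN * exp (\<theta> * (\<lambda>(c, t). c - t) p)))"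
  proof (rule density_cong)
    have "EN = (l + \<theta>) / (l * mB)" using root mB_pos rate rate' by (simp add: field_simps)
    moreover have "exp (\<theta> * (c - t)) = exp (\<theta> * c) * exp (- \<theta> * t)" for c t
      by (simp add: exp_add[symmetric] algebra_simps)
    ultimately have "exp (\<theta> * c) / mB * ((l + \<theta>) / l * exp (- \<theta> * t)) = EN * exp (\<theta> * (c - t))" for c t
      by (simp add: mult_ac)
    then have "?g c * ?h t = ennreal (EN * exp (\<theta> * (c - t)))" for c t
      using rate theta mB_pos by (subst ennreal_mult[symmetric]) auto
    then show "AE p in B \<Otimes>\<^sub>M expo l. (\<lambda>(c, t). ?g c * ?h t) p = ennreal (EN * exp (\<theta> * (\<lambda>(c, t). c - t) p))"
      by (auto simp: case_prod_unfold)
  qed measurable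
  finally show ?thesis
    unfolding jump_law_def by (subst density_distr) auto
qed

lemma integral_step_jump:
  assumes [measurable]: "h \<in> borel_measurable borel"
  shows "(\<integral>z. h z \<partial>\<eta>) = (\<integral>u. EN * exp (\<theta> * u) * h u \<partial>jump_law B l)"
  unfolding step_density using EN_ge_1 by (subst integral_density) auto

lemma jump_exp: "integrable (jump_law B l) (\<lambda>u. exp (\<theta> * u))" "EN * (\<integral>u. exp (\<theta> * u) \<partial>jump_law B l) = 1"
proof -
  have "integrable \<eta> (\<lambda>_. 1 :: real)" by simp
  then have "integrable (jump_law B l) (\<lambda>u. EN * exp (\<theta> * u))"
    unfolding step_density using EN_ge_1 by (subst (asm) integrable_density) auto
  then show "integrable (jump_law B l) (\<lambda>u. exp (\<theta> * u))" using EN_ge_1 by simp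
  show "EN * (\<integral>u. exp (\<theta> * u) \<partial>jump_law B l) = 1"
    using integral_step_jump[of "\<lambda>_. 1"] D.prob_space by simp
qed

lemma tail_exp: "tail x \<le> exp (- \<theta> * x)"
  by (rule tail_le_exp[OF f_pos f_mean jump_exp(1) _ theta]) (use jump_exp(2) in \<open>simp add: EN_def\<close>)

definition tilted_tail :: "real \<Rightarrow> real" where "tilted_tail x = exp (\<theta> * x) * tail x"

lemma tilted_tail_measurable [measurable]: "tilted_tail \<in> borel_measurable borel"
  unfolding tilted_tail_def[abs_def] by measurable

lemma tilted_tail_bounds: "0 \<le> tilted_tail x" "tilted_tail x \<le> 1"
proof -
  show "0 \<le> tilted_tail x" by (simp add: tilted_tail_def tail_bounds)
  have "tilted_tail x \<le> exp (\<theta> * x) * exp (- \<theta> * x)"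
    unfolding tilted_tail_def by (intro mult_left_mono tail_exp) auto
  then show "tilted_tail x \<le> 1" by (simp add: exp_add[symmetric])
qed

lemma step_tilted_tail: "(\<integral>z. tilted_tail (x - z) \<partial>\<eta>) = EN * exp (\<theta> * x) * step_tail x"
proof -
  have "(\<integral>z. tilted_tail (x - z) \<partial>\<eta>) = (\<integral>u. EN * exp (\<theta> * u) * tilted_tail (x - u) \<partial>jump_law B l)"
    by (rule integral_step_jump) measurable
  also have "\<dots> = (\<integral>u. EN * exp (\<theta> * x) * tail (x - u) \<partial>jump_law B l)"
    by (intro Bochner_Integration.integral_cong) (auto simp: tilted_tail_def exp_add[symmetric] algebra_simps)
  finally show ?thesis by (simp add: step_tail_def jump_tail_def)
qed

lemma step_tail_bounds: "0 \<le> step_tail x" "step_tail x \<le> 1"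
  unfolding step_tail_def by (auto intro!: jump_tail_bounds tail_bounds)

lemma step_tail_exp: "EN * step_tail x \<le> exp (- \<theta> * x)"
proof -
  have "EN * exp (\<theta> * x) * step_tail x \<le> 1"
    unfolding step_tilted_tail[symmetric]
    by (rule D.integral_le_const[OF D.integrable_shift_bounded[where C = 1]]) (use tilted_tail_bounds in auto)
  then show ?thesis by (simp add: exp_minus field_simps)
qed

lemma step_tail_exp': "step_tail x \<le> exp (- \<theta> * x)"
  using step_tail_exp[of x] mult_right_mono[OF EN_ge_1 step_tail_bounds(1)[of x]] by simp

text \<open>For each value of the tilted \<chi> the exponential part of the step smooths; averaging
  over \<chi> keeps the Lipschitz constant.\<close>

lemma step_tilted_tail_lipschitz:
  "\<bar>(\<integral>z. tilted_tail (x - z) \<partial>\<eta>) - (\<integral>z. tilted_tail (y - z) \<partial>\<eta>)\<bar> \<le> 2 * (l + \<theta>) * \<bar>x - y\<bar>"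
proof -
  define F where "F x = (\<integral>t. tilted_tail (x + t) \<partial>expo (l + \<theta>))" for x
  have F_meas [measurable]: "F \<in> borel_measurable borel"
    unfolding F_def[abs_def] by (rule X.borel_measurable_lebesgue_integral) measurable
  have F01: "\<bar>F x\<bar> \<le> 1" for x
  proof -
    have "integrable (expo (l + \<theta>)) (\<lambda>t. tilted_tail (x + t))"
      by (rule X.integrable_const_bound[where B = 1]) (use tilted_tail_bounds in auto)
    then show ?thesis unfolding F_def using tilted_tail_bounds X.integral_le_const[of _ 1]
      by (subst abs_of_nonneg) auto
  qed
  have F_int: "integrable (tilted B \<theta>) (\<lambda>c. F (x - c))" for x
    by (rule T.integrable_const_bound[where B = 1]) (use F01 in auto)
  have u: "(\<integral>z. tilted_tail (x - z) \<partial>\<eta>) = (\<integral>c. F (x - c) \<partial>tilted B \<theta>)" for x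
  proof -
    have "integrable (tilted B \<theta> \<Otimes>\<^sub>M expo (l + \<theta>)) (\<lambda>(c, t). tilted_tail (x - (c - t)))"
      by (rule TX.integrable_const_bound[where B = 1]) (use tilted_tail_bounds in \<open>auto simp: case_prod_unfold\<close>)
    from integral_step[OF _ this] show ?thesis by (simp add: F_def diff_diff_eq2 diff_add_eq)
  qed
  have "\<bar>(\<integral>z. tilted_tail (x - z) \<partial>\<eta>) - (\<integral>z. tilted_tail (y - z) \<partial>\<eta>)\<bar> = \<bar>\<integral>c. F (x - c) - F (y - c) \<partial>tilted B \<theta>\<bar>"
    unfolding u by (subst Bochner_Integration.integral_diff[OF F_int F_int]) simp
  also have "\<dots> \<le> (\<integral>c. \<bar>F (x - c) - F (y - c)\<bar> \<partial>tilted B \<theta>)" by (rule integral_abs_bound)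
  also have "\<dots> \<le> 2 * (l + \<theta>) * \<bar>x - y\<bar>"
  proof (rule T.integral_le_const)
    show "integrable (tilted B \<theta>) (\<lambda>c. \<bar>F (x - c) - F (y - c)\<bar>)"
      by (intro integrable_abs Bochner_Integration.integrable_diff F_int)
    have "\<bar>F (x - c) - F (y - c)\<bar> \<le> 2 * (l + \<theta>) * \<bar>x - y\<bar>" for c
      using exponential_smoothing_lipschitz[OF rate' tilted_tail_measurable tilted_tail_bounds, of "x - c" "y - c"] by (simp add: F_def)
    then show "AE c in tilted B \<theta>. \<bar>F (x - c) - F (y - c)\<bar> \<le> 2 * (l + \<theta>) * \<bar>x - y\<bar>" by simp
  qed
  finally show ?thesis .
qed

text \<open>For c \<ge> 0 the difference c - y falls into \<open>{-t..-s}\<close> whenever the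
  exponential variable y lies in \<open>{c + s<..c + t}\<close>, an interval of positive
  probability; and c \<ge> 0 almost surely also under the tilted law.\<close>

lemma step_support:
  assumes s: "0 < s" "s < t"
  shows "0 < D.prob {-t..-s}"
proof -
  let ?m = "\<lambda>c. X.prob {y. c - y \<in> {-t..-s}}"
  let ?S = "{p :: real \<times> real. fst p - snd p \<in> {-t..-s}}"
  have "{p \<in> space (borel \<Otimes>\<^sub>M borel). fst p - snd p \<in> {-t..-s}} \<in> sets (borel \<Otimes>\<^sub>M (borel :: real measure))"
    by measurable
  then have S [measurable]: "?S \<in> sets (borel \<Otimes>\<^sub>M borel)" by (simp add: space_pair_measure)
  then have S' [measurable]: "?S \<in> sets (tilted B \<theta> \<Otimes>\<^sub>M expo (l + \<theta>))" by (simp add: pair_sets)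
  have sp: "space (tilted B \<theta> \<Otimes>\<^sub>M expo (l + \<theta>)) = UNIV"
    using sets_eq_imp_space_eq[OF pair_sets] by (simp add: space_pair_measure)
  have "D.prob {-t..-s} = measure (tilted B \<theta> \<Otimes>\<^sub>M expo (l + \<theta>)) ?S"
    unfolding jump_law_def
    by (subst measure_distr) (auto simp: sp case_prod_unfold intro!: arg_cong[where f = "measure _"])
  also have "\<dots> = (\<integral>c. measure (expo (l + \<theta>)) (Pair c -` ?S) \<partial>tilted B \<theta>)"
    by (rule measure_pair_measure_slices) (use S' X.finite_measure_axioms in auto)
  finally have eq: "D.prob {-t..-s} = (\<integral>c. measure (expo (l + \<theta>)) (Pair c -` ?S) \<partial>tilted B \<theta>)" .
  have pos: "0 < measure (expo (l + \<theta>)) (Pair c -` ?S)" if "0 \<le> c" for c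
  proof -
    have "{c + s<..c + t} \<subseteq> Pair c -` ?S" by auto
    then have "X.prob {c + s<..c + t} \<le> X.prob (Pair c -` ?S)"
      by (intro X.finite_measure_mono) (use sets_Pair1[OF S] in auto)
    with exponential_law_Ioc_pos[OF rate', of "c + s" "c + t"] that s show ?thesis by simp
  qed
  have "AE c in tilted B \<theta>. 0 \<le> c"
    unfolding tilted_def using B_nonneg by (subst AE_density) auto
  then have AE: "AE c in tilted B \<theta>. 0 < measure (expo (l + \<theta>)) (Pair c -` ?S)"
    by eventually_elim (rule pos)
  have "D.prob {-t..-s} \<noteq> 0"
  proof
    assume "D.prob {-t..-s} = 0"
    moreover have "integrable (tilted B \<theta>) (\<lambda>c. measure (expo (l + \<theta>)) (Pair c -` ?S))"
    proof (rule T.integrable_const_bound[where B = 1])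
      show "(\<lambda>c. measure (expo (l + \<theta>)) (Pair c -` ?S)) \<in> borel_measurable (tilted B \<theta>)"
        unfolding measure_def using X.measurable_emeasure_Pair[OF S'] by measurable
    qed auto
    ultimately have "AE c in tilted B \<theta>. measure (expo (l + \<theta>)) (Pair c -` ?S) = 0"
      unfolding eq by (subst (asm) integral_nonneg_eq_0_iff_AE) auto
    with AE have "AE c in tilted B \<theta>. False" by eventually_elim simp
    then show False by simp
  qed
  then show ?thesis by (simp add: order_less_le)
qed

definition forcing :: "real \<Rightarrow> real" where "forcing x = exp (\<theta> * x) * (tail x - EN * step_tail x)"

definition KN :: real where "KN = measure_pmf.expectation f (\<lambda>n. real n powr (1 + \<beta>))"

lemma KN_nonneg: "0 \<le> KN" by (simp add: KN_def)

lemma step_tail_measurable [measurable]: "step_tail \<in> borel_measurable borel"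
  unfolding step_tail_def jump_tail_def[abs_def] by (rule J.borel_measurable_lebesgue_integral) measurable

lemma forcing_measurable [measurable]: "forcing \<in> borel_measurable borel"
  unfolding forcing_def[abs_def] by measurable

lemma forcing_eq: "forcing x = tilted_tail x - (\<integral>z. tilted_tail (x - z) \<partial>\<eta>)"
  unfolding step_tilted_tail by (simp add: forcing_def tilted_tail_def right_diff_distrib)

text \<open>Of \<open>step_tail x powr (1 + \<beta>)\<close> one factor \<open>step_tail x\<close>
  is kept and only the power \<beta> is bounded by an exponential. The kept factor lets the defect
  be read as killing at a relative rate, the form in which \<open>tilted_tail_eventually_pos\<close>
  uses it.\<close>

lemma defect_bound:
  assumes "0 \<le> x"
  shows "0 \<le> EN * step_tail x - tail x" "EN * step_tail x - tail x \<le> KN * (step_tail x * exp (- (\<theta> * \<beta>) * x))"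
proof -
  have t: "tail x = some_child f (step_tail x)" using tail_fixed_point[OF assms] by (simp add: step_tail_def)
  show "0 \<le> EN * step_tail x - tail x"
    using some_child_bounds(2)[OF f_pos f_mean step_tail_bounds[of x]] by (simp add: t EN_def)
  have "step_tail x powr (1 + \<beta>) \<le> step_tail x * exp (- (\<theta> * \<beta>) * x)"
  proof -
    have "step_tail x powr \<beta> \<le> exp (- \<theta> * x) powr \<beta>"
      by (intro powr_mono2 step_tail_exp' step_tail_bounds) (use \<beta> in auto)
    also have "\<dots> = exp (- (\<theta> * \<beta>) * x)" by (simp add: exp_powr_real)
    finally have "step_tail x * step_tail x powr \<beta> \<le> step_tail x * exp (- (\<theta> * \<beta>) * x)"
      by (intro mult_left_mono step_tail_bounds)
    then show ?thesis using step_tail_bounds(1)[of x] by (simp add: powr_add)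
  qed
  then have "KN * step_tail x powr (1 + \<beta>) \<le> KN * (step_tail x * exp (- (\<theta> * \<beta>) * x))"
    by (intro mult_left_mono KN_nonneg)
  with some_child_defect[OF f_mean step_tail_bounds[of x] \<beta> N_moment]
  show "EN * step_tail x - tail x \<le> KN * (step_tail x * exp (- (\<theta> * \<beta>) * x))" by (simp add: t EN_def KN_def)
qed

lemma forcing_bound: "\<bar>forcing x\<bar> \<le> (1 + EN + KN) * exp (- (\<theta> * \<beta>) * \<bar>x\<bar>)"
proof (cases "0 \<le> x")
  case True
  have "\<bar>forcing x\<bar> = exp (\<theta> * x) * (EN * step_tail x - tail x)"
    using defect_bound(1)[OF True] by (simp add: forcing_def abs_mult)
  also have "\<dots> \<le> exp (\<theta> * x) * (KN * (step_tail x * exp (- (\<theta> * \<beta>) * x)))"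
    by (intro mult_left_mono defect_bound True) auto
  also have "\<dots> = KN * exp (- (\<theta> * \<beta>) * x) * (exp (\<theta> * x) * step_tail x)" by simp
  also have "\<dots> \<le> KN * exp (- (\<theta> * \<beta>) * x) * 1"
  proof (intro mult_left_mono mult_nonneg_nonneg KN_nonneg)
    have "exp (\<theta> * x) * step_tail x \<le> exp (\<theta> * x) * exp (- \<theta> * x)" by (intro mult_left_mono step_tail_exp') auto
    then show "exp (\<theta> * x) * step_tail x \<le> 1" by (simp add: exp_add[symmetric])
  qed auto
  also have "\<dots> \<le> (1 + EN + KN) * exp (- (\<theta> * \<beta>) * x)"
    using EN_ge_1 by (simp add: mult_right_mono)
  finally show ?thesis using True by simp
next
  case False
  have "0 \<le> EN * step_tail x" "EN * step_tail x \<le> EN"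
    using step_tail_bounds[of x] EN_ge_1 mult_left_mono[of "step_tail x" 1 EN] by auto
  then have "\<bar>tail x - EN * step_tail x\<bar> \<le> 1 + EN"
    unfolding abs_le_iff using tail_bounds[of x] by linarith
  then have "\<bar>forcing x\<bar> \<le> exp (\<theta> * x) * (1 + EN)"
    unfolding forcing_def abs_mult by (simp add: mult_left_mono)
  also have "\<dots> \<le> exp (- (\<theta> * \<beta>) * \<bar>x\<bar>) * (1 + EN + KN)"
  proof (intro mult_mono)
    \<comment> \<open>On the negative half line the decay comes from
      \<open>exp (\<theta> * x)\<close> alone; its rate \<theta> is weakened to
      \<open>\<theta> * \<beta>\<close>, using \<beta> \<le> 1, to match the other side.\<close>
    have "\<theta> * \<beta> * (- x) \<le> \<theta> * 1 * (- x)" using theta \<beta> False by (intro mult_right_mono mult_left_mono) auto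
    then show "exp (\<theta> * x) \<le> exp (- (\<theta> * \<beta>) * \<bar>x\<bar>)" using False by simp
  qed (use EN_ge_1 KN_nonneg in auto)
  finally show ?thesis by (simp add: mult.commute)
qed

lemma forcing_integrable: "integrable lborel forcing"
  by (rule integral_exp_abs_bound[OF _ _ forcing_bound]) (use theta \<beta> in auto)

lemma forcing_tendsto: "(forcing \<longlongrightarrow> 0) at_top"
proof (rule Lim_null_comparison)
  show "\<forall>\<^sub>F x in at_top. norm (forcing x) \<le> (1 + EN + KN) * exp (- (\<theta> * \<beta>) * \<bar>x\<bar>)" using forcing_bound by simp
  have "((\<lambda>x. exp (- k * \<bar>x\<bar>)) \<longlongrightarrow> 0) at_top" if "0 < k" for k :: real
    using that by real_asymp
  from tendsto_mult_right_zero[OF this[of "\<theta> * \<beta>"]]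
  show "((\<lambda>x. (1 + EN + KN) * exp (- (\<theta> * \<beta>) * \<bar>x\<bar>)) \<longlongrightarrow> 0) at_top" using theta \<beta> by simp
qed

lemma tilted_tail_left_integrable: "integrable lborel (\<lambda>y. indicator {..x} y * tilted_tail y)"
proof (rule Bochner_Integration.integrable_bound)
  let ?p = "exponential_density \<theta>"
  have "integrable lborel (\<lambda>y. ?p (x - y))"
    using lborel_integrable_real_affine[OF exponential_density_integrable(1)[OF theta], of "- 1" x] by simp
  then show "integrable lborel (\<lambda>y. exp (\<theta> * x) / \<theta> * ?p (x - y))" by simp
  have "\<bar>indicator {..x} y * tilted_tail y\<bar> \<le> \<bar>exp (\<theta> * x) / \<theta> * ?p (x - y)\<bar>" for y
  proof (cases "y \<le> x")
    case True
    have "tilted_tail y \<le> exp (\<theta> * y) * 1" unfolding tilted_tail_def by (intro mult_left_mono tail_bounds) auto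
    also have "\<dots> = exp (\<theta> * x) / \<theta> * ?p (x - y)"
      using True theta by (simp add: exponential_density_def exp_add[symmetric] algebra_simps)
    finally have "tilted_tail y \<le> exp (\<theta> * x) / \<theta> * ?p (x - y)" .
    moreover have "\<bar>indicator {..x} y * tilted_tail y\<bar> = tilted_tail y" using True tilted_tail_bounds(1)[of y] by simp
    ultimately show ?thesis using abs_ge_self[of "exp (\<theta> * x) / \<theta> * ?p (x - y)"] by linarith
  qed simp
  then show "AE y in lborel. norm (indicator {..x} y * tilted_tail y) \<le> norm (exp (\<theta> * x) / \<theta> * ?p (x - y))" by simp
qed simp

lemma tilted_tail_tendsto: "(tilted_tail \<longlongrightarrow> (\<integral>x. forcing x \<partial>lborel) / drift) at_top"
  using D.renewal_limit[OF tilted_tail_measurable tilted_tail_bounds tilted_tail_left_integrable step_tilted_tail_lipschitz step_support forcing_eq forcing_integrable forcing_tendsto]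
  by (simp add: step_mean)

text \<open>As \<eta> has positive mean, some h > 0 is reached by a single step with positive
  probability, under \<eta> and hence under the jump law. Moving from x back to x - h costs at most
  that factor, and finitely many moves lead below 0, where the tail is 1.\<close>

lemma tail_pos: "0 < tail x"
proof -
  have "\<exists>h>0. 0 < J.prob {h..}"
  proof (rule ccontr)
    assume neg: "\<not> ?thesis"
    have "AE u in jump_law B l. \<forall>n. u < 1 / real (Suc n)"
    proof (rule AE_all_countable[THEN iffD2], rule allI)
      fix n
      have "0 < 1 / real (Suc n)" by simp
      with neg have "\<not> 0 < J.prob {1 / real (Suc n)..}" by blast
      then have "J.prob {1 / real (Suc n)..} = 0" by (simp add: zero_less_measure_iff)
      then show "AE u in jump_law B l. u < 1 / real (Suc n)"
        by (subst AE_iff_measurable[of "{1 / real (Suc n)..}"]) (auto simp: J.emeasure_eq_measure not_less)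
    qed
    then have "AE u in jump_law B l. u \<le> 0"
    proof eventually_elim
      fix u :: real assume u: "\<forall>n. u < 1 / real (Suc n)"
      show "u \<le> 0"
      proof (rule ccontr)
        assume "\<not> u \<le> 0"
        then obtain n where "1 / real (Suc n) < u" using nat_approx_posE[of u] by auto
        with u show False using less_asym by blast
      qed
    qed
    then have "AE z in \<eta>. z \<le> 0" unfolding step_density by (subst AE_density) auto
    then have "0 \<le> (\<integral>z. - z \<partial>\<eta>)" by (intro integral_nonneg_AE) auto
    then have "(\<integral>z. z \<partial>\<eta>) \<le> 0" by simp
    then show False using D.drift_pos by simp
  qed
  then obtain h where h: "0 < h" "0 < J.prob {h..}" by blast
  have step: "J.prob {h..} * tail (x - h) \<le> tail x" if x: "0 \<le> x" for x
  proof -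
    have "J.prob {h..} * tail (x - h) = (\<integral>u. indicator {h..} u * tail (x - h) \<partial>jump_law B l)" by simp
    also have "\<dots> \<le> step_tail x"
      unfolding step_tail_def jump_tail_def
    proof (rule integral_mono)
      show "integrable (jump_law B l) (\<lambda>u. indicator {h..} u * tail (x - h))"
        by (intro integrable_mult_left integrable_real_indicator) (auto simp: J.emeasure_eq_measure)
      show "integrable (jump_law B l) (\<lambda>u. tail (x - u))" by (rule jump_tail_bounds) (auto simp: tail_bounds)
      fix u show "indicator {h..} u * tail (x - h) \<le> tail (x - u)"
        using antimonoD[OF antimono_tail, of "x - u" "x - h"] tail_bounds by (auto simp: indicator_def)
    qed
    also have "\<dots> \<le> tail x"
      using some_child_bounds(1)[OF f_pos f_mean step_tail_bounds[of x]] tail_fixed_point[OF x] by (simp add: step_tail_def)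
    finally show ?thesis .
  qed
  have "0 < tail x" if "x < real k * h" for k x
    using that
  proof (induction k arbitrary: x)
    case 0 then show ?case by (simp add: tail_neg)
  next
    case (Suc k)
    show ?case
    proof (cases "x < 0")
      case False
      have "0 < tail (x - h)" using Suc by (intro Suc.IH) (simp add: algebra_simps)
      then have "0 < J.prob {h..} * tail (x - h)" using h by simp
      with step[of x] False show ?thesis by simp
    qed (simp add: tail_neg)
  qed
  moreover obtain k :: nat where "x < real k * h" using reals_Archimedean3[OF h(1)] by blast
  ultimately show ?thesis by blast
qed

text \<open>The gap between \<open>some_child\<close> and its linearisation acts as killing at rate
  \<open>KN * exp (- (\<theta> * \<beta>) * x)\<close>. The lower bound on compact intervals comes
  from \<open>tail_pos\<close> and monotonicity of the tail.\<close>

lemma tilted_tail_eventually_pos: "\<exists>\<delta>>0. eventually (\<lambda>x. \<delta> \<le> tilted_tail x) at_top"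
proof (rule D.superharmonic_bounded_below[OF tilted_tail_measurable tilted_tail_bounds _ KN_nonneg])
  show "0 < \<theta> * \<beta>" using theta \<beta> by simp
  show "(1 - KN * exp (- (\<theta> * \<beta>) * x)) * (\<integral>z. tilted_tail (x - z) \<partial>\<eta>) \<le> tilted_tail x" if x: "0 \<le> x" for x
  proof -
    have "EN * step_tail x - tail x \<le> KN * (EN * step_tail x * exp (- (\<theta> * \<beta>) * x))"
    proof -
      have "KN * (step_tail x * exp (- (\<theta> * \<beta>) * x)) \<le> KN * (EN * step_tail x * exp (- (\<theta> * \<beta>) * x))"
        using EN_ge_1 step_tail_bounds(1)[of x] by (intro mult_left_mono mult_right_mono KN_nonneg) (auto simp: mult_le_cancel_right1)
      with defect_bound(2)[OF x] show ?thesis by linarith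
    qed
    then have "exp (\<theta> * x) * (EN * step_tail x - tail x) \<le> exp (\<theta> * x) * (KN * (EN * step_tail x * exp (- (\<theta> * \<beta>) * x)))"
      by (intro mult_left_mono) auto
    then show ?thesis unfolding step_tilted_tail by (simp add: tilted_tail_def algebra_simps)
  qed
  show "\<exists>\<delta>>0. \<forall>x\<in>{s..t}. \<delta> \<le> tilted_tail x" for s t
  proof (intro exI conjI ballI)
    show "0 < exp (\<theta> * s) * tail t" using tail_pos by simp
    fix x assume "x \<in> {s..t}"
    then show "exp (\<theta> * s) * tail t \<le> tilted_tail x"
      unfolding tilted_tail_def using theta antimonoD[OF antimono_tail, of x t] tail_bounds by (intro mult_mono) auto
  qed
qed

lemma limit_pos: "0 < (\<integral>x. forcing x \<partial>lborel) / drift"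
proof -
  obtain \<delta> where \<delta>: "0 < \<delta>" "eventually (\<lambda>x. \<delta> \<le> tilted_tail x) at_top" using tilted_tail_eventually_pos by blast
  have "\<delta> \<le> (\<integral>x. forcing x \<partial>lborel) / drift" by (rule tendsto_lowerbound[OF tilted_tail_tendsto \<delta>(2)]) simp
  with \<delta>(1) show ?thesis by simp
qed

end

section \<open>The constant\<close>

text \<open>The integrand is \<open>exp (\<theta> * y)\<close> times the exponential density at
  \<open>y - x\<close>. Integrating over the whole line, not only from 0, leaves no additive
  constant.\<close>

lemma exp_layer_cake:
  fixes \<theta> y :: real
  assumes \<theta>: "0 < \<theta>"
  shows "integrable lborel (\<lambda>x. \<theta> * exp (\<theta> * x) * of_bool (x < y))"
    and "(\<integral>x. \<theta> * exp (\<theta> * x) * of_bool (x < y) \<partial>lborel) = exp (\<theta> * y)"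
proof -
  let ?p = "\<lambda>x. exp (\<theta> * y) * exponential_density \<theta> (y - x)"
  have p: "integrable lborel ?p" "(\<integral>x. ?p x \<partial>lborel) = exp (\<theta> * y)"
  proof -
    show "integrable lborel ?p"
      using lborel_integrable_real_affine[OF exponential_density_integrable(1)[OF \<theta>], of "- 1" y] by simp
    have "(\<integral>x. exponential_density \<theta> (y - x) \<partial>lborel) = 1"
      using lborel_integral_real_affine[of "- 1" "exponential_density \<theta>" y] exponential_density_integrable(2)[OF \<theta>] by simp
    then show "(\<integral>x. ?p x \<partial>lborel) = exp (\<theta> * y)" by simp
  qed
  \<comment> \<open>The two integrands differ at \<open>x = y\<close>, where the density equals
    \<theta> but the strict indicator is 0.\<close>
  have "AE x in lborel. x \<noteq> y" by (rule AE_lborel_singleton)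
  then have AE: "AE x in lborel. ?p x = \<theta> * exp (\<theta> * x) * of_bool (x < y)"
    by eventually_elim (auto simp: exponential_density_def exp_add[symmetric] algebra_simps)
  show "integrable lborel (\<lambda>x. \<theta> * exp (\<theta> * x) * of_bool (x < y))"
    using p(1) integrable_cong_AE[OF _ _ AE] by simp
  show "(\<integral>x. \<theta> * exp (\<theta> * x) * of_bool (x < y) \<partial>lborel) = exp (\<theta> * y)"
    using p(2) integral_cong_AE[OF _ _ AE] by simp
qed

definition mark :: "real \<times> real \<times> ereal \<Rightarrow> real" where
  "mark = (\<lambda>(c, t, w). c - t + real_of_ereal w)"

text \<open>The clause \<open>x < 0\<close> stands for the 1 in the maximum, since 1 = exp (\<theta>
  0).\<close>

definition max_above :: "real \<Rightarrow> nat \<times> (nat \<Rightarrow> real \<times> real \<times> ereal) \<Rightarrow> real" where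
  "max_above x p = of_bool (x < 0 \<or> (\<exists>i\<in>{1..fst p}. x < mark (snd p i)))"

definition count_above :: "real \<Rightarrow> nat \<times> (nat \<Rightarrow> real \<times> real \<times> ereal) \<Rightarrow> real" where
  "count_above x p = (\<Sum>i = 1..fst p. of_bool (x < mark (snd p i)))"

lemma max_minus_sum_layer_cake:
  assumes \<theta>: "0 < \<theta>"
  shows "max_minus_sum \<theta> p = (\<integral>x. \<theta> * exp (\<theta> * x) * (max_above x p - count_above x p) \<partial>lborel)"
proof -
  obtain n z where p: "p = (n, z)" by (cases p)
  let ?Z = "Max (insert 0 ((\<lambda>i. mark (z i)) ` {1..n}))"
  have bw: "branch_weight \<theta> q = exp (\<theta> * mark q)" for q
    by (simp add: branch_weight_def mark_def split: prod.split)
  have "exp (\<theta> * ?Z) = Max ((\<lambda>y. exp (\<theta> * y)) ` insert 0 ((\<lambda>i. mark (z i)) ` {1..n}))"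
    by (rule mono_Max_commute) (use \<theta> in \<open>auto simp: mono_def\<close>)
  also have "\<dots> = Max (insert 1 ((\<lambda>i. branch_weight \<theta> (z i)) ` {1..n}))"
    by (simp add: image_image bw)
  finally have "max_minus_sum \<theta> p = exp (\<theta> * ?Z) - (\<Sum>i = 1..n. exp (\<theta> * mark (z i)))"
    by (simp add: max_minus_sum_def p bw)
  also have "\<dots> = (\<integral>x. \<theta> * exp (\<theta> * x) * of_bool (x < ?Z)
      - (\<Sum>i = 1..n. \<theta> * exp (\<theta> * x) * of_bool (x < mark (z i))) \<partial>lborel)"
  proof (subst Bochner_Integration.integral_diff)
    show "integrable lborel (\<lambda>x. \<theta> * exp (\<theta> * x) * of_bool (x < ?Z))" by (rule exp_layer_cake(1)[OF \<theta>])
    show "integrable lborel (\<lambda>x. \<Sum>i = 1..n. \<theta> * exp (\<theta> * x) * of_bool (x < mark (z i)))"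
      by (intro Bochner_Integration.integrable_sum exp_layer_cake(1)[OF \<theta>])
    have "(\<integral>x. (\<Sum>i = 1..n. \<theta> * exp (\<theta> * x) * of_bool (x < mark (z i))) \<partial>lborel)
        = (\<Sum>i = 1..n. \<integral>x. \<theta> * exp (\<theta> * x) * of_bool (x < mark (z i)) \<partial>lborel)"
      by (intro Bochner_Integration.integral_sum exp_layer_cake(1)[OF \<theta>])
    then show "exp (\<theta> * ?Z) - (\<Sum>i = 1..n. exp (\<theta> * mark (z i))) =
        (\<integral>x. \<theta> * exp (\<theta> * x) * of_bool (x < ?Z) \<partial>lborel)
        - (\<integral>x. (\<Sum>i = 1..n. \<theta> * exp (\<theta> * x) * of_bool (x < mark (z i))) \<partial>lborel)"
      by (simp only: exp_layer_cake(2)[OF \<theta>])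
  qed
  also have "\<dots> = (\<integral>x. \<theta> * exp (\<theta> * x) * (max_above x p - count_above x p) \<partial>lborel)"
  proof (rule Bochner_Integration.integral_cong[OF refl])
    fix x
    have "x < ?Z \<longleftrightarrow> x < 0 \<or> (\<exists>i\<in>{1..n}. x < mark (z i))" by (subst Max_gr_iff) auto
    then show "\<theta> * exp (\<theta> * x) * of_bool (x < ?Z) - (\<Sum>i = 1..n. \<theta> * exp (\<theta> * x) * of_bool (x < mark (z i)))
      = \<theta> * exp (\<theta> * x) * (max_above x p - count_above x p)"
      by (simp add: max_above_def count_above_def p right_diff_distrib sum_distrib_left)
  qed
  finally show ?thesis .
qed

lemma count_above_nonneg: "0 \<le> count_above x p"
  by (simp add: count_above_def sum_nonneg)

text \<open>\<open>count_above\<close> dominates \<open>max_above\<close> unless x < 0 and no mark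
  exceeds x. Hence the absolute value costs only a term of known integral, and absolute
  integrability can be deduced from the expectation of the signed difference.\<close>

lemma abs_max_above_minus_count_above:
  "\<bar>max_above x p - count_above x p\<bar> \<le> count_above x p - max_above x p + 2 * of_bool (x < 0)"
proof (cases "\<exists>i\<in>{1..fst p}. x < mark (snd p i)")
  case True
  then obtain i where i: "i \<in> {1..fst p}" "x < mark (snd p i)" by blast
  have "(\<Sum>i\<in>{i}. of_bool (x < mark (snd p i))) \<le> count_above x p"
    unfolding count_above_def by (rule sum_mono2) (use i in auto)
  then have "1 \<le> count_above x p" using i by simp
  moreover have "max_above x p = 1" using True by (simp add: max_above_def)
  ultimately show ?thesis by simp
next
  case False
  then have "count_above x p = 0" by (simp add: count_above_def)
  then show ?thesis using False by (simp add: max_above_def)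
qed

section \<open>The numerator of \<open>H\<close> as an integral of \<open>forcing\<close>\<close>

context cramer_lindley
begin

abbreviation "LW \<equiv> distr M borel (endogenous N chi tau)"

sublocale L: prob_space LW by (rule prob_space_distr) measurable

sublocale B: prob_space B by (rule B_prob)

sublocale E: prob_space "expo l" by (rule prob_space_exponential_density[OF rate])

sublocale EL: pair_prob_space "expo l" LW ..

sublocale BEL: pair_prob_space B "expo l \<Otimes>\<^sub>M LW" ..

sublocale BE: pair_prob_space B "expo l" ..

abbreviation "Q \<equiv> B \<Otimes>\<^sub>M (expo l \<Otimes>\<^sub>M LW)"

lemma sets_Q [measurable_cong]: "sets Q = sets (borel \<Otimes>\<^sub>M (borel \<Otimes>\<^sub>M borel))"
  by (intro sets_pair_measure_cong) (auto simp: B_prob)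

lemma mark_measurable [measurable]: "mark \<in> borel_measurable (borel \<Otimes>\<^sub>M (borel \<Otimes>\<^sub>M borel))"
  unfolding mark_def by measurable

text \<open>Makes \<open>real_of_ereal\<close> harmless in the marks: the exponential tail bound
  excludes the value \<infinity>, and the root of the tree, with walk 0, excludes
  -\<infinity>.\<close>

lemma W_finite: "AE \<omega> in M. endogenous N chi tau \<omega> = ereal (real_of_ereal (endogenous N chi tau \<omega>))"
proof -
  let ?I = "{\<omega>\<in>space M. endogenous N chi tau \<omega> = \<infinity>}"
  have I: "?I \<in> sets M" by measurable
  have "prob ?I \<le> exp (- \<theta> * real n)" for n
  proof -
    have "prob ?I \<le> tail (real n)" unfolding tail_def by (intro finite_measure_mono) auto
    then show ?thesis using tail_exp[of "real n"] by linarith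
  qed
  moreover have "(\<lambda>n. exp (- \<theta> * real n)) \<longlonglongrightarrow> 0" using theta by real_asymp
  ultimately have "prob ?I \<le> 0" by (intro LIMSEQ_le_const) auto
  then have "AE \<omega> in M. \<omega> \<notin> ?I" using I by (intro AE_not_in) (auto simp: null_sets_def emeasure_eq_measure measure_le_0_iff)
  moreover have "ereal (- 1) < endogenous N chi tau \<omega>" for \<omega>
    using less_endogenous_iff[of "\<lambda>x. var x \<omega>" N \<omega> chi tau "- 1"] by (auto intro!: exI[of _ 0])
  then have "endogenous N chi tau \<omega> \<noteq> - \<infinity>" for \<omega> by (metis less_ereal.simps(3))
  ultimately show ?thesis
    by (elim AE_mp) (auto intro!: AE_I2 simp: ereal_real)
qed

lemma L_tail: "L.prob {w. x < real_of_ereal w} = tail x"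
proof -
  have "{w \<in> space borel. x < real_of_ereal w} \<in> sets (borel :: ereal measure)" by measurable
  then have S: "{w. x < real_of_ereal w} \<in> sets (borel :: ereal measure)" by simp
  then have "L.prob {w. x < real_of_ereal w} = prob {\<omega>\<in>space M. x < real_of_ereal (endogenous N chi tau \<omega>)}"
    by (subst measure_distr) (auto intro!: arg_cong[where f = prob])
  also have "\<dots> = tail x"
    unfolding tail_def
  proof (rule measure_eq_AE)
    show "AE \<omega> in M. (\<omega> \<in> {\<omega>\<in>space M. x < real_of_ereal (endogenous N chi tau \<omega>)})
        \<longleftrightarrow> (\<omega> \<in> {\<omega>\<in>space M. ereal x < endogenous N chi tau \<omega>})"
      using W_finite by eventually_elim (metis (no_types, lifting) less_ereal.simps(1) mem_Collect_eq)
  qed measurable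
  finally show ?thesis .
qed

lemma mark_tail: "measure Q {q. x < mark q} = step_tail x"
proof -
  have "{q \<in> space (borel \<Otimes>\<^sub>M (borel \<Otimes>\<^sub>M borel)). x < mark q} \<in> sets (borel \<Otimes>\<^sub>M (borel \<Otimes>\<^sub>M borel))"
    by measurable
  then have S: "{q. x < mark q} \<in> sets Q" by (simp add: sets_Q space_pair_measure)
  have "measure Q {q. x < mark q} = (\<integral>c. measure (expo l \<Otimes>\<^sub>M LW) (Pair c -` {q. x < mark q}) \<partial>B)"
    by (rule measure_pair_measure_slices[OF _ S]) (rule EL.finite_measure_axioms)
  also have "\<dots> = (\<integral>c. (\<integral>t. tail (x - (c - t)) \<partial>expo l) \<partial>B)"
  proof (rule Bochner_Integration.integral_cong[OF refl])
    fix c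
    have S': "Pair c -` {q. x < mark q} \<in> sets (expo l \<Otimes>\<^sub>M LW)" using S by (rule sets_Pair1)
    have "measure (expo l \<Otimes>\<^sub>M LW) (Pair c -` {q. x < mark q})
        = (\<integral>t. L.prob (Pair t -` (Pair c -` {q. x < mark q})) \<partial>expo l)"
      by (rule measure_pair_measure_slices[OF _ S']) (rule L.finite_measure_axioms)
    also have "\<dots> = (\<integral>t. tail (x - (c - t)) \<partial>expo l)"
    proof (rule Bochner_Integration.integral_cong[OF refl])
      fix t
      have "Pair t -` (Pair c -` {q. x < mark q}) = {w. x - (c - t) < real_of_ereal w}"
        by (auto simp: mark_def)
      then show "L.prob (Pair t -` (Pair c -` {q. x < mark q})) = tail (x - (c - t))" by (simp add: L_tail)
    qed
    finally show "measure (expo l \<Otimes>\<^sub>M LW) (Pair c -` {q. x < mark q}) = (\<integral>t. tail (x - (c - t)) \<partial>expo l)" .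
  qed
  also have "\<dots> = (\<integral>p. (\<lambda>(c, t). tail (x - (c - t))) p \<partial>(B \<Otimes>\<^sub>M expo l))"
  proof -
    have "integrable (B \<Otimes>\<^sub>M expo l) (\<lambda>(c, t). tail (x - (c - t)))"
      by (rule BE.integrable_const_bound[where B = 1]) (use tail_bounds in \<open>auto simp: case_prod_unfold\<close>)
    from BE.integral_fst'[OF this] show ?thesis by simp
  qed
  also have "\<dots> = step_tail x"
    unfolding step_tail_def jump_tail_def jump_law_def by (subst integral_distr) (auto simp: case_prod_unfold)
  finally show ?thesis .
qed

definition R :: "(nat \<Rightarrow> real \<times> real \<times> ereal) measure" where "R = PiM {1..} (\<lambda>_. Q)"

abbreviation "P \<equiv> copies f B l LW"

lemma P_eq: "P = measure_pmf f \<Otimes>\<^sub>M R"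
  by (simp only: copies_def R_def)

sublocale PR: product_prob_space "\<lambda>_::nat. Q" "{1..}"
  by (intro product_prob_spaceI BEL.prob_space_axioms)

sublocale R: prob_space R
  unfolding R_def by (rule PR.P.prob_space_axioms)

sublocale FR: pair_prob_space "measure_pmf f" R ..

sublocale P: prob_space P
  unfolding P_eq by (rule FR.prob_space_axioms)

lemma mark_component [measurable]: "1 \<le> i \<Longrightarrow> (\<lambda>z. mark (z i)) \<in> borel_measurable R"
  unfolding R_def
  by (rule measurable_compose[OF measurable_component_singleton[of i "{1..}"]]) (auto cong: measurable_cong_sets)

lemma S_sets: "{q. x < mark q} \<in> sets Q" "{q. mark q \<le> x} \<in> sets Q"
proof -
  have "{q \<in> space (borel \<Otimes>\<^sub>M (borel \<Otimes>\<^sub>M borel)). x < mark q} \<in> sets (borel \<Otimes>\<^sub>M (borel \<Otimes>\<^sub>M borel))"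
    "{q \<in> space (borel \<Otimes>\<^sub>M (borel \<Otimes>\<^sub>M borel)). mark q \<le> x} \<in> sets (borel \<Otimes>\<^sub>M (borel \<Otimes>\<^sub>M borel))"
    by measurable
  then show "{q. x < mark q} \<in> sets Q" "{q. mark q \<le> x} \<in> sets Q" by (simp_all add: sets_Q space_pair_measure)
qed

lemma mark_le_prob: "measure Q {q. mark q \<le> x} = 1 - step_tail x"
proof -
  have "space Q = UNIV" using sets_eq_imp_space_eq[OF sets_Q] by (simp add: space_pair_measure)
  then have "{q. mark q \<le> x} = space Q - {q. x < mark q}" by auto
  then show ?thesis using BEL.prob_compl[OF S_sets(1)] by (simp add: mark_tail)
qed

lemma component_above: "1 \<le> i \<Longrightarrow> (\<integral>z. of_bool (x < mark (z i)) \<partial>R) = step_tail x"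
proof -
  assume i: "1 \<le> i"
  have "(\<integral>z. of_bool (x < mark (z i)) \<partial>R) = (\<integral>z. indicator {z\<in>space R. x < mark (z i)} z \<partial>R)"
    by (intro Bochner_Integration.integral_cong) (auto simp: indicator_def)
  also have "\<dots> = R.prob {z\<in>space R. \<forall>j\<in>{i}. z j \<in> {q. x < mark q}}" by (simp add: Int_absorb2 Collect_restrict)
  also have "\<dots> = measure Q {q. x < mark q}"
    unfolding measure_def R_def using i S_sets(1) by (subst PR.emeasure_PiM_Collect) auto
  finally show ?thesis by (simp add: mark_tail)
qed

lemma components_below: "R.prob {z\<in>space R. \<forall>i\<in>{1..n}. mark (z i) \<le> x} = (1 - step_tail x) ^ n"
proof -
  have "ennreal (R.prob {z\<in>space R. \<forall>i\<in>{1..n}. mark (z i) \<le> x}) = emeasure R {z\<in>space R. \<forall>i\<in>{1..n}. z i \<in> {q. mark q \<le> x}}"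
    by (simp add: R.emeasure_eq_measure)
  also have "\<dots> = (\<Prod>i\<in>{1..n}. emeasure Q {q. mark q \<le> x})"
    unfolding R_def by (rule PR.emeasure_PiM_Collect) (use S_sets in auto)
  also have "\<dots> = ennreal ((1 - step_tail x) ^ n)"
    using step_tail_bounds[of x] by (simp add: BEL.emeasure_eq_measure mark_le_prob ennreal_power)
  finally show ?thesis using step_tail_bounds[of x] by simp
qed

lemma above_measurable:
  "(\<lambda>(p, x). max_above x p) \<in> borel_measurable (P \<Otimes>\<^sub>M lborel)" (is ?A)
  "(\<lambda>(p, x). count_above x p) \<in> borel_measurable (P \<Otimes>\<^sub>M lborel)" (is ?B)
proof -
  have n: "(\<lambda>q. fst (fst q)) \<in> measurable ((measure_pmf f \<Otimes>\<^sub>M R) \<Otimes>\<^sub>M lborel) (count_space UNIV)"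
    by (rule measurable_compose[OF measurable_compose[OF measurable_fst measurable_fst]]) simp
  have m: "(\<lambda>q. mark (snd (fst q) i)) \<in> borel_measurable ((measure_pmf f \<Otimes>\<^sub>M R) \<Otimes>\<^sub>M (lborel :: real measure))" if "1 \<le> i" for i
    by (rule measurable_compose[OF measurable_compose[OF measurable_fst measurable_snd] mark_component[OF that]])
  have x: "(\<lambda>q. snd q) \<in> borel_measurable ((measure_pmf f \<Otimes>\<^sub>M R) \<Otimes>\<^sub>M (lborel :: real measure))"
    by simp
  have pr: "Measurable.pred ((measure_pmf f \<Otimes>\<^sub>M R) \<Otimes>\<^sub>M lborel) (\<lambda>q. snd q < mark (snd (fst q) i))" if "1 \<le> i" for i
    using borel_measurable_pred_less[OF x m[OF that]] .
  have "(\<lambda>q. (\<lambda>n q. of_bool (snd q < 0 \<or> (\<exists>i\<in>{1..n}. snd q < mark (snd (fst q) i))) :: real) (fst (fst q)) q)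
      \<in> borel_measurable ((measure_pmf f \<Otimes>\<^sub>M R) \<Otimes>\<^sub>M lborel)"
  proof (rule measurable_compose_countable[OF _ n])
    fix n :: nat
    have "Measurable.pred ((measure_pmf f \<Otimes>\<^sub>M R) \<Otimes>\<^sub>M lborel) (\<lambda>q. snd q < 0 \<or> (\<exists>i\<in>{1..n}. snd q < mark (snd (fst q) i)))"
      by (intro pred_intros_logic pred_intros_finite borel_measurable_pred_less x pr) auto
    then show "(\<lambda>q. of_bool (snd q < 0 \<or> (\<exists>i\<in>{1..n}. snd q < mark (snd (fst q) i))) :: real)
        \<in> borel_measurable ((measure_pmf f \<Otimes>\<^sub>M R) \<Otimes>\<^sub>M lborel)"
      by (rule measurable_compose[where g = of_bool]) simp
  qed
  then show ?A by (simp add: P_eq case_prod_unfold max_above_def)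
  have "(\<lambda>q. (\<lambda>n q. \<Sum>i = 1..n. of_bool (snd q < mark (snd (fst q) i)) :: real) (fst (fst q)) q)
      \<in> borel_measurable ((measure_pmf f \<Otimes>\<^sub>M R) \<Otimes>\<^sub>M lborel)"
  proof (rule measurable_compose_countable[OF _ n])
    fix n :: nat
    show "(\<lambda>q. \<Sum>i = 1..n. of_bool (snd q < mark (snd (fst q) i)) :: real)
        \<in> borel_measurable ((measure_pmf f \<Otimes>\<^sub>M R) \<Otimes>\<^sub>M lborel)"
      by (rule borel_measurable_sum, rule measurable_compose[OF pr, where g = of_bool]) auto
  qed
  then show ?B by (simp add: P_eq case_prod_unfold count_above_def)
qed

lemma max_above_measurable [measurable]: "max_above x \<in> borel_measurable P"
  and count_above_measurable [measurable]: "count_above x \<in> borel_measurable P"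
  using measurable_compose[OF measurable_Pair2'[of x lborel P] above_measurable(1)]
    measurable_compose[OF measurable_Pair2'[of x lborel P] above_measurable(2)] by simp_all

text \<open>Given N = n the marks are independent with tail \<open>step_tail\<close>, so one of them
  exceeds x \<ge> 0 with probability \<open>1 - (1 - step_tail x) ^ n\<close>; averaging over n
  gives the right side of the fixed point equation for \<open>tail\<close>.\<close>

lemma max_above_expectation: "integrable P (max_above x)" "(\<integral>p. max_above x p \<partial>P) = tail x"
proof -
  show i: "integrable P (max_above x)"
    by (rule P.integrable_const_bound[where B = 1]) (auto simp: max_above_def)
  have "(\<integral>p. max_above x p \<partial>P) = (\<integral>n. (\<integral>z. max_above x (n, z) \<partial>R) \<partial>measure_pmf f)"
    unfolding P_eq using FR.integral_fst'[of "max_above x"] i by (simp add: P_eq)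
  also have "\<dots> = tail x"
  proof (cases "x < 0")
    case True
    then show ?thesis by (simp add: max_above_def tail_neg R.prob_space)
  next
    case False
    have "(\<integral>z. max_above x (n, z) \<partial>R) = 1 - (1 - step_tail x) ^ n" for n
    proof -
      let ?D = "{z\<in>space R. \<forall>i\<in>{1..n}. mark (z i) \<le> x}"
      have D: "?D \<in> sets R"
        by (intro sets.sets_Collect_finite_All borel_measurable_le) auto
      have "(\<integral>z. max_above x (n, z) \<partial>R) = (\<integral>z. 1 - indicator ?D z \<partial>R)"
        using False by (intro Bochner_Integration.integral_cong) (auto simp: max_above_def indicator_def not_le)
      also have "\<dots> = 1 - R.prob ?D"
        using D by (subst Bochner_Integration.integral_diff) (auto simp: R.prob_space R.emeasure_eq_measure)
      finally show ?thesis by (simp only: components_below)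
    qed
    then show ?thesis using False tail_fixed_point[of x] by (simp add: some_child_def step_tail_def)
  qed
  finally show "(\<integral>p. max_above x p \<partial>P) = tail x" .
qed

lemma count_above_expectation: "integrable P (count_above x)" "(\<integral>p. count_above x p \<partial>P) = EN * step_tail x"
proof -
  have ci: "integrable R (\<lambda>z. of_bool (x < mark (z i)) :: real)" if "1 \<le> i" for i
  proof (rule R.integrable_const_bound[where B = 1])
    have "Measurable.pred R (\<lambda>z. x < mark (z i))"
      by (rule borel_measurable_pred_less[OF _ mark_component[OF that]]) simp
    then show "(\<lambda>z. of_bool (x < mark (z i)) :: real) \<in> borel_measurable R"
      by (rule measurable_compose[where g = of_bool]) simp
  qed simp
  have c: "(\<integral>z. count_above x (n, z) \<partial>R) = real n * step_tail x" for n
  proof -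
    have "(\<integral>z. count_above x (n, z) \<partial>R) = (\<Sum>i = 1..n. \<integral>z. of_bool (x < mark (z i)) \<partial>R)"
      unfolding count_above_def fst_conv snd_conv
      by (rule Bochner_Integration.integral_sum) (rule ci, simp)
    also have "\<dots> = (\<Sum>i = 1..n. step_tail x)" by (rule sum.cong) (auto intro!: component_above)
    finally show ?thesis by simp
  qed
  have "integrable (measure_pmf f \<Otimes>\<^sub>M R) (count_above x)"
  proof (rule FR.Fubini_integrable)
    show "count_above x \<in> borel_measurable (measure_pmf f \<Otimes>\<^sub>M R)"
      using count_above_measurable[of x] by (simp add: P_eq)
    show "integrable (measure_pmf f) (\<lambda>n. \<integral>z. norm (count_above x (n, z)) \<partial>R)"
      using f_mean by (simp add: count_above_nonneg c)
    show "AE n in measure_pmf f. integrable R (\<lambda>z. count_above x (n, z))"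
      unfolding count_above_def fst_conv snd_conv
      by (intro AE_I2 Bochner_Integration.integrable_sum ci) simp
  qed
  then show i: "integrable P (count_above x)" by (simp add: P_eq)
  have "(\<integral>p. count_above x p \<partial>P) = (\<integral>n. (\<integral>z. count_above x (n, z) \<partial>R) \<partial>measure_pmf f)"
    unfolding P_eq using FR.integral_fst'[of "count_above x"] i by (simp add: P_eq)
  then show "(\<integral>p. count_above x p \<partial>P) = EN * step_tail x" by (simp add: c EN_def)
qed

text \<open>Fubini for the signed integrand \<open>G\<close>. Its absolute value is at most
  \<open>- G p x\<close> plus a term supported on x < 0; the mean of this bound over p involves only
  \<open>forcing\<close>, already known to be integrable, and an explicit exponential.\<close>

lemma max_minus_sum_expectation:
  "integrable P (max_minus_sum \<theta>)" "(\<integral>p. max_minus_sum \<theta> p \<partial>P) = \<theta> * (\<integral>x. forcing x \<partial>lborel)"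
proof -
  interpret PL: pair_sigma_finite P lborel ..
  interpret LP: pair_sigma_finite lborel P ..
  define G where "G p x = \<theta> * exp (\<theta> * x) * (max_above x p - count_above x p)" for p x
  have meas: "(\<lambda>(p, x). G p x) \<in> borel_measurable (P \<Otimes>\<^sub>M lborel)"
  proof -
    have [measurable]: "(\<lambda>q. max_above (snd q) (fst q)) \<in> borel_measurable (P \<Otimes>\<^sub>M lborel)"
      "(\<lambda>q. count_above (snd q) (fst q)) \<in> borel_measurable (P \<Otimes>\<^sub>M lborel)"
      using above_measurable by (simp_all add: case_prod_unfold)
    show ?thesis unfolding G_def case_prod_unfold by measurable
  qed
  have meas': "(\<lambda>(x, p). G p x) \<in> borel_measurable (lborel \<Otimes>\<^sub>M P)"
    using measurable_pair_swap[OF meas] by (simp add: case_prod_unfold)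
  have Gi: "integrable P (\<lambda>p. G p x)" for x
    unfolding G_def by (intro integrable_mult_right Bochner_Integration.integrable_diff max_above_expectation count_above_expectation)
  have Ge: "(\<integral>p. G p x \<partial>P) = \<theta> * forcing x" for x
    unfolding G_def by (simp add: max_above_expectation count_above_expectation forcing_def)
  have int': "integrable (lborel \<Otimes>\<^sub>M P) (\<lambda>(x, p). G p x)"
  proof (rule LP.Fubini_integrable[OF meas'])
    show "AE x in lborel. integrable P (\<lambda>p. case (x, p) of (x, p) \<Rightarrow> G p x)" using Gi by simp
    have "integrable lborel (\<lambda>x. \<integral>p. \<bar>G p x\<bar> \<partial>P)"
    proof (rule Bochner_Integration.integrable_bound)
      show "integrable lborel (\<lambda>x. - (\<theta> * forcing x) + 2 * (\<theta> * exp (\<theta> * x) * of_bool (x < 0)))"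
        by (intro Bochner_Integration.integrable_add integrable_minus integrable_mult_right forcing_integrable exp_layer_cake(1) theta)
      show "(\<lambda>x. \<integral>p. \<bar>G p x\<bar> \<partial>P) \<in> borel_measurable lborel"
        by (rule P.borel_measurable_lebesgue_integral) (use meas' in \<open>auto simp: case_prod_unfold\<close>)
      have "(\<integral>p. \<bar>G p x\<bar> \<partial>P) \<le> - (\<theta> * forcing x) + 2 * (\<theta> * exp (\<theta> * x) * of_bool (x < 0))" for x
      proof -
        have "\<bar>G p x\<bar> \<le> - G p x + 2 * (\<theta> * exp (\<theta> * x) * of_bool (x < 0))" for p
        proof -
          have "\<bar>G p x\<bar> = \<theta> * exp (\<theta> * x) * \<bar>max_above x p - count_above x p\<bar>"
            unfolding G_def abs_mult using theta by simp
          also have "\<dots> \<le> \<theta> * exp (\<theta> * x) * (count_above x p - max_above x p + 2 * of_bool (x < 0))"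
            using theta by (intro mult_left_mono abs_max_above_minus_count_above) auto
          finally show ?thesis by (simp add: G_def algebra_simps)
        qed
        then have "(\<integral>p. \<bar>G p x\<bar> \<partial>P) \<le> (\<integral>p. - G p x + 2 * (\<theta> * exp (\<theta> * x) * of_bool (x < 0)) \<partial>P)"
          using Gi by (intro integral_mono) auto
        also have "\<dots> = - (\<theta> * forcing x) + 2 * (\<theta> * exp (\<theta> * x) * of_bool (x < 0))"
          using Gi Ge P.prob_space by simp
        finally show ?thesis .
      qed
      moreover have "0 \<le> (\<integral>p. \<bar>G p x\<bar> \<partial>P)" for x by simp
      ultimately show "AE x in lborel. norm (\<integral>p. \<bar>G p x\<bar> \<partial>P) \<le> norm (- (\<theta> * forcing x) + 2 * (\<theta> * exp (\<theta> * x) * of_bool (x < 0)))"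
        by (intro AE_I2) (simp add: order_trans[OF _ abs_ge_self])
    qed
    then show "integrable lborel (\<lambda>x. \<integral>p. norm (case (x, p) of (x, p) \<Rightarrow> G p x) \<partial>P)" by simp
  qed
  have int: "integrable (P \<Otimes>\<^sub>M lborel) (\<lambda>(p, x). G p x)"
    using LP.integrable_product_swap[OF int'] by (simp add: case_prod_unfold)
  have eq: "max_minus_sum \<theta> p = (\<integral>x. G p x \<partial>lborel)" for p
    unfolding G_def by (rule max_minus_sum_layer_cake[OF theta])
  show "integrable P (max_minus_sum \<theta>)"
    using PL.integrable_fst'[OF int] by (simp add: eq[abs_def])
  have "(\<integral>p. max_minus_sum \<theta> p \<partial>P) = (\<integral>x. (\<integral>p. G p x \<partial>P) \<partial>lborel)"
    unfolding eq by (rule PL.Fubini_integral[symmetric]) (rule int)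
  then show "(\<integral>p. max_minus_sum \<theta> p \<partial>P) = \<theta> * (\<integral>x. forcing x \<partial>lborel)" by (simp add: Ge)
qed

end

theorem theorem3p4:
  fixes M :: "'a measure" and f :: "nat pmf" and B :: "real measure"
    and N :: "nat list \<Rightarrow> 'a \<Rightarrow> nat" and chi tau :: "nat list \<Rightarrow> 'a \<Rightarrow> real"
    and lam lams EN \<theta> \<epsilon> H :: real and W :: "'a \<Rightarrow> ereal"
  assumes "prob_space M"
    and f_pos: "set_pmf f \<subseteq> {1..}"
    and f_mean: "integrable (measure_pmf f) real"
    and B_prob: "prob_space B" "sets B = sets borel" and B_nonneg: "AE x in B. 0 \<le> x"
    and lam: "lam > 0"
  defines "EN \<equiv> measure_pmf.expectation f real"
  defines "lams \<equiv> lam * EN"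
  assumes N_law: "\<And>i. i \<in> nodes \<Longrightarrow> distr M (count_space UNIV) (N i) = measure_pmf f"
    and chi_law: "\<And>i. i \<in> nodes \<Longrightarrow> distr M borel (chi i) = B"
    and tau_law: "\<And>i. i \<in> nodes \<Longrightarrow> distributed M lborel (tau i) (exponential_density lams)"
    and indep: "prob_space.indep_vars M (\<lambda>_. borel)
      (case_sum (\<lambda>i \<omega>. real (N i \<omega>)) (case_sum chi tau)) (nodes <+> (nodes <+> nodes))"
    and theta: "\<theta> > 0"
    and exp_int: "integrable B (\<lambda>x. exp (\<theta> * x))"
    and root: "EN * (LINT x|B. exp (\<theta> * x)) * (lams / (lams + \<theta>)) = 1"
    and exp_id_int: "integrable B (\<lambda>x. exp (\<theta> * x) * x)"
    and deriv_pos: "0 < (LINT x|B. exp (\<theta> * x) * x) - (LINT x|B. exp (\<theta> * x)) / (lams + \<theta>)"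
    and eps: "\<epsilon> > 0"
    and N_moment: "integrable (measure_pmf f) (\<lambda>n. real n powr (max \<theta> (1 + \<epsilon>)))"
  defines "W \<equiv> endogenous N chi tau"
  defines "H \<equiv> (lams + \<theta>)\<^sup>2 / (\<theta> * lams * EN) *
      ((LINT y|copies f B lams (distr M borel W). max_minus_sum \<theta> y) /
       ((lams + \<theta>) * (LINT x|B. exp (\<theta> * x) * x) - (LINT x|B. exp (\<theta> * x))))"
  shows "integrable (copies f B lams (distr M borel W)) (max_minus_sum \<theta>)
    \<and> 0 < H
    \<and> (\<lambda>x. measure M {\<omega> \<in> space M. W \<omega> > ereal x}) \<sim>[at_top] (\<lambda>x. H * exp (- \<theta> * x))"
proof -
  \<comment> \<open>The defect estimate requires \<beta> \<le> 1, and
    \<open>1 + \<beta> \<le> 1 + \<epsilon>\<close> lets the assumed moment dominate, as N \<ge>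
    1.\<close>
  define \<beta> where "\<beta> = min 1 \<epsilon>"
  have \<beta>: "0 < \<beta>" "\<beta> \<le> 1" "1 + \<beta> \<le> max \<theta> (1 + \<epsilon>)" using eps by (auto simp: \<beta>_def)
  have moment: "integrable (measure_pmf f) (\<lambda>n. real n powr (1 + \<beta>))"
  proof (rule Bochner_Integration.integrable_bound[OF N_moment])
    have "real n powr (1 + \<beta>) \<le> real n powr (max \<theta> (1 + \<epsilon>))" if "n \<in> set_pmf f" for n
      using that f_pos \<beta>(3) by (intro powr_mono) auto
    then show "AE n in measure_pmf f. norm (real n powr (1 + \<beta>)) \<le> norm (real n powr (max \<theta> (1 + \<epsilon>)))"
      by (intro AE_pmfI) simp
  qed simp
  have EN1: "1 \<le> EN"
    unfolding EN_def by (rule measure_pmf.integral_ge_const[OF f_mean]) (use f_pos in \<open>auto intro!: AE_pmfI\<close>)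
  have lams: "0 < lams" using lam EN1 by (simp add: lams_def)
  interpret prob_space M by fact
  interpret lindley_tree M f B lams N chi tau
    by (intro lindley_tree.intro lindley_tree_axioms.intro \<open>prob_space M\<close> B_prob lams N_law chi_law tau_law indep)
  interpret C: cramer_lindley M f B lams N chi tau \<theta> \<beta> EN
    unfolding EN_def
    by (intro cramer_lindley.intro lindley_tree_axioms cramer_lindley_axioms.intro f_pos f_mean B_nonneg theta
      exp_int root[unfolded EN_def] exp_id_int deriv_pos \<beta>(1,2) moment)
  define c where "c = (\<integral>x. C.forcing x \<partial>lborel) / C.drift"
  \<comment> \<open>The expectation in \<open>H\<close> is \<theta> times the integral of
    \<open>forcing\<close>, the denominator below it is \<open>C.drift\<close> times
    \<open>?m * (lams + \<theta>)\<close>, and the root equation gives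
    \<open>?m = (lams + \<theta>) / (EN * lams)\<close>; the prefactor of \<open>H\<close> cancels
    all but the quotient \<open>c\<close>.\<close>
  have "H = c"
  proof -
    let ?A = "\<integral>x. exp (\<theta> * x) * x \<partial>B" and ?m = "\<integral>x. exp (\<theta> * x) \<partial>B"
    have m: "?m = (lams + \<theta>) / (EN * lams)" using root EN1 lams theta by (simp add: field_simps)
    have "(x / y - 1 / r) * (y * r) = r * x - y" if "0 < y" "0 < r" for x y r :: real
      using that by (simp add: field_simps)
    from this[OF C.mB_pos C.rate', of ?A]
    have D: "(lams + \<theta>) * ?A - ?m = C.drift * (?m * (lams + \<theta>))" by (simp add: C.drift_def)
    have "(lams + \<theta>)\<^sup>2 / (\<theta> * lams * EN) * (\<theta> * I / (d * ((lams + \<theta>) / (EN * lams) * (lams + \<theta>)))) = I / d" for I d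
      using EN1 lams theta C.rate' by (simp add: power2_eq_square)
    then show ?thesis
      unfolding H_def W_def C.max_minus_sum_expectation(2) D c_def by (simp only: m)
  qed
  have c: "0 < c" using C.limit_pos by (simp add: c_def)
  have "(C.tilted_tail \<longlongrightarrow> c) at_top" using C.tilted_tail_tendsto by (simp add: c_def)
  from tendsto_divide[OF this tendsto_const[of c]] c
  have "((\<lambda>x. C.tilted_tail x / c) \<longlongrightarrow> 1) at_top" by simp
  moreover have "C.tilted_tail x / c = tail x / (c * exp (- \<theta> * x))" for x
    by (simp add: C.tilted_tail_def exp_minus field_simps)
  ultimately have "tail \<sim>[at_top] (\<lambda>x. c * exp (- \<theta> * x))"
    by (intro asymp_equivI') simp
  then show ?thesis
    using C.max_minus_sum_expectation(1) c by (simp add: \<open>H = c\<close> W_def tail_def[abs_def])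
qed

end
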